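(* (1) The orbit closure of $X_1\cdots X_m$ is not normal if $m>2$. (2) The orbit closures of $\det_n$ and $\mathrm{per}_n$ are not normal if $n>2$.
   Context: Work over $\mathbb{C}$. $\mathrm{Sym}^D\mathbb{C}^N$ is the space of homogeneous polynomials of degree $D$ in $N$ variables with the natural action of $\mathrm{GL}_N$; the orbit closure of $w\in\mathrm{Sym}^D\mathbb{C}^N$ is the closure of $\mathrm{GL}_N w$ in $\mathrm{Sym}^D\mathbb{C}^N$, an affine variety. Here $X_1\cdots X_m\in\mathrm{Sym}^m\mathbb{C}^m$, and $\det_n=\sum_{\pi\in S_n}\mathrm{sgn}(\pi)X_{1,\pi(1)}\cdots X_{n,\pi(n)}$, $\mathrm{per}_n=\sum_{\pi\in S_n}X_{1,\pi(1)}\cdots X_{n,\pi(n)}$ are in $\mathrm{Sym}^n\mathbb{C}^{n^2}$ (so the orbits are under $\mathrm{GL}_m$ and $\mathrm{GL}_{n^2}$, respectively). *)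

theory Defs
  imports
    "HOL-Analysis.Determinants"
    "HOL-Algebra.Polynomials"
    "HOL-Library.Poly_Mapping"
    "HOL-Computational_Algebra.Polynomial"
begin

section \<open>Homogeneous polynomials and linear substitutions\<close>

text \<open>
  The variables of a polynomial ring are indexed by a finite type, so that the number \<open>N\<close> of
  variables is the cardinality of that type. A monomial is the finitely supported function of its
  exponents, and a polynomial is the finitely supported function of its coefficients; the
  multiplication of \<^theory>\<open>HOL-Library.Poly_Mapping\<close> is the convolution product.
\<close>

type_synonym 'v cpoly = "('v \<Rightarrow>\<^sub>0 nat) \<Rightarrow>\<^sub>0 complex"

definition Var :: "'v \<Rightarrow> 'v cpoly"
  where "Var i = Poly_Mapping.single (Poly_Mapping.single i 1) 1"

definition Const :: "complex \<Rightarrow> 'v cpoly"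
  where "Const c = Poly_Mapping.single 0 c"

definition Sym :: "nat \<Rightarrow> 'v::finite cpoly set"
  where "Sym D = {p. \<forall>m\<in>Poly_Mapping.keys p. (\<Sum>i\<in>UNIV. Poly_Mapping.lookup m i) = D}"

text \<open>
  The natural action of \<open>GL\<^sub>N\<close> on polynomials in the basis vectors \<open>X\<^sub>i\<close> of the standard
  representation: \<open>A\<close> sends \<open>X\<^sub>i\<close> to \<open>\<Sum>\<^sub>j A\<^sub>j\<^sub>i X\<^sub>j\<close> and acts by algebra homomorphisms.
\<close>

definition linear_form :: "complex ^ 'v ^ 'v \<Rightarrow> 'v \<Rightarrow> 'v::finite cpoly"
  where "linear_form A i = (\<Sum>j\<in>UNIV. Const (A $ j $ i) * Var j)"

definition gl_act :: "complex ^ 'v ^ 'v \<Rightarrow> 'v::finite cpoly \<Rightarrow> 'v cpoly"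
  where "gl_act A p = (\<Sum>m\<in>Poly_Mapping.keys p.
    Const (Poly_Mapping.lookup p m) * (\<Prod>i\<in>UNIV. linear_form A i ^ Poly_Mapping.lookup m i))"

definition gl_orbit :: "'v::finite cpoly \<Rightarrow> 'v cpoly set"
  where "gl_orbit w = {gl_act A w | A. invertible A}"


section \<open>Affine varieties in the space of forms\<close>

text \<open>
  Polynomial functions on \<open>Sym D\<close>: the functions generated by the linear coordinates, which are
  the coefficients of a form. (Coefficients at monomials of another degree vanish on \<open>Sym D\<close>.)
\<close>

inductive_set polynomial_maps :: "('v cpoly \<Rightarrow> complex) set" where
  const: "(\<lambda>_. c) \<in> polynomial_maps"
| coord: "(\<lambda>p. Poly_Mapping.lookup p m) \<in> polynomial_maps"
| add: "f \<in> polynomial_maps \<Longrightarrow> g \<in> polynomial_maps \<Longrightarrow> (\<lambda>p. f p + g p) \<in> polynomial_maps"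
| mult: "f \<in> polynomial_maps \<Longrightarrow> g \<in> polynomial_maps \<Longrightarrow> (\<lambda>p. f p * g p) \<in> polynomial_maps"

definition zariski_closed :: "nat \<Rightarrow> 'v::finite cpoly set \<Rightarrow> bool"
  where "zariski_closed D Z \<longleftrightarrow>
    (\<exists>F\<subseteq>polynomial_maps. Z = {p \<in> Sym D. \<forall>f\<in>F. f p = 0})"

definition zariski_closure :: "nat \<Rightarrow> 'v::finite cpoly set \<Rightarrow> 'v cpoly set"
  where "zariski_closure D S = \<Inter>{Z. zariski_closed D Z \<and> S \<subseteq> Z}"

definition orbit_closure :: "nat \<Rightarrow> 'v::finite cpoly \<Rightarrow> 'v cpoly set"
  where "orbit_closure D w = zariski_closure D (gl_orbit w)"

text \<open>The ring of polynomial functions restricted to a set, with pointwise operations.\<close>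

definition coordinate_ring :: "'v cpoly set \<Rightarrow> ('v cpoly \<Rightarrow> complex) ring"
  where "coordinate_ring Z =
    \<lparr> carrier = (\<lambda>f. restrict f Z) ` polynomial_maps,
      monoid.mult = (\<lambda>f g. \<lambda>p\<in>Z. f p * g p),
      one = (\<lambda>p\<in>Z. 1),
      zero = (\<lambda>p\<in>Z. 0),
      add = (\<lambda>f g. \<lambda>p\<in>Z. f p + g p) \<rparr>"


section \<open>Normality\<close>

definition frac_rel :: "('a, 'b) ring_scheme \<Rightarrow> (('a \<times> 'a) \<times> ('a \<times> 'a)) set"
  where "frac_rel R = {((a, b), (c, d)).
    a \<in> carrier R \<and> b \<in> carrier R - {\<zero>\<^bsub>R\<^esub>} \<and> c \<in> carrier R \<and> d \<in> carrier R - {\<zero>\<^bsub>R\<^esub>} \<and>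
    a \<otimes>\<^bsub>R\<^esub> d = c \<otimes>\<^bsub>R\<^esub> b}"

definition fraction :: "('a, 'b) ring_scheme \<Rightarrow> 'a \<Rightarrow> 'a \<Rightarrow> ('a \<times> 'a) set"
  where "fraction R a b = frac_rel R `` {(a, b)}"

definition fraction_field :: "('a, 'b) ring_scheme \<Rightarrow> ('a \<times> 'a) set ring"
  where "fraction_field R =
    \<lparr> carrier = (carrier R \<times> (carrier R - {\<zero>\<^bsub>R\<^esub>})) // frac_rel R,
      monoid.mult = (\<lambda>x y. \<Union>(a, b)\<in>x. \<Union>(c, d)\<in>y. fraction R (a \<otimes>\<^bsub>R\<^esub> c) (b \<otimes>\<^bsub>R\<^esub> d)),
      one = fraction R \<one>\<^bsub>R\<^esub> \<one>\<^bsub>R\<^esub>,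
      zero = fraction R \<zero>\<^bsub>R\<^esub> \<one>\<^bsub>R\<^esub>,
      add = (\<lambda>x y. \<Union>(a, b)\<in>x. \<Union>(c, d)\<in>y.
        fraction R (a \<otimes>\<^bsub>R\<^esub> d \<oplus>\<^bsub>R\<^esub> c \<otimes>\<^bsub>R\<^esub> b) (b \<otimes>\<^bsub>R\<^esub> d)) \<rparr>"

text \<open>
  Polynomials of \<^theory>\<open>HOL-Algebra.Polynomials\<close> are coefficient lists, leading coefficient first.
\<close>

definition integral_over :: "('a, 'b) ring_scheme \<Rightarrow> 'a set \<Rightarrow> 'a \<Rightarrow> bool"
  where "integral_over K S x \<longleftrightarrow>
    (\<exists>p. p \<in> carrier (S [X]\<^bsub>K\<^esub>) \<and> p \<noteq> [] \<and> Polynomials.lead_coeff p = \<one>\<^bsub>K\<^esub> \<and> ring.eval K p x = \<zero>\<^bsub>K\<^esub>)"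

definition integrally_closed_domain :: "('a, 'b) ring_scheme \<Rightarrow> bool"
  where "integrally_closed_domain R \<longleftrightarrow> domain R \<and>
    (let \<iota>R = (\<lambda>a. fraction R a \<one>\<^bsub>R\<^esub>) ` carrier R in
      \<forall>x\<in>carrier (fraction_field R). integral_over (fraction_field R) \<iota>R x \<longrightarrow> x \<in> \<iota>R)"

definition normal_variety :: "'v cpoly set \<Rightarrow> bool"
  where "normal_variety Z \<longleftrightarrow> integrally_closed_domain (coordinate_ring Z)"


section \<open>The forms in question\<close>

definition prod_form :: "'m::finite cpoly"
  where "prod_form = (\<Prod>i\<in>UNIV. Var i)"

definition det_form :: "('n::finite \<times> 'n) cpoly"
  where "det_form = (\<Sum>\<pi> | \<pi> permutes UNIV. of_int (sign \<pi>) * (\<Prod>i\<in>UNIV. Var (i, \<pi> i)))"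

definition per_form :: "('n::finite \<times> 'n) cpoly"
  where "per_form = (\<Sum>\<pi> | \<pi> permutes UNIV. \<Prod>i\<in>UNIV. Var (i, \<pi> i))"


section \<open>The fraction field is a field\<close>

context domain
begin

lemma frac_equiv: "equiv (carrier R \<times> (carrier R - {\<zero>})) (frac_rel R)"
proof (intro equivI)
  show "frac_rel R \<subseteq> (carrier R \<times> (carrier R - {\<zero>})) \<times> (carrier R \<times> (carrier R - {\<zero>}))"
    by (auto simp: frac_rel_def)
  show "refl_on (carrier R \<times> (carrier R - {\<zero>})) (frac_rel R)"
    by (auto simp: frac_rel_def refl_on_def)
  show "sym (frac_rel R)" by (auto simp: frac_rel_def sym_def)
  show "trans (frac_rel R)"
  proof (rule transI, clarsimp simp: frac_rel_def)
    fix a b c d e f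
    assume c: "a \<in> carrier R" "b \<in> carrier R" "c \<in> carrier R" "d \<in> carrier R" "e \<in> carrier R" "f \<in> carrier R"
      "d \<noteq> \<zero>" and e: "a \<otimes> d = c \<otimes> b" "c \<otimes> f = e \<otimes> d"
    have "d \<otimes> (a \<otimes> f) = (a \<otimes> d) \<otimes> f" using c by (simp add: m_ac)
    also have "\<dots> = (c \<otimes> f) \<otimes> b" using c e(1) by (simp add: m_ac)
    also have "\<dots> = d \<otimes> (e \<otimes> b)" using c e(2) by (simp add: m_ac)
    finally show "a \<otimes> f = e \<otimes> b" using c m_lcancel[of d] by simp
  qed
qed

lemma frac_eq_iff:
  assumes "a \<in> carrier R" "b \<in> carrier R - {\<zero>}" "c \<in> carrier R" "d \<in> carrier R - {\<zero>}"
  shows "fraction R a b = fraction R c d \<longleftrightarrow> a \<otimes> d = c \<otimes> b"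
  unfolding fraction_def using eq_equiv_class_iff[OF frac_equiv, of "(a, b)" "(c, d)"] assms
  by (simp add: frac_rel_def)

lemma fraction_field_carrier:
  "carrier (fraction_field R) = {fraction R a b | a b. a \<in> carrier R \<and> b \<in> carrier R - {\<zero>}}"
  by (auto simp: fraction_field_def fraction_def quotient_def)

lemma frac_op:
  assumes ab: "a \<in> carrier R" "b \<in> carrier R - {\<zero>}" "c \<in> carrier R" "d \<in> carrier R - {\<zero>}"
    and cong: "\<And>a' b' c' d'. ((a, b), (a', b')) \<in> frac_rel R \<Longrightarrow> ((c, d), (c', d')) \<in> frac_rel R
      \<Longrightarrow> h a' b' c' d' = h a b c d"
  shows "(\<Union>(a, b)\<in>fraction R a b. \<Union>(c, d)\<in>fraction R c d. h a b c d) = h a b c d"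
proof -
  have "(a, b) \<in> fraction R a b" "(c, d) \<in> fraction R c d" using ab by (auto simp: fraction_def frac_rel_def)
  moreover have "h a' b' c' d' = h a b c d" if "(a', b') \<in> fraction R a b" "(c', d') \<in> fraction R c d" for a' b' c' d'
    using that cong by (auto simp: fraction_def)
  ultimately show ?thesis by fast
qed

lemma frac_mult:
  assumes "a \<in> carrier R" "b \<in> carrier R - {\<zero>}" "c \<in> carrier R" "d \<in> carrier R - {\<zero>}"
  shows "fraction R a b \<otimes>\<^bsub>fraction_field R\<^esub> fraction R c d = fraction R (a \<otimes> c) (b \<otimes> d)"
proof -
  have "fraction R (a' \<otimes> c') (b' \<otimes> d') = fraction R (a \<otimes> c) (b \<otimes> d)"
    if "((a, b), (a', b')) \<in> frac_rel R" "((c, d), (c', d')) \<in> frac_rel R" for a' b' c' d'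
  proof -
    have C: "a' \<in> carrier R" "b' \<in> carrier R - {\<zero>}" "c' \<in> carrier R" "d' \<in> carrier R - {\<zero>}"
      and e: "a \<otimes> b' = a' \<otimes> b" "c \<otimes> d' = c' \<otimes> d" using that by (auto simp: frac_rel_def)
    have "(a' \<otimes> c') \<otimes> (b \<otimes> d) = (a' \<otimes> b) \<otimes> (c' \<otimes> d)" using C assms by (simp add: m_ac)
    also have "\<dots> = (a \<otimes> c) \<otimes> (b' \<otimes> d')" using C assms unfolding e[symmetric] by (simp add: m_ac)
    finally show ?thesis using C assms by (subst frac_eq_iff) (auto simp: integral_iff)
  qed
  then show ?thesis
    unfolding fraction_field_def using frac_op[OF assms, of "\<lambda>a b c d. fraction R (a \<otimes> c) (b \<otimes> d)"] by simp
qed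

lemma frac_add:
  assumes "a \<in> carrier R" "b \<in> carrier R - {\<zero>}" "c \<in> carrier R" "d \<in> carrier R - {\<zero>}"
  shows "fraction R a b \<oplus>\<^bsub>fraction_field R\<^esub> fraction R c d = fraction R (a \<otimes> d \<oplus> c \<otimes> b) (b \<otimes> d)"
proof -
  have "fraction R (a' \<otimes> d' \<oplus> c' \<otimes> b') (b' \<otimes> d') = fraction R (a \<otimes> d \<oplus> c \<otimes> b) (b \<otimes> d)"
    if "((a, b), (a', b')) \<in> frac_rel R" "((c, d), (c', d')) \<in> frac_rel R" for a' b' c' d'
  proof -
    have C: "a' \<in> carrier R" "b' \<in> carrier R - {\<zero>}" "c' \<in> carrier R" "d' \<in> carrier R - {\<zero>}"
      and e: "a \<otimes> b' = a' \<otimes> b" "c \<otimes> d' = c' \<otimes> d" using that by (auto simp: frac_rel_def)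
    have "(a' \<otimes> d' \<oplus> c' \<otimes> b') \<otimes> (b \<otimes> d) = (a' \<otimes> b) \<otimes> (d \<otimes> d') \<oplus> (c' \<otimes> d) \<otimes> (b \<otimes> b')"
      using C assms by (simp add: m_ac l_distr r_distr)
    also have "\<dots> = (a \<otimes> d \<oplus> c \<otimes> b) \<otimes> (b' \<otimes> d')"
      using C assms unfolding e[symmetric] by (simp add: m_ac l_distr r_distr)
    finally show ?thesis using C assms by (subst frac_eq_iff) (auto simp: integral_iff)
  qed
  then show ?thesis
    unfolding fraction_field_def
    using frac_op[OF assms, of "\<lambda>a b c d. fraction R (a \<otimes> d \<oplus> c \<otimes> b) (b \<otimes> d)"] by simp
qed

lemma fraction_field_cases:
  assumes "x \<in> carrier (fraction_field R)"
  obtains a b where "a \<in> carrier R" "b \<in> carrier R - {\<zero>}" "x = fraction R a b"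
  using assms fraction_field_carrier by auto

lemma fraction_field_one: "\<one>\<^bsub>fraction_field R\<^esub> = fraction R \<one> \<one>"
  and fraction_field_zero: "\<zero>\<^bsub>fraction_field R\<^esub> = fraction R \<zero> \<one>"
  by (auto simp: fraction_field_def)

lemma frac_in_carrier:
  "a \<in> carrier R \<Longrightarrow> b \<in> carrier R - {\<zero>} \<Longrightarrow> fraction R a b \<in> carrier (fraction_field R)"
  using fraction_field_carrier by auto

lemma fraction_field_field: "field (fraction_field R)"
proof (rule cring.cring_fieldI2)
  let ?K = "fraction_field R"
  note S = frac_mult frac_add frac_eq_iff integral_iff frac_in_carrier fraction_field_one fraction_field_zero
  show "cring ?K"
  proof (rule cringI)
    show "abelian_group ?K"
    proof (rule abelian_groupI)
      fix x y assume "x \<in> carrier ?K" "y \<in> carrier ?K"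
      then show "x \<oplus>\<^bsub>?K\<^esub> y \<in> carrier ?K"
        by (elim fraction_field_cases) (simp add: S)
    next
      fix x y z assume "x \<in> carrier ?K" "y \<in> carrier ?K" "z \<in> carrier ?K"
      then show "x \<oplus>\<^bsub>?K\<^esub> y \<oplus>\<^bsub>?K\<^esub> z = x \<oplus>\<^bsub>?K\<^esub> (y \<oplus>\<^bsub>?K\<^esub> z)"
        by (elim fraction_field_cases) (simp add: S m_ac a_ac l_distr r_distr)
    next
      fix x y assume "x \<in> carrier ?K" "y \<in> carrier ?K"
      then show "x \<oplus>\<^bsub>?K\<^esub> y = y \<oplus>\<^bsub>?K\<^esub> x"
        by (elim fraction_field_cases) (simp add: S m_ac a_ac l_distr r_distr)
    next
      fix x assume "x \<in> carrier ?K"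
      then show "\<zero>\<^bsub>?K\<^esub> \<oplus>\<^bsub>?K\<^esub> x = x" 
        by (elim fraction_field_cases) (simp add: S)
    next
      fix x assume "x \<in> carrier ?K"
      then obtain a b where "a \<in> carrier R" "b \<in> carrier R - {\<zero>}" "x = fraction R a b"
        by (rule fraction_field_cases)
      then show "\<exists>y\<in>carrier ?K. y \<oplus>\<^bsub>?K\<^esub> x = \<zero>\<^bsub>?K\<^esub>"
        by (intro bexI[of _ "fraction R (\<ominus> a) b"]) (simp_all add: S l_minus l_neg)
    qed (simp add: S)
    show "comm_monoid ?K"
    proof (rule comm_monoidI)
      fix x y assume "x \<in> carrier ?K" "y \<in> carrier ?K"
      then show "x \<otimes>\<^bsub>?K\<^esub> y \<in> carrier ?K" "x \<otimes>\<^bsub>?K\<^esub> y = y \<otimes>\<^bsub>?K\<^esub> x"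
        by (elim fraction_field_cases, simp add: S m_ac)+
    next
      fix x y z assume "x \<in> carrier ?K" "y \<in> carrier ?K" "z \<in> carrier ?K"
      then show "x \<otimes>\<^bsub>?K\<^esub> y \<otimes>\<^bsub>?K\<^esub> z = x \<otimes>\<^bsub>?K\<^esub> (y \<otimes>\<^bsub>?K\<^esub> z)"
        by (elim fraction_field_cases) (simp add: S m_ac)
    next
      fix x assume "x \<in> carrier ?K"
      then show "\<one>\<^bsub>?K\<^esub> \<otimes>\<^bsub>?K\<^esub> x = x" 
        by (elim fraction_field_cases) (simp add: S)
    qed (simp add: S)
    fix x y z assume "x \<in> carrier ?K" "y \<in> carrier ?K" "z \<in> carrier ?K"
    then show "(x \<oplus>\<^bsub>?K\<^esub> y) \<otimes>\<^bsub>?K\<^esub> z = x \<otimes>\<^bsub>?K\<^esub> z \<oplus>\<^bsub>?K\<^esub> y \<otimes>\<^bsub>?K\<^esub> z"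
      by (elim fraction_field_cases) (simp add: S m_ac a_ac l_distr r_distr)
  qed
  show "\<zero>\<^bsub>?K\<^esub> \<noteq> \<one>\<^bsub>?K\<^esub>" by (simp add: S)
  fix x assume x: "x \<in> carrier ?K" "x \<noteq> \<zero>\<^bsub>?K\<^esub>"
  then obtain a b where ab: "a \<in> carrier R" "b \<in> carrier R - {\<zero>}" "x = fraction R a b"
    using fraction_field_cases[OF x(1)] by metis
  then have "a \<noteq> \<zero>" using x(2) by (auto simp: S)
  then show "\<exists>y\<in>carrier ?K. x \<otimes>\<^bsub>?K\<^esub> y = \<one>\<^bsub>?K\<^esub>"
    using ab by (intro bexI[of _ "fraction R b a"]) (simp_all add: S m_comm)
qed

end


section \<open>Irreducibility of orbit closures\<close>

text \<open>
  For every form \<open>w\<close>, the coordinate ring of its orbit closure is a domain, so that failure of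
  \<^const>\<open>normal_variety\<close> can only be a failure of integral closedness. Two invertible matrices
  lie on a line in the space of matrices, which reduces the claim to polynomials in one variable.
\<close>

lemma Sym_mult:
  assumes "p \<in> Sym d" "q \<in> Sym e"
  shows "p * q \<in> Sym (d + e)"
proof -
  have "(\<Sum>i\<in>UNIV. Poly_Mapping.lookup m i) = d + e" if m: "m \<in> Poly_Mapping.keys (p * q)" for m
  proof -
    obtain a b where "a \<in> Poly_Mapping.keys p" "b \<in> Poly_Mapping.keys q" "m = a + b"
      using m keys_mult[of p q] by blast
    then show ?thesis using assms by (simp add: Sym_def lookup_add sum.distrib)
  qed
  then show ?thesis by (simp add: Sym_def)
qed

lemma Sym_add: "p \<in> Sym d \<Longrightarrow> q \<in> Sym d \<Longrightarrow> p + q \<in> Sym d"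
  using keys_add[of p q] by (auto simp: Sym_def)

lemma Sym_0: "0 \<in> Sym d"
  by (simp add: Sym_def)

lemma Sym_sum: "(\<And>x. x \<in> T \<Longrightarrow> f x \<in> Sym d) \<Longrightarrow> sum f T \<in> Sym d"
  by (induction T rule: infinite_finite_induct) (auto simp: Sym_add Sym_0)

lemma Sym_Const: "Const c \<in> Sym 0"
  by (auto simp: Sym_def Const_def)

lemma Sym_one: "1 \<in> Sym 0"
  by (auto simp: Sym_def)

lemma Sym_Var: "Var i \<in> Sym 1"
  by (auto simp: Sym_def Var_def lookup_single when_def)

lemma Sym_prod: "(\<And>x. x \<in> T \<Longrightarrow> f x \<in> Sym (d x)) \<Longrightarrow> finite T \<Longrightarrow> prod f T \<in> Sym (sum d T)"
  by (induction T rule: infinite_finite_induct) (auto simp: Sym_mult Sym_one)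

lemma Sym_power: "p \<in> Sym d \<Longrightarrow> p ^ k \<in> Sym (d * k)"
  by (induction k) (auto simp: Sym_mult Sym_one)

lemma gl_act_Sym:
  assumes "w \<in> Sym D"
  shows "gl_act A w \<in> Sym D"
proof -
  have lf: "linear_form A i \<in> Sym 1" for i
    unfolding linear_form_def using Sym_mult[OF Sym_Const Sym_Var] by (intro Sym_sum) simp
  show ?thesis unfolding gl_act_def
  proof (rule Sym_sum)
    fix m assume "m \<in> Poly_Mapping.keys w"
    then have D: "(\<Sum>i\<in>UNIV. Poly_Mapping.lookup m i) = D" using assms by (simp add: Sym_def)
    have "(\<Prod>i\<in>UNIV. linear_form A i ^ Poly_Mapping.lookup m i) \<in> Sym D"
      using Sym_prod[of UNIV "\<lambda>i. linear_form A i ^ Poly_Mapping.lookup m i" "Poly_Mapping.lookup m"]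
        Sym_power[OF lf] D by simp
    from Sym_mult[OF Sym_Const this]
    show "Const (Poly_Mapping.lookup w m) * (\<Prod>i\<in>UNIV. linear_form A i ^ Poly_Mapping.lookup m i) \<in> Sym D"
      by simp
  qed
qed

lemma prod_form_Sym: "(prod_form :: 'm::finite cpoly) \<in> Sym CARD('m)"
  unfolding prod_form_def using Sym_prod[of "UNIV :: 'm set" Var "\<lambda>_. 1", OF Sym_Var] by simp

lemma per_form_Sym: "(per_form :: ('n::finite \<times> 'n) cpoly) \<in> Sym CARD('n)"
  unfolding per_form_def
  using Sym_prod[of "UNIV :: 'n set" "\<lambda>i. Var (i, \<pi> i)" "\<lambda>_. 1" for \<pi>, OF Sym_Var]
  by (intro Sym_sum) simp

lemma det_form_Sym: "(det_form :: ('n::finite \<times> 'n) cpoly) \<in> Sym CARD('n)"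
  unfolding det_form_def
proof (rule Sym_sum)
  fix \<pi> :: "'n \<Rightarrow> 'n"
  have "(\<Prod>i\<in>UNIV. Var (i, \<pi> i)) \<in> Sym CARD('n)"
    using Sym_prod[of "UNIV :: 'n set" "\<lambda>i. Var (i, \<pi> i)" "\<lambda>_. 1", OF Sym_Var] by simp
  moreover have "of_int (sign \<pi>) \<in> (Sym 0 :: ('n \<times> 'n) cpoly set)"
    using Sym_Const[of "-1"] by (auto simp: sign_def Sym_one Sym_def)
  ultimately show "of_int (sign \<pi>) * (\<Prod>i\<in>UNIV. Var (i, \<pi> i)) \<in> Sym CARD('n)"
    using Sym_mult by fastforce
qed

text \<open>A polynomial curve; \<open>K\<close> embeds the scalars into the target.\<close>

definition curve :: "(complex \<Rightarrow> 'a::comm_ring_1) \<Rightarrow> (complex \<Rightarrow> 'a) \<Rightarrow> bool"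
  where "curve K P \<longleftrightarrow> (\<exists>n c. \<forall>t. P t = (\<Sum>k\<le>n. K (t ^ k) * c k))"

locale scalar =
  fixes K :: "complex \<Rightarrow> 'a::comm_ring_1"
  assumes K_add: "K (s + t) = K s + K t" and K_mult: "K (s * t) = K s * K t" and K_1: "K 1 = 1"
begin

lemma K_pow: "K (s ^ k) = K s ^ k"
  by (induction k) (auto simp: K_1 K_mult)

lemma curve_iff: "curve K P \<longleftrightarrow> (\<exists>q. \<forall>t. P t = poly q (K t))"
proof
  assume "curve K P"
  then obtain n c where "\<forall>t. P t = (\<Sum>k\<le>n. K (t ^ k) * c k)" by (auto simp: curve_def)
  then have "\<forall>t. P t = poly (\<Sum>k\<le>n. Polynomial.monom (c k) k) (K t)"
    by (simp add: poly_sum poly_monom K_pow mult.commute)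
  then show "\<exists>q. \<forall>t. P t = poly q (K t)" by blast
next
  assume "\<exists>q. \<forall>t. P t = poly q (K t)"
  then obtain q where q: "\<And>t. P t = poly q (K t)" by blast
  show "curve K P" unfolding curve_def q
    by (intro exI[of _ "Polynomial.degree q"] exI[of _ "Polynomial.coeff q"]) (simp add: poly_altdef K_pow mult.commute)
qed

lemma curve_const: "curve K (\<lambda>_. c)"
  unfolding curve_iff by (intro exI[of _ "[:c:]"]) simp

lemma curve_K: "curve K K"
  unfolding curve_iff by (intro exI[of _ "[:0, 1:]"]) simp

lemma curve_add: "curve K P \<Longrightarrow> curve K Q \<Longrightarrow> curve K (\<lambda>t. P t + Q t)"
  unfolding curve_iff by (metis poly_add)

lemma curve_mult: "curve K P \<Longrightarrow> curve K Q \<Longrightarrow> curve K (\<lambda>t. P t * Q t)"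
  unfolding curve_iff by (metis poly_mult)

lemma curve_sum: "(\<And>x. x \<in> T \<Longrightarrow> curve K (f x)) \<Longrightarrow> curve K (\<lambda>t. \<Sum>x\<in>T. f x t)"
  by (induction T rule: infinite_finite_induct) (auto simp: curve_add curve_const)

lemma curve_prod: "(\<And>x. x \<in> T \<Longrightarrow> curve K (f x)) \<Longrightarrow> curve K (\<lambda>t. \<Prod>x\<in>T. f x t)"
  by (induction T rule: infinite_finite_induct) (auto simp: curve_mult curve_const)

lemma curve_power: "curve K P \<Longrightarrow> curve K (\<lambda>t. P t ^ k)"
  by (induction k) (auto simp: curve_mult curve_const)

end

interpretation cid: scalar "\<lambda>t. t :: complex"
  by standard auto

interpretation cpl: scalar "Const :: complex \<Rightarrow> 'v cpoly"
  by standard (auto simp: Const_def single_add mult_single)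

lemma curve_gl_act:
  "curve Const (\<lambda>t. gl_act (A + (\<chi> i j. t * B $ i $ j)) w)" for A B :: "complex ^ 'v ^ 'v::finite"
proof -
  have "curve Const (\<lambda>t. Const (A $ j $ i + t * B $ j $ i) :: 'v cpoly)" for i j
    unfolding cpl.K_add cpl.K_mult by (intro cpl.curve_add cpl.curve_mult cpl.curve_const cpl.curve_K)
  then show ?thesis unfolding gl_act_def linear_form_def
    by (intro cpl.curve_sum cpl.curve_mult cpl.curve_const cpl.curve_prod cpl.curve_power) simp
qed


lemma lookup_Const_mult: "Poly_Mapping.lookup (Const c * p) m = c * Poly_Mapping.lookup p m"
  unfolding Const_def mult_map_scale_conv_mult[symmetric]
  by (simp add: Poly_Mapping.map.rep_eq when_def)

lemma curve_polynomial_map: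
  assumes "f \<in> polynomial_maps" "curve Const P"
  shows "curve (\<lambda>t. t) (\<lambda>t. f (P t))"
  using assms(1)
proof induction
  case (coord m)
  obtain n c where P: "\<And>t. P t = (\<Sum>k\<le>n. Const (t ^ k) * c k)"
    using assms(2) by (auto simp: curve_def)
  show ?case unfolding curve_def P
    by (intro exI[of _ n] exI[of _ "\<lambda>k. Poly_Mapping.lookup (c k) m"]) (simp add: lookup_sum lookup_Const_mult)
qed (auto intro: cid.curve_const cid.curve_add cid.curve_mult)

lemma curve_mult_zero:
  assumes "curve (\<lambda>t. t) P" "curve (\<lambda>t. t) Q" "\<And>t. P t * Q t = (0::complex)"
  shows "(\<forall>t. P t = 0) \<or> (\<forall>t. Q t = 0)"
proof -
  obtain p q where pq: "\<And>t. P t = poly p t" "\<And>t. Q t = poly q t"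
    using assms(1,2) unfolding cid.curve_iff by blast
  then have "\<forall>t. poly (p * q) t = 0" using assms(3) by simp
  then have "p * q = 0" using poly_all_0_iff_0 by blast
  then show ?thesis using pq by auto
qed

lemma gl_orbit_irreducible:
  fixes w :: "'v::finite cpoly"
  assumes f: "f \<in> polynomial_maps" and g: "g \<in> polynomial_maps"
    and fg: "\<And>p. p \<in> gl_orbit w \<Longrightarrow> f p * g p = 0"
  shows "(\<forall>p\<in>gl_orbit w. f p = 0) \<or> (\<forall>p\<in>gl_orbit w. g p = 0)"
proof (rule ccontr)
  assume "\<not> ?thesis"
  then obtain A A' where A: "invertible A" "f (gl_act A w) \<noteq> 0"
    and A': "invertible A'" "g (gl_act A' w) \<noteq> 0"
    unfolding gl_orbit_def by blast
  define M where "M t = A + (\<chi> i j. t * (A' - A) $ i $ j)" for t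
  have M: "M 0 = A" "M 1 = A'" by (auto simp: M_def vec_eq_iff)
  have cf: "curve (\<lambda>t. t) (\<lambda>t. f (gl_act (M t) w))" and cg: "curve (\<lambda>t. t) (\<lambda>t. g (gl_act (M t) w))"
    unfolding M_def by (intro curve_polynomial_map f g curve_gl_act)+
  have cd: "curve (\<lambda>t. t) (\<lambda>t. det (M t))"
    unfolding det_def M_def
    by (simp, intro cid.curve_sum cid.curve_mult cid.curve_const cid.curve_prod cid.curve_add cid.curve_K)
  have "det (M t) * (f (gl_act (M t) w) * g (gl_act (M t) w)) = 0" for t
    using fg[of "gl_act (M t) w"] unfolding gl_orbit_def by (auto simp: invertible_det_nz)
  from curve_mult_zero[OF cd cid.curve_mult[OF cf cg] this]
  have "\<forall>t. f (gl_act (M t) w) * g (gl_act (M t) w) = 0"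
    using A(1) M by (metis invertible_det_nz)
  then show False using curve_mult_zero[OF cf cg] A A' M by metis
qed

lemma zero_on_orbit_closure:
  assumes "w \<in> Sym D" "f \<in> polynomial_maps" "\<And>p. p \<in> gl_orbit w \<Longrightarrow> f p = 0" "p \<in> orbit_closure D w"
  shows "f p = 0"
proof -
  have "zariski_closed D {p \<in> Sym D. f p = 0}"
    unfolding zariski_closed_def using assms(2) by (intro exI[of _ "{f}"]) auto
  moreover have "gl_orbit w \<subseteq> {p \<in> Sym D. f p = 0}"
    using assms(1,3) gl_act_Sym unfolding gl_orbit_def by blast
  ultimately show ?thesis using assms(4) unfolding orbit_closure_def zariski_closure_def by blast
qed

lemma gl_orbit_subset_closure: "gl_orbit w \<subseteq> orbit_closure D w"
  unfolding orbit_closure_def zariski_closure_def by blast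

lemma coordinate_ring_cring: "cring (coordinate_ring Z)"
proof -
  let ?R = "coordinate_ring Z"
  have car: "carrier ?R = (\<lambda>f. restrict f Z) ` polynomial_maps" by (simp add: coordinate_ring_def)
  have inC: "h \<in> carrier ?R" if "f \<in> polynomial_maps" "h = restrict f Z" for f h
    using that car by blast
  show ?thesis
  proof (rule cringI)
    show "abelian_group ?R"
    proof (rule abelian_groupI)
      fix x y assume "x \<in> carrier ?R" "y \<in> carrier ?R"
      then obtain f g where "f \<in> polynomial_maps" "g \<in> polynomial_maps" "x = restrict f Z" "y = restrict g Z"
        unfolding car by blast
      then show "x \<oplus>\<^bsub>?R\<^esub> y \<in> carrier ?R"
        by (intro inC[OF polynomial_maps.add[of f g]]) (auto simp: coordinate_ring_def)
    next
      show "\<zero>\<^bsub>?R\<^esub> \<in> carrier ?R"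
        by (intro inC[OF polynomial_maps.const[of 0]]) (auto simp: coordinate_ring_def)
    next
      fix x assume "x \<in> carrier ?R"
      then obtain f where f: "f \<in> polynomial_maps" "x = restrict f Z" unfolding car by blast
      then have "restrict (\<lambda>p. (-1) * f p) Z \<in> carrier ?R"
        by (intro inC[OF polynomial_maps.mult[OF polynomial_maps.const[of "-1"]]]) auto
      then show "\<exists>y\<in>carrier ?R. y \<oplus>\<^bsub>?R\<^esub> x = \<zero>\<^bsub>?R\<^esub>"
        by (rule bexI[rotated]) (auto simp: coordinate_ring_def f)
    qed (auto simp: coordinate_ring_def add.assoc add.commute fun_eq_iff restrict_def)
    show "comm_monoid ?R"
    proof (rule comm_monoidI)
      fix x y assume "x \<in> carrier ?R" "y \<in> carrier ?R"
      then obtain f g where "f \<in> polynomial_maps" "g \<in> polynomial_maps" "x = restrict f Z" "y = restrict g Z"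
        unfolding car by blast
      then show "x \<otimes>\<^bsub>?R\<^esub> y \<in> carrier ?R"
        by (intro inC[OF polynomial_maps.mult[of f g]]) (auto simp: coordinate_ring_def)
    next
      show "\<one>\<^bsub>?R\<^esub> \<in> carrier ?R"
        by (intro inC[OF polynomial_maps.const[of 1]]) (auto simp: coordinate_ring_def)
    qed (auto simp: coordinate_ring_def mult.assoc mult.commute fun_eq_iff restrict_def)
  qed (auto simp: coordinate_ring_def fun_eq_iff algebra_simps)
qed

lemma coordinate_ring_orbit_closure_domain:
  assumes w: "w \<in> Sym D"
  shows "domain (coordinate_ring (orbit_closure D w))"
proof -
  let ?Z = "orbit_closure D w"
  let ?R = "coordinate_ring ?Z"
  interpret cring ?R by (rule coordinate_ring_cring)
  show ?thesis
  proof unfold_locales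
    have "invertible (mat 1 :: complex ^ 'a ^ 'a)" by (simp add: invertible_det_nz)
    then obtain p where "p \<in> ?Z" using gl_orbit_subset_closure[of w D] unfolding gl_orbit_def by blast
    then show "\<one>\<^bsub>?R\<^esub> \<noteq> \<zero>\<^bsub>?R\<^esub>"
      by (auto simp: coordinate_ring_def fun_eq_iff restrict_def intro!: exI[of _ p])
  next
    fix x y assume xy: "x \<otimes>\<^bsub>?R\<^esub> y = \<zero>\<^bsub>?R\<^esub>" "x \<in> carrier ?R" "y \<in> carrier ?R"
    obtain f g where fg: "f \<in> polynomial_maps" "g \<in> polynomial_maps" "x = restrict f ?Z" "y = restrict g ?Z"
      using xy(2,3) by (auto simp: coordinate_ring_def)
    have "f p * g p = 0" if "p \<in> ?Z" for p
      using fun_cong[OF xy(1), of p] that fg by (simp add: coordinate_ring_def)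
    then have "(\<forall>p\<in>gl_orbit w. f p = 0) \<or> (\<forall>p\<in>gl_orbit w. g p = 0)"
      using gl_orbit_subset_closure[of w D] fg by (intro gl_orbit_irreducible) auto
    then have "(\<forall>p\<in>?Z. f p = 0) \<or> (\<forall>p\<in>?Z. g p = 0)"
      using zero_on_orbit_closure[OF w] fg by blast
    then show "x = \<zero>\<^bsub>?R\<^esub> \<or> y = \<zero>\<^bsub>?R\<^esub>"
      using fg by (auto simp: coordinate_ring_def fun_eq_iff)
  qed
qed

end

theory Submission
  imports Defs "HOL-Library.FuncSet"
begin

text \<open>Let \<open>w\<close> be one of the forms, of degree \<open>D > 2\<close> in \<open>N\<close> variables. In all three cases \<open>(det g)\<^sup>2\<close>
  depends only on \<open>g w\<close>, and it contradicts normality: it is a rational function on the orbit closure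
  and integral over the regular functions, but it is not regular.

  It is integral because the monomials of \<open>w\<close> have constant total weight for some ordering of the
  variables and some of them partition the variables: contracting the tensor of \<open>g w\<close> with suitable
  products of minors of \<open>g\<close> shows that \<open>det g\<close> maps the finitely generated module spanned by
  products of flag minors to itself.

  It is not regular because a regular function is a combination of products of values \<open>(g w)(z)\<close>. By
  homogeneity only \<open>2 N / D < N\<close> factors can occur, and a form in the entries of \<open>g\<close> built from fewer
  than \<open>N\<close> vectors \<open>z\<close> is orthogonal to \<open>\<Prod>\<^sub>a g\<^sub>a\<^sub>a \<cdot> det g\<close>, whereas \<open>(det g)\<^sup>2\<close> is not.

  It is rational for the product of the variables and for the permanent because only diagonal
  derivations annihilate \<open>w\<close>: if \<open>g w = h w\<close> then conjugation by \<open>g\<^sup>-\<^sup>1 h\<close> preserves these, so \<open>g\<^sup>-\<^sup>1 h\<close> is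
  monomial and its determinant squares to 1. This is carried out modulo the ideal of the relation
  \<open>g w = h w\<close>, which yields rationality by descent. For the determinant, \<open>(det g)\<^sup>2\<close> is read off from
  the Gram determinant of a trace form.\<close>

text \<open>The square is forced: exchanging two variables fixes \<open>prod_form\<close> and has
  determinant -1, so \<open>det g\<close> itself is no function of \<open>g w\<close>. Constancy of
  \<open>(det g)^2\<close> on the fibres of \<open>g \<mapsto> g w\<close> is not yet rationality.
  Hence the pair \<open>(g, h)\<close> is treated in the ring of separable functions modulo the
  relations \<open>g w = h w\<close>. This quotient is not known to be a domain, so "an entry
  vanishes" becomes "a product of two entries lies in the ideal", and no monomial matrix is ever
  exhibited. Descent is then linear algebra over the fraction field of the regular functions, for
  which arbitrary complex functions of \<open>g\<close> will do. The determinant is annihilated by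
  all \<open>X \<mapsto> A X + X B\<close> with \<open>tr A + tr B = 0\<close>, so diagonal
  derivations do not suffice there and numerator and denominator are made explicit. For integrality
  there is one minor of each size 0, ..., N - 1, as many as variables; multiplication by
  \<open>det g\<close> raises each size by one, and a block of the partition pays for its D raises
  with one contraction against the tensor of \<open>g w\<close>.\<close>

unbundle no m_inv_syntax

section \<open>Quotients of regular functions on an orbit closure\<close>

text \<open>Being polynomial along every line is all that is used of polynomials in the matrix
  entries: matrices are compared two at a time, without a polynomial ring in N^2 variables.\<close>

definition line_poly :: "(complex ^ 'v ^ 'v \<Rightarrow> complex) \<Rightarrow> bool"
  where "line_poly \<phi> \<longleftrightarrow> (\<forall>A B. curve (\<lambda>t. t) (\<lambda>t. \<phi> (A + (\<chi> i j. t * B $ i $ j))))"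

lemma line_poly_const: "line_poly (\<lambda>_. c)"
  by (simp add: line_poly_def cid.curve_const)

lemma line_poly_add: "line_poly \<phi> \<Longrightarrow> line_poly \<psi> \<Longrightarrow> line_poly (\<lambda>g. \<phi> g + \<psi> g)"
  by (simp add: line_poly_def cid.curve_add)

lemma line_poly_mult: "line_poly \<phi> \<Longrightarrow> line_poly \<psi> \<Longrightarrow> line_poly (\<lambda>g. \<phi> g * \<psi> g)"
  by (simp add: line_poly_def cid.curve_mult)

lemma line_poly_power: "line_poly \<phi> \<Longrightarrow> line_poly (\<lambda>g. \<phi> g ^ k)"
  by (simp add: line_poly_def cid.curve_power)

lemma line_poly_diff: "line_poly \<phi> \<Longrightarrow> line_poly \<psi> \<Longrightarrow> line_poly (\<lambda>g. \<phi> g - \<psi> g)"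
  using line_poly_add[of \<phi> "\<lambda>g. (-1) * \<psi> g"] line_poly_mult[OF line_poly_const[of "-1"], of \<psi>] by simp

lemma line_poly_det: "line_poly (\<lambda>g. det g)"
  unfolding line_poly_def det_def
  by (simp, intro allI cid.curve_sum cid.curve_mult cid.curve_const cid.curve_prod cid.curve_add cid.curve_K)

lemma line_poly_orbit: "f \<in> polynomial_maps \<Longrightarrow> line_poly (\<lambda>g. f (gl_act g w))"
  unfolding line_poly_def by (intro allI curve_polynomial_map curve_gl_act)

text \<open>The line through \<open>g0\<close> and \<open>g\<close> reduces the claim to the absence
  of zero divisors among polynomials in one variable.\<close>

lemma line_poly_mult_zero:
  assumes "line_poly \<phi>" "line_poly \<psi>" "\<And>g. \<phi> g * \<psi> g = 0" "\<phi> g0 \<noteq> 0"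
  shows "\<psi> g = 0"
proof -
  define M where "M t = g0 + (\<chi> i j. t * (g - g0) $ i $ j)" for t
  have M: "M 0 = g0" "M 1 = g" by (auto simp: M_def vec_eq_iff)
  have "curve (\<lambda>t. t) (\<lambda>t. \<phi> (M t))" "curve (\<lambda>t. t) (\<lambda>t. \<psi> (M t))"
    using assms(1,2) unfolding M_def line_poly_def by blast+
  from curve_mult_zero[OF this assms(3)] show ?thesis using assms(4) M by metis
qed

text \<open>Density of the invertible matrices: \<open>det g * \<phi> g\<close> vanishes everywhere,
  and \<open>det\<close> is not identically zero.\<close>

lemma line_poly_zero_if_invertible:
  assumes "line_poly \<phi>" "\<And>g. invertible g \<Longrightarrow> \<phi> g = 0"
  shows "\<phi> g = 0"
proof (rule line_poly_mult_zero[OF line_poly_det assms(1)])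
  show "det g * \<phi> g = 0" for g using assms(2)[of g] by (auto simp: invertible_det_nz)
  show "det (mat 1 :: complex ^ 'a ^ 'a) \<noteq> 0" by simp
qed

lemma polynomial_maps_sum:
  "(\<And>x. x \<in> S \<Longrightarrow> f x \<in> polynomial_maps) \<Longrightarrow> (\<lambda>p. \<Sum>x\<in>S. f x p) \<in> polynomial_maps"
  by (induction S rule: infinite_finite_induct) (auto intro: polynomial_maps.intros)

lemma polynomial_maps_prod:
  "(\<And>x. x \<in> S \<Longrightarrow> f x \<in> polynomial_maps) \<Longrightarrow> (\<lambda>p. \<Prod>x\<in>S. f x p) \<in> polynomial_maps"
  by (induction S rule: infinite_finite_induct) (auto intro: polynomial_maps.intros)

lemma polynomial_maps_power: "f \<in> polynomial_maps \<Longrightarrow> (\<lambda>p. f p ^ k) \<in> polynomial_maps"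
  by (induction k) (auto intro: polynomial_maps.intros)

lemma polynomial_maps_diff:
  "f \<in> polynomial_maps \<Longrightarrow> g \<in> polynomial_maps \<Longrightarrow> (\<lambda>p. f p - g p) \<in> polynomial_maps"
  using polynomial_maps.add[of f "\<lambda>p. (-1) * g p"] polynomial_maps.mult[OF polynomial_maps.const[of "-1"], of g] by simp

text \<open>Numerator of the Horner evaluation of a coefficient list, leading coefficient first, at \<open>P / Q\<close>,
  over the denominator \<open>Q ^ length rs\<close>.\<close>

fun horner_num :: "('p \<Rightarrow> complex) \<Rightarrow> ('p \<Rightarrow> complex) \<Rightarrow> ('p \<Rightarrow> complex) list \<Rightarrow> 'p \<Rightarrow> complex"
  where "horner_num P Q [] p = 0"
  | "horner_num P Q (r # rs) p = (r p * P p ^ length rs + horner_num P Q rs p) * Q p"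

lemma horner_num_polynomial_maps:
  "P \<in> polynomial_maps \<Longrightarrow> Q \<in> polynomial_maps \<Longrightarrow> set rs \<subseteq> polynomial_maps
    \<Longrightarrow> horner_num P Q rs \<in> polynomial_maps"
proof (induction rs)
  case Nil
  then show ?case by (simp add: polynomial_maps.const)
next
  case (Cons r rs)
  then show ?case by (auto intro!: polynomial_maps.mult polynomial_maps.add polynomial_maps_power)
qed

text \<open>The leftover factor \<open>Q\<close> comes from the denominator
  \<open>Q ^ length rs\<close>, which also suits the empty list; what remains is the homogenised
  polynomial in \<open>P\<close> and \<open>Q\<close>.\<close>

lemma horner_num_eq:
  "horner_num P Q rs p = Q p * (\<Sum>i<length rs. (rev rs ! i) p * P p ^ i * Q p ^ (length rs - 1 - i))"
proof (induction rs)
  case (Cons r rs)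
  let ?n = "length rs"
  have "Q p * (\<Sum>i<?n. (rev rs ! i) p * P p ^ i * Q p ^ (?n - 1 - i)) =
    (\<Sum>i<?n. (rev rs ! i) p * P p ^ i * Q p ^ (?n - i))"
    unfolding sum_distrib_left
  proof (rule sum.cong)
    fix i assume "i \<in> {..<?n}"
    then have "?n - i = Suc (?n - 1 - i)" by auto
    then show "Q p * ((rev rs ! i) p * P p ^ i * Q p ^ (?n - 1 - i)) = (rev rs ! i) p * P p ^ i * Q p ^ (?n - i)"
      by simp
  qed simp
  moreover have "(\<Sum>i<?n. (rev (r # rs) ! i) p * P p ^ i * Q p ^ (?n - i)) =
     (\<Sum>i<?n. (rev rs ! i) p * P p ^ i * Q p ^ (?n - i))"
    by (rule sum.cong) (auto simp: nth_append)
  ultimately show ?case by (simp add: Cons nth_append algebra_simps)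
qed simp

locale orbit_closure_ring =
  fixes D :: nat and w :: "'v::finite cpoly"
  assumes w: "w \<in> Sym D"
begin

abbreviation "Z \<equiv> orbit_closure D w"
abbreviation "R \<equiv> coordinate_ring Z"
abbreviation "K \<equiv> fraction_field R"

sublocale domain R
  by (rule coordinate_ring_orbit_closure_domain[OF w])

definition res :: "('v cpoly \<Rightarrow> complex) \<Rightarrow> ('v cpoly \<Rightarrow> complex)" where "res f = restrict f Z"

lemma res_carrier: "f \<in> polynomial_maps \<Longrightarrow> res f \<in> carrier R"
  by (auto simp: res_def coordinate_ring_def)

lemma res_mult: "res f \<otimes>\<^bsub>R\<^esub> res g = res (\<lambda>p. f p * g p)"
  and res_add: "res f \<oplus>\<^bsub>R\<^esub> res g = res (\<lambda>p. f p + g p)"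
  and res_one: "\<one>\<^bsub>R\<^esub> = res (\<lambda>_. 1)"
  and res_zero: "\<zero>\<^bsub>R\<^esub> = res (\<lambda>_. 0)"
  by (auto simp: res_def coordinate_ring_def fun_eq_iff)

text \<open>The orbit is dense in its closure, so identities in the coordinate ring are checked at
  points \<open>g w\<close> only.\<close>

lemma res_eq_iff:
  assumes "f \<in> polynomial_maps" "g \<in> polynomial_maps"
  shows "res f = res g \<longleftrightarrow> (\<forall>p\<in>gl_orbit w. f p = g p)"
proof
  assume "res f = res g"
  then show "\<forall>p\<in>gl_orbit w. f p = g p"
    using gl_orbit_subset_closure[of w D] unfolding res_def by (metis restrict_apply' subsetD)
next
  assume *: "\<forall>p\<in>gl_orbit w. f p = g p"
  have "f p - g p = 0" if "p \<in> Z" for p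
    by (rule zero_on_orbit_closure[OF w _ _ that, of "\<lambda>p. f p - g p"])
      (use * in \<open>auto intro: polynomial_maps_diff assms\<close>)
  then show "res f = res g" by (auto simp: res_def fun_eq_iff)
qed

lemma eval_horner:
  assumes P: "P \<in> polynomial_maps" and Q: "Q \<in> polynomial_maps" "res Q \<noteq> \<zero>\<^bsub>R\<^esub>"
    and rs: "set rs \<subseteq> polynomial_maps"
  shows "ring.eval K (map (\<lambda>f. fraction R (res f) \<one>\<^bsub>R\<^esub>) rs) (fraction R (res P) (res Q)) =
    fraction R (res (horner_num P Q rs)) (res (\<lambda>p. Q p ^ length rs))"
proof -
  interpret K: field K by (rule fraction_field_field)
  have Qk: "res (\<lambda>p. Q p ^ k) \<in> carrier R - {\<zero>\<^bsub>R\<^esub>}" for k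
  proof (induction k)
    case 0
    then show ?case using res_one by (simp flip: res_one)
  next
    case (Suc k)
    then show ?case using Q res_carrier[OF Q(1)] by (simp flip: res_mult add: integral_iff)
  qed
  have Q1: "res Q \<in> carrier R - {\<zero>\<^bsub>R\<^esub>}" using Qk[of 1] by simp
  have pow: "fraction R (res P) (res Q) [^]\<^bsub>K\<^esub> k = fraction R (res (\<lambda>p. P p ^ k)) (res (\<lambda>p. Q p ^ k))" for k
  proof (induction k)
    case 0
    then show ?case by (simp add: fraction_field_one flip: res_one)
  next
    case (Suc k)
    have "fraction R (res P) (res Q) [^]\<^bsub>K\<^esub> Suc k = fraction R (res (\<lambda>p. P p ^ k)) (res (\<lambda>p. Q p ^ k)) \<otimes>\<^bsub>K\<^esub> fraction R (res P) (res Q)"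
      by (simp add: Suc)
    also have "\<dots> = fraction R (res (\<lambda>p. P p ^ k) \<otimes>\<^bsub>R\<^esub> res P) (res (\<lambda>p. Q p ^ k) \<otimes>\<^bsub>R\<^esub> res Q)"
      using Qk[of k] Q1 by (intro frac_mult) (auto intro: res_carrier polynomial_maps_power P)
    finally show ?case by (simp add: res_mult mult.commute)
  qed
  show ?thesis using rs
  proof (induction rs)
    case Nil
    then show ?case by (simp add: fraction_field_zero flip: res_zero res_one)
  next
    case (Cons r rs)
    let ?n = "length rs"
    have r: "r \<in> polynomial_maps" and rs: "set rs \<subseteq> polynomial_maps" using Cons.prems by auto
    have h: "horner_num P Q rs \<in> polynomial_maps" by (rule horner_num_polynomial_maps[OF P Q(1) rs])
    note C = res_carrier[OF r] res_carrier[OF P] res_carrier[OF h] res_carrier[OF polynomial_maps_power[OF P, of ?n]] Qk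
    have "ring.eval K (map (\<lambda>f. fraction R (res f) \<one>\<^bsub>R\<^esub>) (r # rs)) (fraction R (res P) (res Q)) =
      fraction R (res r) \<one>\<^bsub>R\<^esub> \<otimes>\<^bsub>K\<^esub> fraction R (res (\<lambda>p. P p ^ ?n)) (res (\<lambda>p. Q p ^ ?n)) \<oplus>\<^bsub>K\<^esub>
      fraction R (res (horner_num P Q rs)) (res (\<lambda>p. Q p ^ ?n))"
      using Cons.IH[OF rs] by (simp add: pow)
    also have "fraction R (res r) \<one>\<^bsub>R\<^esub> \<otimes>\<^bsub>K\<^esub> fraction R (res (\<lambda>p. P p ^ ?n)) (res (\<lambda>p. Q p ^ ?n)) =
      fraction R (res (\<lambda>p. r p * P p ^ ?n)) (res (\<lambda>p. Q p ^ ?n))"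
      using C C(5)[of ?n] by (subst frac_mult) (auto simp: res_mult)
    also have "\<dots> \<oplus>\<^bsub>K\<^esub> fraction R (res (horner_num P Q rs)) (res (\<lambda>p. Q p ^ ?n)) =
      fraction R (res (\<lambda>p. r p * P p ^ ?n) \<otimes>\<^bsub>R\<^esub> res (\<lambda>p. Q p ^ ?n) \<oplus>\<^bsub>R\<^esub> res (horner_num P Q rs) \<otimes>\<^bsub>R\<^esub> res (\<lambda>p. Q p ^ ?n))
        (res (\<lambda>p. Q p ^ ?n) \<otimes>\<^bsub>R\<^esub> res (\<lambda>p. Q p ^ ?n))"
      using C(3) C(5)[of ?n] by (intro frac_add) (auto intro!: res_carrier polynomial_maps.mult polynomial_maps_power r P)
    also have "\<dots> = fraction R (res (horner_num P Q (r # rs))) (res (\<lambda>p. Q p ^ length (r # rs)))"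
    proof -
      have m: "(\<lambda>p. (r p * P p ^ ?n) * Q p ^ ?n + horner_num P Q rs p * Q p ^ ?n) \<in> polynomial_maps"
        "horner_num P Q (r # rs) \<in> polynomial_maps"
        using horner_num_polynomial_maps[OF P Q(1) Cons.prems] by (auto intro!: polynomial_maps.add polynomial_maps.mult polynomial_maps_power r P Q h)
      show ?thesis unfolding res_mult res_add
        by (subst frac_eq_iff)
          (use m Qk[of "?n + ?n"] Qk[of "Suc ?n"] in \<open>auto simp: res_mult power_add res_carrier algebra_simps\<close>)
    qed
    finally show ?case .
  qed
qed

text \<open>Normality in pointwise form: a monic equation for \<open>P / Q\<close>, cleared of
  denominators and tested on the orbit, makes \<open>Q\<close> divide \<open>P\<close>. Fraction
  classes and coefficient lists do not occur beyond this point.\<close>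

theorem normal_integral_quotient:
  assumes nor: "normal_variety Z" and P: "P \<in> polynomial_maps" and Q: "Q \<in> polynomial_maps"
    and nz: "p0 \<in> gl_orbit w" "Q p0 \<noteq> 0"
    and r: "\<And>i. i < s \<Longrightarrow> r i \<in> polynomial_maps"
    and eq: "\<And>p. p \<in> gl_orbit w \<Longrightarrow> P p ^ s + (\<Sum>i<s. r i p * P p ^ i * Q p ^ (s - i)) = 0"
  shows "\<exists>f\<in>polynomial_maps. \<forall>p\<in>gl_orbit w. f p * Q p = P p"
proof -
  interpret K: field K by (rule fraction_field_field)
  let ?\<iota> = "\<lambda>a. fraction R a \<one>\<^bsub>R\<^esub>"
  let ?x = "fraction R (res P) (res Q)"
  have Q0: "res Q \<noteq> \<zero>\<^bsub>R\<^esub>"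
    using nz res_eq_iff[OF Q polynomial_maps.const[of 0]] by (auto simp: res_zero)
  then have Q1: "res Q \<in> carrier R - {\<zero>\<^bsub>R\<^esub>}" using res_carrier[OF Q] by simp
  \<comment> \<open>Coefficient lists start with the leading coefficient, so the monic 1 heads the
    list and the \<open>r i\<close> follow in descending order.\<close>
  define rs where "rs = (\<lambda>_. 1) # rev (map r [0..<s])"
  have len: "length rs = Suc s" by (simp add: rs_def)
  have rs: "set rs \<subseteq> polynomial_maps" using r by (auto simp: rs_def polynomial_maps.const)
  have rv: "rev rs ! i = (if i < s then r i else (\<lambda>_. 1))" if "i \<le> s" for i
    using that by (auto simp: rs_def nth_append)
  have "horner_num P Q rs p = 0" if p: "p \<in> gl_orbit w" for p
  proof -
    have "horner_num P Q rs p = Q p * ((\<Sum>i<s. r i p * P p ^ i * Q p ^ (s - i)) + P p ^ s)"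
      unfolding horner_num_eq len by (simp add: rv)
    then show ?thesis using eq[OF p] by (simp add: add.commute)
  qed
  then have h0: "res (horner_num P Q rs) = \<zero>\<^bsub>R\<^esub>"
    unfolding res_zero using horner_num_polynomial_maps[OF P Q rs] by (subst res_eq_iff) (auto intro: polynomial_maps.const)
  have "res (\<lambda>p. Q p ^ length rs) \<in> carrier R - {\<zero>\<^bsub>R\<^esub>}"
    using nz res_eq_iff[OF polynomial_maps_power[OF Q, of "length rs"] polynomial_maps.const[of 0]]
      res_carrier[OF polynomial_maps_power[OF Q]]
    by (auto simp: res_zero)
  then have e0: "ring.eval K (map (\<lambda>f. ?\<iota> (res f)) rs) ?x = \<zero>\<^bsub>K\<^esub>"
    unfolding eval_horner[OF P Q Q0 rs] h0 fraction_field_zero by (subst frac_eq_iff) auto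
  have "map (\<lambda>f. ?\<iota> (res f)) rs \<in> carrier ((?\<iota> ` carrier R) [X]\<^bsub>K\<^esub>)"
  proof -
    have "set (map (\<lambda>f. ?\<iota> (res f)) rs) \<subseteq> ?\<iota> ` carrier R" using rs res_carrier by auto
    moreover have "Polynomials.lead_coeff (map (\<lambda>f. ?\<iota> (res f)) rs) = \<one>\<^bsub>K\<^esub>"
      by (simp add: rs_def fraction_field_one res_one)
    ultimately show ?thesis by (simp add: univ_poly_def polynomial_def rs_def)
  qed
  moreover have "Polynomials.lead_coeff (map (\<lambda>f. ?\<iota> (res f)) rs) = \<one>\<^bsub>K\<^esub>" "map (\<lambda>f. ?\<iota> (res f)) rs \<noteq> []"
    by (simp_all add: rs_def fraction_field_one res_one)
  ultimately have "integral_over K (?\<iota> ` carrier R) ?x"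
    unfolding integral_over_def using e0 by blast
  moreover have "?x \<in> carrier K" using frac_in_carrier[OF res_carrier[OF P] Q1] .
  ultimately have "?x \<in> ?\<iota> ` carrier R"
    using nor unfolding normal_variety_def integrally_closed_domain_def Let_def by blast
  then obtain f where f: "f \<in> polynomial_maps" "?x = ?\<iota> (res f)"
    by (auto simp: coordinate_ring_def res_def)
  then have "res P \<otimes>\<^bsub>R\<^esub> \<one>\<^bsub>R\<^esub> = res f \<otimes>\<^bsub>R\<^esub> res Q"
    using frac_eq_iff[OF res_carrier[OF P] Q1 res_carrier[OF f(1)], of "\<one>\<^bsub>R\<^esub>"] by simp
  then have "res P = res (\<lambda>p. f p * Q p)" using res_carrier[OF P] by (simp add: res_mult)
  then have "\<forall>p\<in>gl_orbit w. P p = f p * Q p"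
    by (subst (asm) res_eq_iff) (auto intro: polynomial_maps.mult P Q f)
  then show ?thesis using f(1) by (intro bexI[of _ f]) simp_all
qed

end

lemma prod_sum_UNIV:
  fixes F :: "'i::finite \<Rightarrow> 'j::finite \<Rightarrow> 'r::comm_semiring_1"
  shows "(\<Prod>i\<in>UNIV. \<Sum>j\<in>UNIV. F i j) = (\<Sum>\<theta>\<in>UNIV. \<Prod>i\<in>UNIV. F i (\<theta> i))"
  using prod_sum_PiE[of "UNIV :: 'i set" "\<lambda>_. UNIV :: 'j set" F] by (simp add: PiE_UNIV_domain)

lemma sum_permutes_inv:
  "(\<Sum>\<tau> | \<tau> permutes S. F (inv \<tau>)) = (\<Sum>\<tau> | \<tau> permutes S. F \<tau>)"
  by (rule sum.reindex_bij_witness[of _ inv inv]) (auto simp: permutes_inv permutes_inv_inv)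

lemma prod_permutes:
  "\<tau> permutes UNIV \<Longrightarrow> (\<Prod>i\<in>UNIV. F (\<tau> i)) = (\<Prod>i\<in>UNIV. F i)"
  using prod.permute[of \<tau> UNIV F] by (simp add: o_def)

section \<open>Polarisation\<close>

text \<open>Inclusion-exclusion over sets of arguments: for a form of degree \<open>CARD('s)\<close>
  this is the full polarisation, not divided by a factorial. It uses only values of
  \<open>\<phi>\<close>, hence needs no coefficients.\<close>

definition polarization :: "('x::comm_monoid_add \<Rightarrow> complex) \<Rightarrow> ('s::finite \<Rightarrow> 'x) \<Rightarrow> complex"
  where "polarization \<phi> A = (\<Sum>S\<in>UNIV. (-1) ^ card (- S) * \<phi> (\<Sum>s\<in>S. A s))"

text \<open>Expansion of the product of \<open>1 + ?g t\<close>, in which a factor vanishes unless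
  \<open>T\<close> is everything.\<close>

lemma sum_signed_supersets:
  "(\<Sum>S\<in>UNIV. (-1) ^ card (- S) * (if T \<subseteq> S then 1 else 0)) = (if T = UNIV then 1 else 0 :: complex)"
  for T :: "'s::finite set"
proof -
  let ?g = "\<lambda>t. if t \<in> T then 0 else - 1 :: complex"
  have "(\<Prod>t\<in>UNIV. 1 + ?g t) = (\<Sum>S\<in>Pow UNIV. (\<Prod>t\<in>S. 1) * (\<Prod>t\<in>UNIV - S. ?g t))"
    by (rule prod_add) simp
  moreover have "(\<Prod>t\<in>UNIV. 1 + ?g t) = (if T = UNIV then 1 else 0)"
  proof (cases "T = UNIV")
    case False
    then obtain t where "t \<notin> T" by blast
    then show ?thesis using False by (auto intro!: prod_zero)
  qed simp
  moreover have "(\<Prod>t\<in>UNIV - S. ?g t) = (-1) ^ card (- S) * (if T \<subseteq> S then 1 else 0)" for S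
  proof (cases "T \<subseteq> S")
    case True
    then have "(\<Prod>t\<in>UNIV - S. ?g t) = (\<Prod>t\<in>UNIV - S. - 1)" by (intro prod.cong) auto
    then show ?thesis using True by (simp add: Compl_eq_Diff_UNIV)
  qed (auto intro!: prod_zero)
  ultimately show ?thesis by simp
qed

text \<open>Expanding the product gives maps \<open>\<sigma>\<close> that choose an argument for
  each factor; the signed sum over \<open>S\<close> keeps the surjective ones. The result is a
  permanent.\<close>

lemma polarization_prod:
  fixes l :: "'s::finite \<Rightarrow> 'x::comm_monoid_add \<Rightarrow> complex"
  assumes l: "\<And>s x y. l s (x + y) = l s x + l s y" "\<And>s. l s 0 = 0"
  shows "polarization (\<lambda>x. \<Prod>s\<in>UNIV. l s x) A = (\<Sum>\<sigma> | \<sigma> permutes UNIV. \<Prod>s\<in>UNIV. l s (A (\<sigma> s)))"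
proof -
  have ls: "l s (sum A S) = (\<Sum>t\<in>S. l s (A t))" for s S
    by (induction S rule: infinite_finite_induct) (simp_all add: l)
  have "(\<Prod>s\<in>UNIV. l s (sum A S)) = (\<Sum>\<sigma>\<in>UNIV. (if range \<sigma> \<subseteq> S then 1 else 0) * (\<Prod>s\<in>UNIV. l s (A (\<sigma> s))))" for S
  proof -
    have "(\<Prod>s\<in>UNIV. l s (sum A S)) = (\<Prod>s\<in>UNIV. \<Sum>t\<in>UNIV. if t \<in> S then l s (A t) else 0)"
      unfolding ls by (intro prod.cong refl) (simp add: sum.If_cases)
    also have "\<dots> = (\<Sum>\<sigma>\<in>UNIV. \<Prod>s\<in>UNIV. if \<sigma> s \<in> S then l s (A (\<sigma> s)) else 0)"
      by (rule prod_sum_UNIV)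
    also have "\<dots> = (\<Sum>\<sigma>\<in>UNIV. (if range \<sigma> \<subseteq> S then 1 else 0) * (\<Prod>s\<in>UNIV. l s (A (\<sigma> s))))"
    proof (rule sum.cong)
      fix \<sigma> :: "'s \<Rightarrow> 's"
      show "(\<Prod>s\<in>UNIV. if \<sigma> s \<in> S then l s (A (\<sigma> s)) else 0) = (if range \<sigma> \<subseteq> S then 1 else 0) * (\<Prod>s\<in>UNIV. l s (A (\<sigma> s)))"
      proof (cases "range \<sigma> \<subseteq> S")
        case True
        then show ?thesis by (auto intro!: prod.cong)
      qed (auto intro!: prod_zero)
    qed simp
    finally show ?thesis .
  qed
  then have "polarization (\<lambda>x. \<Prod>s\<in>UNIV. l s x) A =
    (\<Sum>S\<in>UNIV. \<Sum>\<sigma>\<in>UNIV. ((-1) ^ card (- S) * (if range \<sigma> \<subseteq> S then 1 else 0)) * (\<Prod>s\<in>UNIV. l s (A (\<sigma> s))))"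
    by (simp add: polarization_def sum_distrib_left mult.assoc)
  also have "\<dots> = (\<Sum>\<sigma>\<in>UNIV. (\<Sum>S\<in>UNIV. (-1) ^ card (- S) * (if range \<sigma> \<subseteq> S then 1 else 0)) * (\<Prod>s\<in>UNIV. l s (A (\<sigma> s))))"
    by (subst sum.swap) (simp only: sum_distrib_right)
  also have "\<dots> = (\<Sum>\<sigma>\<in>UNIV. if \<sigma> permutes UNIV then \<Prod>s\<in>UNIV. l s (A (\<sigma> s)) else 0)"
  proof (rule sum.cong)
    fix \<sigma> :: "'s \<Rightarrow> 's"
    have "range \<sigma> = UNIV \<longleftrightarrow> \<sigma> permutes UNIV"
      by (metis UNIV_I bij_betw_def bij_imp_permutes finite finite_UNIV_surj_inj permutes_imp_bij)
    then show "(\<Sum>S\<in>UNIV. (-1) ^ card (- S) * (if range \<sigma> \<subseteq> S then 1 else 0)) * (\<Prod>s\<in>UNIV. l s (A (\<sigma> s))) =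
      (if \<sigma> permutes UNIV then \<Prod>s\<in>UNIV. l s (A (\<sigma> s)) else 0)"
      unfolding sum_signed_supersets by simp
  qed simp
  also have "\<dots> = (\<Sum>\<sigma> | \<sigma> permutes UNIV. \<Prod>s\<in>UNIV. l s (A (\<sigma> s)))"
    by (simp add: sum.If_cases)
  finally show ?thesis .
qed

lemma polarization_sum: "polarization (\<lambda>x. \<Sum>j\<in>J. \<phi> j x) A = (\<Sum>j\<in>J. polarization (\<phi> j) A)"
  unfolding polarization_def sum_distrib_left by (rule sum.swap)

lemma polarization_scale: "polarization (\<lambda>x. a * \<phi> x) A = a * polarization \<phi> A"
  unfolding polarization_def sum_distrib_left by (simp add: mult.left_commute)

section \<open>The action on sums of monomials\<close>

text \<open>Monomials are written as words with one variable per position: this permits multilinear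
  expansion over positions, and permuting positions accounts for commutativity.\<close>

definition exponents :: "('i::finite \<Rightarrow> 'v) \<Rightarrow> ('v \<Rightarrow>\<^sub>0 nat)"
  where "exponents \<theta> = (\<Sum>i\<in>UNIV. Poly_Mapping.single (\<theta> i) 1)"

lemma lookup_exponents: "Poly_Mapping.lookup (exponents \<theta>) v = card {i. \<theta> i = v}"
  by (simp add: exponents_def lookup_sum lookup_single when_def sum.If_cases)

lemma exponents_permute:
  assumes "\<tau> permutes UNIV"
  shows "exponents (\<theta> \<circ> \<tau>) = exponents \<theta>"
  using sum.permute[OF assms, of "\<lambda>i. Poly_Mapping.single (\<theta> i) (1::nat)"] by (simp add: exponents_def o_def)

lemma exponents_eq_permute:
  fixes \<theta> \<theta>' :: "'i::finite \<Rightarrow> 'v"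
  assumes "exponents \<theta> = exponents \<theta>'"
  obtains \<tau> where "\<tau> permutes UNIV" "\<theta>' = \<theta> \<circ> \<tau>"
proof -
  have "image_mset \<theta>' (mset_set UNIV) = image_mset \<theta> (mset_set UNIV)"
  proof (rule multiset_eqI)
    fix v
    have "{i \<in> UNIV. v = \<theta> i} = {i. \<theta> i = v}" "{i \<in> UNIV. v = \<theta>' i} = {i. \<theta>' i = v}" by auto
    then show "count (image_mset \<theta>' (mset_set UNIV)) v = count (image_mset \<theta> (mset_set UNIV)) v"
      using lookup_exponents[of \<theta> v] lookup_exponents[of \<theta>' v] assms by (simp add: count_image_mset' eq_commute)
  qed
  from image_mset_eq_implies_permutes[OF finite this] show thesis
    using that by (metis comp_apply ext UNIV_I)
qed

lemma prod_Const_Var: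
  "(\<Prod>i\<in>UNIV. Const (G i) * Var (\<theta> i)) = Poly_Mapping.single (exponents \<theta>) (\<Prod>i\<in>UNIV. G i)"
proof -
  have "(\<Prod>i\<in>I. Const (G i) * Var (\<theta> i)) = Poly_Mapping.single (\<Sum>i\<in>I. Poly_Mapping.single (\<theta> i) 1) (\<Prod>i\<in>I. G i)" for I
    by (induction I rule: infinite_finite_induct) (simp_all add: Const_def Var_def mult_single)
  then show ?thesis by (simp add: exponents_def)
qed

lemma lookup_prod_linear_form:
  "Poly_Mapping.lookup (\<Prod>i\<in>UNIV. linear_form g (\<beta> i)) m =
    (\<Sum>\<theta> | exponents \<theta> = m. \<Prod>i\<in>UNIV. g $ \<theta> i $ \<beta> i)"
proof -
  have "(\<Prod>i\<in>UNIV. linear_form g (\<beta> i)) =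
    (\<Sum>\<theta>\<in>UNIV. Poly_Mapping.single (exponents \<theta>) (\<Prod>i\<in>UNIV. g $ \<theta> i $ \<beta> i))"
    unfolding linear_form_def prod_sum_UNIV prod_Const_Var ..
  then show ?thesis by (simp add: lookup_sum lookup_single when_def sum.If_cases Collect_conj_eq)
qed

lemma gl_act_superset:
  assumes "finite S" "Poly_Mapping.keys p \<subseteq> S"
  shows "gl_act A p = (\<Sum>m\<in>S. Const (Poly_Mapping.lookup p m) * (\<Prod>i\<in>UNIV. linear_form A i ^ Poly_Mapping.lookup m i))"
  unfolding gl_act_def using assms
  by (intro sum.mono_neutral_left) (auto simp: in_keys_iff Const_def)

lemma gl_act_add: "gl_act A (p + q) = gl_act A p + gl_act A q"
proof -
  let ?S = "Poly_Mapping.keys p \<union> Poly_Mapping.keys q"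
  have "finite ?S" "Poly_Mapping.keys (p + q) \<subseteq> ?S" "Poly_Mapping.keys p \<subseteq> ?S" "Poly_Mapping.keys q \<subseteq> ?S"
    using keys_add[of p q] by auto
  then show ?thesis
    by (simp add: gl_act_superset[of ?S] lookup_add cpl.K_add sum.distrib distrib_right)
qed

lemma gl_act_sum: "gl_act A (sum p T) = (\<Sum>x\<in>T. gl_act A (p x))"
  by (induction T rule: infinite_finite_induct) (simp_all add: gl_act_add, simp_all add: gl_act_def)

lemma gl_act_single: "gl_act A (Poly_Mapping.single m a) = Const a * (\<Prod>i\<in>UNIV. linear_form A i ^ Poly_Mapping.lookup m i)"
  by (simp add: gl_act_superset[of "{m}"])

lemma gl_act_monomial:
  fixes \<beta> :: "'i::finite \<Rightarrow> 'v::finite"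
  shows "gl_act A (Const a * (\<Prod>i\<in>UNIV. Var (\<beta> i))) = Const a * (\<Prod>i\<in>UNIV. linear_form A (\<beta> i))"
proof -
  have C1: "Const 1 = 1" by (simp add: Const_def)
  have "Const a * (\<Prod>i\<in>UNIV. Var (\<beta> i)) = Poly_Mapping.single (exponents \<beta>) a"
    using prod_Const_Var[of "\<lambda>_. 1" \<beta>] by (simp add: C1 Const_def mult_single)
  moreover have "(\<Prod>v\<in>UNIV. linear_form A v ^ Poly_Mapping.lookup (exponents \<beta>) v) = (\<Prod>i\<in>UNIV. linear_form A (\<beta> i))"
  proof -
    have "(\<Prod>i\<in>UNIV. linear_form A (\<beta> i)) = (\<Prod>v\<in>UNIV. \<Prod>i\<in>{i \<in> UNIV. \<beta> i = v}. linear_form A (\<beta> i))"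
      by (rule prod.group[symmetric]) auto
    also have "\<dots> = (\<Prod>v\<in>UNIV. linear_form A v ^ card {i. \<beta> i = v})"
      by (intro prod.cong refl) simp
    finally show ?thesis by (simp add: lookup_exponents)
  qed
  ultimately show ?thesis by (simp add: gl_act_single)
qed

text \<open>Orbit counting: the words with the exponents of \<open>\<theta>\<close> form one orbit
  under permuting positions, and each is reached as often as \<open>\<theta>\<close> has stabilising
  permutations.\<close>

lemma sum_permutes_exponents:
  fixes F :: "('i::finite \<Rightarrow> 'v::finite) \<Rightarrow> complex"
  shows "(\<Sum>\<tau> | \<tau> permutes UNIV. F (\<theta> \<circ> \<tau>)) =
    of_nat (card {\<tau>. \<tau> permutes UNIV \<and> \<theta> \<circ> \<tau> = \<theta>}) * (\<Sum>\<theta>' | exponents \<theta>' = exponents \<theta>. F \<theta>')"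
proof -
  let ?P = "{\<tau> :: 'i \<Rightarrow> 'i. \<tau> permutes UNIV}"
  have "(\<Sum>\<tau>\<in>?P. F (\<theta> \<circ> \<tau>)) = (\<Sum>\<theta>' | exponents \<theta>' = exponents \<theta>. \<Sum>\<tau>\<in>{\<tau> \<in> ?P. \<theta> \<circ> \<tau> = \<theta>'}. F (\<theta> \<circ> \<tau>))"
    by (rule sum.group[symmetric]) (auto simp: exponents_permute)
  also have "\<dots> = (\<Sum>\<theta>' | exponents \<theta>' = exponents \<theta>. of_nat (card {\<tau>. \<tau> permutes UNIV \<and> \<theta> \<circ> \<tau> = \<theta>}) * F \<theta>')"
  proof (rule sum.cong)
    fix \<theta>' :: "'i \<Rightarrow> 'v" assume "\<theta>' \<in> {\<theta>'. exponents \<theta>' = exponents \<theta>}"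
    then obtain \<rho> where \<rho>: "\<rho> permutes UNIV" "\<theta>' = \<theta> \<circ> \<rho>"
      using exponents_eq_permute[of \<theta> \<theta>'] by auto
    have "bij_betw (\<lambda>\<tau>. \<tau> \<circ> \<rho>) {\<tau>. \<tau> permutes UNIV \<and> \<theta> \<circ> \<tau> = \<theta>} {\<tau> \<in> ?P. \<theta> \<circ> \<tau> = \<theta>'}"
    proof (rule bij_betw_byWitness[of _ "\<lambda>\<tau>. \<tau> \<circ> inv \<rho>"])
      show "\<forall>\<tau>\<in>{\<tau>. \<tau> permutes UNIV \<and> \<theta> \<circ> \<tau> = \<theta>}. (\<tau> \<circ> \<rho>) \<circ> inv \<rho> = \<tau>"
        "\<forall>\<tau>\<in>{\<tau> \<in> ?P. \<theta> \<circ> \<tau> = \<theta>'}. (\<tau> \<circ> inv \<rho>) \<circ> \<rho> = \<tau>"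
        using permutes_inv_o[OF \<rho>(1)] by (auto simp: comp_assoc)
      show "(\<lambda>\<tau>. \<tau> \<circ> \<rho>) ` {\<tau>. \<tau> permutes UNIV \<and> \<theta> \<circ> \<tau> = \<theta>} \<subseteq> {\<tau> \<in> ?P. \<theta> \<circ> \<tau> = \<theta>'}"
        using \<rho> by (auto simp: permutes_compose simp flip: comp_assoc)
      show "(\<lambda>\<tau>. \<tau> \<circ> inv \<rho>) ` {\<tau> \<in> ?P. \<theta> \<circ> \<tau> = \<theta>'} \<subseteq> {\<tau>. \<tau> permutes UNIV \<and> \<theta> \<circ> \<tau> = \<theta>}"
      proof (rule image_subsetI)
        fix \<tau> assume "\<tau> \<in> {\<tau> \<in> ?P. \<theta> \<circ> \<tau> = \<theta>'}"
        then have t: "\<tau> permutes UNIV" "\<theta> \<circ> \<tau> = \<theta>'" by auto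
        have "\<theta> \<circ> (\<tau> \<circ> inv \<rho>) = \<theta> \<circ> \<rho> \<circ> inv \<rho>" using t \<rho>(2) by (simp add: comp_assoc[symmetric])
        then have "\<theta> \<circ> (\<tau> \<circ> inv \<rho>) = \<theta>" using permutes_inv_o[OF \<rho>(1)] by (simp add: comp_assoc)
        then show "\<tau> \<circ> inv \<rho> \<in> {\<tau>. \<tau> permutes UNIV \<and> \<theta> \<circ> \<tau> = \<theta>}"
          using permutes_compose[OF permutes_inv[OF \<rho>(1)] t(1)] by simp
      qed
    qed
    then have "card {\<tau> \<in> ?P. \<theta> \<circ> \<tau> = \<theta>'} = card {\<tau>. \<tau> permutes UNIV \<and> \<theta> \<circ> \<tau> = \<theta>}"
      by (simp add: bij_betw_same_card)
    moreover have "(\<Sum>\<tau>\<in>{\<tau> \<in> ?P. \<theta> \<circ> \<tau> = \<theta>'}. F (\<theta> \<circ> \<tau>)) = (\<Sum>\<tau>\<in>{\<tau> \<in> ?P. \<theta> \<circ> \<tau> = \<theta>'}. F \<theta>')"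
      by (intro sum.cong) auto
    ultimately show "(\<Sum>\<tau>\<in>{\<tau> \<in> ?P. \<theta> \<circ> \<tau> = \<theta>'}. F (\<theta> \<circ> \<tau>)) = of_nat (card {\<tau>. \<tau> permutes UNIV \<and> \<theta> \<circ> \<tau> = \<theta>}) * F \<theta>'"
      by simp
  qed simp
  finally show ?thesis by (simp add: sum_distrib_left)
qed

locale monomial_sum =
  fixes B :: "('i::finite \<Rightarrow> 'v::finite) set" and c :: "('i \<Rightarrow> 'v) \<Rightarrow> complex"
begin

definition form :: "'v cpoly"
  where "form = (\<Sum>\<beta>\<in>B. Const (c \<beta>) * (\<Prod>i\<in>UNIV. Var (\<beta> i)))"

text \<open>The symmetric tensor of \<open>g form\<close>; it differs from the coefficients by multinomial factors.\<close>

definition tens :: "complex ^ 'v ^ 'v \<Rightarrow> ('i \<Rightarrow> 'v) \<Rightarrow> complex"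
  where "tens g \<theta> = (\<Sum>\<tau> | \<tau> permutes UNIV. \<Sum>\<beta>\<in>B. c \<beta> * (\<Prod>i\<in>UNIV. g $ \<theta> i $ \<beta> (\<tau> i)))"

lemma form_Sym: "form \<in> Sym CARD('i)"
proof -
  have "(\<Prod>i\<in>UNIV. Var (\<beta> i)) \<in> Sym CARD('i)" for \<beta> :: "'i \<Rightarrow> 'v"
    using Sym_prod[of "UNIV :: 'i set" "\<lambda>i. Var (\<beta> i)" "\<lambda>_. 1", OF Sym_Var] by simp
  then show ?thesis
    unfolding form_def using Sym_mult[OF Sym_Const] by (intro Sym_sum) fastforce
qed

lemma gl_act_form: "gl_act g form = (\<Sum>\<beta>\<in>B. Const (c \<beta>) * (\<Prod>i\<in>UNIV. linear_form g (\<beta> i)))"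
  by (simp add: form_def gl_act_sum gl_act_monomial)

lemma lookup_gl_act_form:
  "Poly_Mapping.lookup (gl_act g form) m = (\<Sum>\<theta> | exponents \<theta> = m. \<Sum>\<beta>\<in>B. c \<beta> * (\<Prod>i\<in>UNIV. g $ \<theta> i $ \<beta> i))"
  unfolding gl_act_form lookup_sum lookup_Const_mult lookup_prod_linear_form sum_distrib_left
  by (rule sum.swap)

lemma tens_alt:
  "tens g \<theta> = (\<Sum>\<tau> | \<tau> permutes UNIV. \<Sum>\<beta>\<in>B. c \<beta> * (\<Prod>i\<in>UNIV. g $ (\<theta> \<circ> \<tau>) i $ \<beta> i))"
proof -
  have "(\<Prod>i\<in>UNIV. g $ \<theta> i $ \<beta> (inv \<tau> i)) = (\<Prod>i\<in>UNIV. g $ (\<theta> \<circ> \<tau>) i $ \<beta> i)" if "\<tau> permutes UNIV" for \<tau> \<beta>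
    using prod_permutes[OF that, of "\<lambda>i. g $ \<theta> i $ \<beta> (inv \<tau> i)"] permutes_inverses[OF that] by simp
  then show ?thesis unfolding tens_def
    by (subst sum_permutes_inv[symmetric]) simp
qed

text \<open>A tensor entry is a coefficient times the order of the stabiliser of its word.\<close>

lemma tens_regular: "\<exists>f\<in>polynomial_maps. \<forall>g. f (gl_act g form) = tens g \<theta>"
proof -
  let ?n = "of_nat (card {\<tau>. \<tau> permutes (UNIV :: 'i set) \<and> \<theta> \<circ> \<tau> = \<theta>})"
  have "tens g \<theta> = ?n * Poly_Mapping.lookup (gl_act g form) (exponents \<theta>)" for g
    unfolding tens_alt lookup_gl_act_form by (rule sum_permutes_exponents)
  then show ?thesis
    by (intro bexI[of _ "\<lambda>p. ?n * Poly_Mapping.lookup p (exponents \<theta>)"])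
      (auto intro!: polynomial_maps.intros)
qed

text \<open>Conversely, summed over all words of one monomial every \<open>\<tau>\<close>
  contributes the same, namely the coefficient.\<close>

lemma lookup_eq_tens:
  "Poly_Mapping.lookup (gl_act g form) m = (\<Sum>\<theta> | exponents \<theta> = m. tens g \<theta>) / fact CARD('i)"
proof -
  let ?H = "\<lambda>\<theta>. \<Sum>\<beta>\<in>B. c \<beta> * (\<Prod>i\<in>UNIV. g $ \<theta> i $ \<beta> i)"
  have "(\<Sum>\<theta> | exponents \<theta> = m. ?H (\<theta> \<circ> \<tau>)) = (\<Sum>\<theta> | exponents \<theta> = m. ?H \<theta>)" if t: "\<tau> permutes UNIV" for \<tau>
    by (rule sum.reindex_bij_witness[of _ "\<lambda>\<theta>. \<theta> \<circ> inv \<tau>" "\<lambda>\<theta>. \<theta> \<circ> \<tau>"])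
      (auto simp: exponents_permute permutes_inv t comp_assoc permutes_inv_o[OF t])
  then have "(\<Sum>\<theta> | exponents \<theta> = m. tens g \<theta>) = (\<Sum>\<tau> | \<tau> permutes (UNIV :: 'i set). (\<Sum>\<theta> | exponents \<theta> = m. ?H \<theta>))"
    unfolding tens_alt by (subst sum.swap[of "\<lambda>\<theta> \<tau>. ?H (\<theta> \<circ> \<tau>)"]) (rule sum.cong[OF refl], simp)
  also have "\<dots> = fact CARD('i) * Poly_Mapping.lookup (gl_act g form) m"
    by (simp add: lookup_gl_act_form card_permutations)
  finally show ?thesis by simp
qed

end

section \<open>A functional that detects the squared determinant\<close>

lemma prod_pair_bool: "(\<Prod>s\<in>UNIV. F s) = (\<Prod>a\<in>UNIV. F (a, False) * F (a, True))"
  for F :: "'a::finite \<times> bool \<Rightarrow> 'r::comm_monoid_mult"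
proof -
  have "(\<Prod>s\<in>UNIV. F s) = (\<Prod>a\<in>UNIV. \<Prod>b\<in>UNIV. F (a, b))"
    by (simp add: prod.cartesian_product flip: UNIV_Times_UNIV)
  then show ?thesis by (simp add: UNIV_bool mult.commute)
qed

lemma sign_compose_UNIV:
  "p permutes (UNIV :: 'a::finite set) \<Longrightarrow> q permutes UNIV \<Longrightarrow> sign (p \<circ> q) = sign p * sign q"
  by (intro sign_compose permutes_imp_permutation[of UNIV]) auto

definition matrix_unit :: "'v \<Rightarrow> 'v \<Rightarrow> complex ^ 'v ^ 'v"
  where "matrix_unit a b = (\<chi> i j. if i = a \<and> j = b then 1 else 0)"

text \<open>Pairing of a homogeneous polynomial of degree \<open>2 CARD('v)\<close> in the entries of a matrix with
  \<open>\<Prod>\<^sub>a g\<^sub>a\<^sub>a \<cdot> det g\<close>, for the pairing under which monomials are orthogonal.\<close>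

definition det_pairing :: "(complex ^ 'v ^ 'v \<Rightarrow> complex) \<Rightarrow> complex"
  where "det_pairing \<phi> = (\<Sum>\<pi> | \<pi> permutes (UNIV :: 'v::finite set). of_int (sign \<pi>) *
    polarization \<phi> (\<lambda>(a, s). matrix_unit a (if s then a else \<pi> a)))"

lemma det_pairing_sum: "det_pairing (\<lambda>x. \<Sum>j\<in>J. \<phi> j x) = (\<Sum>j\<in>J. det_pairing (\<phi> j))"
  unfolding det_pairing_def polarization_sum sum_distrib_left by (rule sum.swap)

lemma det_pairing_scale: "det_pairing (\<lambda>x. a * \<phi> x) = a * det_pairing \<phi>"
  unfolding det_pairing_def polarization_scale sum_distrib_left by (simp add: mult.left_commute)

text \<open>\<open>polarization_prod\<close> with the permutation inverted, so that
  \<open>\<sigma>\<close> acts on the factors. Slots \<open>(a, False)\<close> belong to the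
  determinant, slots \<open>(a, True)\<close> to the diagonal product.\<close>

lemma det_pairing_prod:
  fixes l :: "'v \<times> bool \<Rightarrow> complex ^ 'v ^ 'v::finite \<Rightarrow> complex"
  assumes "\<And>s x y. l s (x + y) = l s x + l s y" "\<And>s. l s 0 = 0"
  shows "det_pairing (\<lambda>x. \<Prod>s\<in>UNIV. l s x) = (\<Sum>\<pi> | \<pi> permutes UNIV. \<Sum>\<sigma> | \<sigma> permutes UNIV.
    of_int (sign \<pi>) * ((\<Prod>a\<in>UNIV. l (\<sigma> (a, False)) (matrix_unit a (\<pi> a))) *
      (\<Prod>a\<in>UNIV. l (\<sigma> (a, True)) (matrix_unit a a))))"
proof -
  have "(\<Sum>\<sigma> | \<sigma> permutes UNIV. \<Prod>s\<in>UNIV. l s (A (\<sigma> s))) = (\<Sum>\<sigma> | \<sigma> permutes UNIV. \<Prod>s\<in>UNIV. l (\<sigma> s) (A s))" for A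
  proof -
    have "(\<Prod>s\<in>UNIV. l s (A (inv \<sigma> s))) = (\<Prod>s\<in>UNIV. l (\<sigma> s) (A s))" if "\<sigma> permutes UNIV" for \<sigma>
      using prod_permutes[OF that, of "\<lambda>s. l s (A (inv \<sigma> s))"] permutes_inverses[OF that] by simp
    then show ?thesis by (subst sum_permutes_inv[symmetric]) simp
  qed
  then have "polarization (\<lambda>x. \<Prod>s\<in>UNIV. l s x) A =
    (\<Sum>\<sigma> | \<sigma> permutes UNIV. (\<Prod>a\<in>UNIV. l (\<sigma> (a, False)) (A (a, False))) * (\<Prod>a\<in>UNIV. l (\<sigma> (a, True)) (A (a, True))))" for A
    using polarization_prod[of l A, OF assms] by (simp add: prod_pair_bool prod.distrib)
  then show ?thesis by (simp add: det_pairing_def sum_distrib_left)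
qed

text \<open>Substituting \<open>\<pi> \<circ> \<kappa>\<close> for \<open>\<pi>\<close> splits off the determinant of the vectors \<open>Z (u a)\<close>, two of which agree.\<close>

lemma alternating_sum_zero:
  fixes Z :: "'z \<Rightarrow> complex ^ 'v::finite"
  assumes "\<not> inj u"
  shows "(\<Sum>\<kappa> | \<kappa> permutes UNIV. \<Sum>\<pi> | \<pi> permutes UNIV. of_int (sign \<pi>) *
    (\<Prod>a\<in>UNIV. Z (u (\<kappa> a)) $ a * (if y (\<kappa> a) = \<pi> a then 1 else 0))) = 0"
proof -
  let ?P = "{\<pi>. \<pi> permutes (UNIV :: 'v set)}"
  let ?e = "\<Sum>\<pi>\<in>?P. of_int (sign \<pi>) * (\<Prod>a\<in>UNIV. if y a = \<pi> a then 1 else 0)"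
  have "(\<Sum>\<pi>\<in>?P. of_int (sign \<pi>) * (\<Prod>a\<in>UNIV. Z (u (\<kappa> a)) $ a * (if y (\<kappa> a) = \<pi> a then 1 else 0)))
    = of_int (sign \<kappa>) * (\<Prod>a\<in>UNIV. Z (u (\<kappa> a)) $ a) * ?e" if \<kappa>: "\<kappa> permutes UNIV" for \<kappa>
  proof -
    have "(\<Sum>\<pi>\<in>?P. of_int (sign \<pi>) * (\<Prod>a\<in>UNIV. Z (u (\<kappa> a)) $ a * (if y (\<kappa> a) = \<pi> a then 1 else 0)))
      = (\<Sum>\<pi>\<in>?P. of_int (sign (\<pi> \<circ> \<kappa>)) * (\<Prod>a\<in>UNIV. Z (u (\<kappa> a)) $ a * (if y (\<kappa> a) = \<pi> (\<kappa> a) then 1 else 0)))"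
      by (rule sum.reindex_bij_witness[of _ "\<lambda>\<pi>. \<pi> \<circ> \<kappa>" "\<lambda>\<pi>. \<pi> \<circ> inv \<kappa>"])
        (auto simp: permutes_compose permutes_inv \<kappa> comp_assoc permutes_inv_o[OF \<kappa>] permutes_inverses[OF \<kappa>])
    also have "\<dots> = (\<Sum>\<pi>\<in>?P. of_int (sign \<kappa>) * (\<Prod>a\<in>UNIV. Z (u (\<kappa> a)) $ a) *
        (of_int (sign \<pi>) * (\<Prod>a\<in>UNIV. if y a = \<pi> a then 1 else 0)))"
    proof (rule sum.cong)
      fix \<pi> assume "\<pi> \<in> ?P"
      then have "sign (\<pi> \<circ> \<kappa>) = sign \<pi> * sign \<kappa>"
        using \<kappa> by (simp add: sign_compose_UNIV)
      then show "of_int (sign (\<pi> \<circ> \<kappa>)) * (\<Prod>a\<in>UNIV. Z (u (\<kappa> a)) $ a * (if y (\<kappa> a) = \<pi> (\<kappa> a) then 1 else 0)) =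
        of_int (sign \<kappa>) * (\<Prod>a\<in>UNIV. Z (u (\<kappa> a)) $ a) * (of_int (sign \<pi>) * (\<Prod>a\<in>UNIV. if y a = \<pi> a then 1 else 0))"
        using prod_permutes[OF \<kappa>, of "\<lambda>a. if y a = \<pi> a then 1 else 0 :: complex"] by (simp add: prod.distrib)
    qed simp
    finally show ?thesis by (simp add: sum_distrib_left)
  qed
  then have "(\<Sum>\<kappa>\<in>?P. \<Sum>\<pi>\<in>?P. of_int (sign \<pi>) * (\<Prod>a\<in>UNIV. Z (u (\<kappa> a)) $ a * (if y (\<kappa> a) = \<pi> a then 1 else 0)))
     = (\<Sum>\<kappa>\<in>?P. of_int (sign \<kappa>) * (\<Prod>a\<in>UNIV. Z (u (\<kappa> a)) $ a)) * ?e"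
    by (simp add: sum_distrib_right)
  moreover have "(\<Sum>\<kappa>\<in>?P. of_int (sign \<kappa>) * (\<Prod>a\<in>UNIV. Z (u (\<kappa> a)) $ a)) = det (\<chi> a b. Z (u b) $ a)"
    by (simp add: det_def)
  moreover have "det (\<chi> a b. Z (u b) $ a) = 0"
  proof -
    obtain a b where "a \<noteq> b" "u a = u b" using assms by (auto simp: inj_def)
    then show ?thesis by (intro det_identical_columns[of a b]) (auto simp: column_def)
  qed
  ultimately show ?thesis by simp
qed

text \<open>Permuting the determinant slots only reorders the sum over \<open>\<sigma>\<close>, so
  it may be averaged over such permutations. These N slots hold fewer than N distinct vectors, so
  two agree and each average is a vanishing alternating sum.\<close>

lemma det_pairing_few_vectors:
  fixes Z :: "'z \<Rightarrow> complex ^ 'v::finite" and y :: "'v \<times> bool \<Rightarrow> 'v"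
  assumes "finite (range u)" "card (range u) < CARD('v)"
  shows "det_pairing (\<lambda>g. \<Prod>s\<in>UNIV. \<Sum>a\<in>UNIV. g $ a $ y s * Z (u s) $ a) = 0"
proof -
  define l where "l s g = (\<Sum>a\<in>UNIV. g $ a $ y s * Z (u s) $ a)" for s and g :: "complex ^ 'v ^ 'v"
  have l: "l s (g + h) = l s g + l s h" "l s 0 = 0" for s g h
    by (simp_all add: l_def distrib_right sum.distrib)
  have lE: "l s (matrix_unit a b) = Z (u s) $ a * (if y s = b then 1 else 0)" for s a b
  proof -
    have "l s (matrix_unit a b) = (\<Sum>i\<in>UNIV. if i = a then Z (u s) $ a * (if y s = b then 1 else 0) else 0)"
      unfolding l_def matrix_unit_def by (intro sum.cong) auto
    then show ?thesis by simp
  qed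
  let ?P = "{\<pi>. \<pi> permutes (UNIV :: 'v set)}" and ?Q = "{\<sigma>. \<sigma> permutes (UNIV :: ('v \<times> bool) set)}"
  let ?T = "\<lambda>\<sigma>. \<Prod>a\<in>UNIV. l (\<sigma> (a, True)) (matrix_unit a a)"
  let ?F = "\<lambda>\<pi> \<sigma>. of_int (sign \<pi>) * ((\<Prod>a\<in>UNIV. l (\<sigma> (a, False)) (matrix_unit a (\<pi> a))) * ?T \<sigma>)"
  \<comment> \<open>Leaving the slots with \<open>True\<close> alone keeps the factor
    \<open>?T \<sigma>\<close> common to the whole average.\<close>
  define ext where "ext \<kappa> = (\<lambda>(a, s). (if s then a else \<kappa> a, s))" for \<kappa> :: "'v \<Rightarrow> 'v"
  have ext: "ext \<kappa> permutes UNIV" if "\<kappa> permutes UNIV" for \<kappa>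
  proof (rule bij_imp_permutes)
    show "bij_betw (ext \<kappa>) UNIV UNIV"
      by (rule bij_betw_byWitness[of _ "ext (inv \<kappa>)"]) (auto simp: ext_def permutes_inverses[OF that])
  qed simp
  have inner: "(\<Sum>\<kappa>\<in>?P. \<Sum>\<pi>\<in>?P. ?F \<pi> (\<sigma> \<circ> ext \<kappa>)) = 0" for \<sigma>
  proof -
    let ?u = "\<lambda>a. u (\<sigma> (a, False))" and ?y = "\<lambda>a. y (\<sigma> (a, False))"
    have "card (range ?u) < CARD('v)"
      using card_mono[OF assms(1), of "range ?u"] assms(2) by fastforce
    then have ni: "\<not> inj ?u" using card_image[of ?u UNIV] by auto
    have "(\<Sum>\<kappa>\<in>?P. \<Sum>\<pi>\<in>?P. ?F \<pi> (\<sigma> \<circ> ext \<kappa>)) =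
      (\<Sum>\<kappa>\<in>?P. \<Sum>\<pi>\<in>?P. of_int (sign \<pi>) * (\<Prod>a\<in>UNIV. Z (?u (\<kappa> a)) $ a * (if ?y (\<kappa> a) = \<pi> a then 1 else 0))) * ?T \<sigma>"
      unfolding sum_distrib_right by (intro sum.cong refl) (simp add: ext_def lE)
    also have "(\<Sum>\<kappa>\<in>?P. \<Sum>\<pi>\<in>?P. of_int (sign \<pi>) * (\<Prod>a\<in>UNIV. Z (?u (\<kappa> a)) $ a * (if ?y (\<kappa> a) = \<pi> a then 1 else 0))) = 0"
      by (rule alternating_sum_zero[OF ni])
    finally show ?thesis by simp
  qed
  have "det_pairing (\<lambda>g. \<Prod>s\<in>UNIV. l s g) = (\<Sum>\<pi>\<in>?P. \<Sum>\<sigma>\<in>?Q. ?F \<pi> \<sigma>)"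
    by (rule det_pairing_prod[OF l])
  also have "\<dots> = (\<Sum>\<sigma>\<in>?Q. \<Sum>\<pi>\<in>?P. ?F \<pi> \<sigma>)" by (rule sum.swap)
  finally have L: "det_pairing (\<lambda>g. \<Prod>s\<in>UNIV. l s g) = (\<Sum>\<sigma>\<in>?Q. \<Sum>\<pi>\<in>?P. ?F \<pi> \<sigma>)" .
  have L\<kappa>: "(\<Sum>\<sigma>\<in>?Q. \<Sum>\<pi>\<in>?P. ?F \<pi> (\<sigma> \<circ> ext \<kappa>)) = (\<Sum>\<sigma>\<in>?Q. \<Sum>\<pi>\<in>?P. ?F \<pi> \<sigma>)" if "\<kappa> \<in> ?P" for \<kappa>
  proof -
    have e: "ext \<kappa> permutes UNIV" using ext that by simp
    show ?thesis
      by (rule sum.reindex_bij_witness[of _ "\<lambda>\<sigma>. \<sigma> \<circ> inv (ext \<kappa>)" "\<lambda>\<sigma>. \<sigma> \<circ> ext \<kappa>"])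
        (auto simp: permutes_compose permutes_inv e comp_assoc permutes_inv_o[OF e])
  qed
  have "of_nat (card ?P) * det_pairing (\<lambda>g. \<Prod>s\<in>UNIV. l s g) = (\<Sum>\<kappa>\<in>?P. \<Sum>\<sigma>\<in>?Q. \<Sum>\<pi>\<in>?P. ?F \<pi> \<sigma>)"
    unfolding L sum_constant ..
  also have "\<dots> = (\<Sum>\<kappa>\<in>?P. \<Sum>\<sigma>\<in>?Q. \<Sum>\<pi>\<in>?P. ?F \<pi> (\<sigma> \<circ> ext \<kappa>))"
    by (rule sum.cong[OF refl L\<kappa>[symmetric]])
  also have "\<dots> = (\<Sum>\<sigma>\<in>?Q. \<Sum>\<kappa>\<in>?P. \<Sum>\<pi>\<in>?P. ?F \<pi> (\<sigma> \<circ> ext \<kappa>))" by (rule sum.swap)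
  also have "\<dots> = 0" by (simp only: inner sum.neutral_const)
  finally show ?thesis by (simp add: card_permutations l_def)
qed

text \<open>No cancellation can occur: if the entries chosen by \<open>\<rho>\<close> and
  \<open>\<rho>'\<close> match those of \<open>\<pi>\<close> and \<open>id\<close> row by row, then
  \<open>\<pi> = \<rho> \<circ> \<rho>'\<close>, so every nonzero term is +1. The identity
  contributes one.\<close>

lemma det_pairing_det_square: "det_pairing (\<lambda>g :: complex ^ 'v ^ 'v::finite. det g ^ 2) \<noteq> 0"
proof -
  let ?P = "{\<pi>. \<pi> permutes (UNIV :: 'v set)}" and ?Q = "{\<sigma>. \<sigma> permutes (UNIV :: ('v \<times> bool) set)}"
  define slot where "slot \<rho> \<rho>' s = (if snd s then \<rho>' (fst s) else \<rho> (fst s))" for \<rho> \<rho>' :: "'v \<Rightarrow> 'v" and s :: "'v \<times> bool"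
  define C where "C = (\<lambda>(\<pi>, \<rho>, \<rho>', \<sigma>). \<forall>s. fst s = fst (\<sigma> s) \<and> slot \<rho> \<rho>' s = slot \<pi> id (\<sigma> s))"
  have sgn: "sign \<pi> * (sign \<rho> * sign \<rho>') = 1" if C: "C (\<pi>, \<rho>, \<rho>', \<sigma>)"
    and p: "\<pi> permutes UNIV" "\<rho> permutes UNIV" "\<rho>' permutes UNIV" "\<sigma> permutes UNIV" for \<pi> \<rho> \<rho>' \<sigma>
  proof -
    have "fst s = fst (\<sigma> s) \<and> slot \<rho> \<rho>' s = slot \<pi> id (\<sigma> s)" for s
      using C unfolding C_def prod.case by (rule spec)
    note c = this[THEN conjunct1, symmetric] this[THEN conjunct2]
    have inj: "inj \<sigma>" "inj \<rho>'" using p permutes_inj by auto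
    have cs: "(\<rho> a = \<pi> a \<and> \<rho>' a = a) \<or> (\<rho> a = a \<and> \<rho>' a = \<pi> a)" for a
    proof -
      have "\<sigma> (a, False) \<noteq> \<sigma> (a, True)" using inj(1) by (auto simp: inj_def)
      then have "snd (\<sigma> (a, False)) \<noteq> snd (\<sigma> (a, True))" using c(1)[of "(a, False)"] c(1)[of "(a, True)"]
        by (metis fst_conv prod.expand)
      then show ?thesis using c[of "(a, False)"] c[of "(a, True)"] by (auto simp: slot_def)
    qed
    \<comment> \<open>If \<open>\<rho>'\<close> fixes \<open>a\<close>, then
      \<open>\<rho> a = \<pi> a\<close>. Otherwise \<open>\<rho>' a = \<pi> a\<close>, and by
      injectivity \<open>\<rho>'\<close> does not fix \<open>\<pi> a\<close>, so
      \<open>\<rho>\<close> does.\<close>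
    have "\<rho> (\<rho>' a) = \<pi> a" for a
      using cs[of a] cs[of "\<pi> a"] inj(2) by (metis injD)
    then have "\<rho> \<circ> \<rho>' = \<pi>" by auto
    then have "sign \<pi> = sign \<rho> * sign \<rho>'"
      using sign_compose_UNIV[OF p(2,3)] by simp
    then show ?thesis by (simp add: sign_def)
  qed
  define l where "l \<rho> \<rho>' s g = g $ fst s $ slot \<rho> \<rho>' s" for \<rho> \<rho>' s and g :: "complex ^ 'v ^ 'v"
  have l: "l \<rho> \<rho>' s (g + h) = l \<rho> \<rho>' s g + l \<rho> \<rho>' s h" "l \<rho> \<rho>' s 0 = 0" for \<rho> \<rho>' s g h
    by (simp_all add: l_def)
  have sq: "det g ^ 2 = (\<Sum>\<rho>\<in>?P. \<Sum>\<rho>'\<in>?P. of_int (sign \<rho> * sign \<rho>') * (\<Prod>s\<in>UNIV. l \<rho> \<rho>' s g))" for g :: "complex ^ 'v ^ 'v"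
    by (simp add: det_def power2_eq_square sum_product prod_pair_bool l_def slot_def prod.distrib mult_ac)
  have "det_pairing (\<lambda>g :: complex ^ 'v ^ 'v. det g ^ 2) = (\<Sum>\<rho>\<in>?P. \<Sum>\<rho>'\<in>?P. \<Sum>\<pi>\<in>?P. \<Sum>\<sigma>\<in>?Q.
    of_int (sign \<pi> * (sign \<rho> * sign \<rho>')) * (\<Prod>s\<in>UNIV. l \<rho> \<rho>' s (matrix_unit (fst (\<sigma> s)) (slot \<pi> id (\<sigma> s)))))"
  proof -
    have "polarization (\<lambda>g. \<Prod>s\<in>UNIV. l \<rho> \<rho>' s g) (\<lambda>(a, s). matrix_unit a (if s then a else \<pi> a))
      = (\<Sum>\<sigma>\<in>?Q. \<Prod>s\<in>UNIV. l \<rho> \<rho>' s (matrix_unit (fst (\<sigma> s)) (slot \<pi> id (\<sigma> s))))" for \<pi> \<rho> \<rho>'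
      by (simp add: polarization_prod[OF l] slot_def case_prod_beta cong: if_cong)
    then show ?thesis
      unfolding sq det_pairing_sum det_pairing_scale det_pairing_def
      by (simp add: sum_distrib_left mult_ac)
  qed
  also have "\<dots> = (\<Sum>\<rho>\<in>?P. \<Sum>\<rho>'\<in>?P. \<Sum>\<pi>\<in>?P. \<Sum>\<sigma>\<in>?Q. if C (\<pi>, \<rho>, \<rho>', \<sigma>) then 1 else 0)"
  proof (intro sum.cong refl)
    fix \<rho> \<rho>' \<pi> \<sigma> assume p: "\<rho> \<in> ?P" "\<rho>' \<in> ?P" "\<pi> \<in> ?P" "\<sigma> \<in> ?Q"
    have "(\<Prod>s\<in>UNIV. l \<rho> \<rho>' s (matrix_unit (fst (\<sigma> s)) (slot \<pi> id (\<sigma> s)))) = (if C (\<pi>, \<rho>, \<rho>', \<sigma>) then 1 else 0)"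
    proof (cases "C (\<pi>, \<rho>, \<rho>', \<sigma>)")
      case True
      then show ?thesis by (auto simp: C_def l_def matrix_unit_def intro!: prod.neutral)
    next
      case False
      then obtain s where "\<not> (fst s = fst (\<sigma> s) \<and> slot \<rho> \<rho>' s = slot \<pi> id (\<sigma> s))" unfolding C_def prod.case by blast
      then have "l \<rho> \<rho>' s (matrix_unit (fst (\<sigma> s)) (slot \<pi> id (\<sigma> s))) = 0"
        by (simp add: l_def matrix_unit_def)
      then have "(\<Prod>s\<in>UNIV. l \<rho> \<rho>' s (matrix_unit (fst (\<sigma> s)) (slot \<pi> id (\<sigma> s)))) = 0"
        by (intro prod_zero bexI[of _ s]) simp_all
      then show ?thesis using False by simp
    qed
    then show "of_int (sign \<pi> * (sign \<rho> * sign \<rho>')) * (\<Prod>s\<in>UNIV. l \<rho> \<rho>' s (matrix_unit (fst (\<sigma> s)) (slot \<pi> id (\<sigma> s))))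
      = (if C (\<pi>, \<rho>, \<rho>', \<sigma>) then 1 else 0 :: complex)"
      using sgn[of \<pi> \<rho> \<rho>' \<sigma>] p by (simp del: of_int_mult)
  qed
  also have "\<dots> = of_nat (\<Sum>\<rho>\<in>?P. \<Sum>\<rho>'\<in>?P. \<Sum>\<pi>\<in>?P. \<Sum>\<sigma>\<in>?Q. if C (\<pi>, \<rho>, \<rho>', \<sigma>) then 1 else 0)"
    unfolding of_nat_sum by (intro sum.cong refl) simp
  also have "\<dots> \<noteq> 0"
  proof -
    have "C (id, id, id, id)" by (simp add: C_def)
    moreover have "id \<in> ?P" "id \<in> ?Q" by (auto simp: permutes_id)
    ultimately have "\<not> (\<forall>\<rho>\<in>?P. \<forall>\<rho>'\<in>?P. \<forall>\<pi>\<in>?P. \<forall>\<sigma>\<in>?Q. \<not> C (\<pi>, \<rho>, \<rho>', \<sigma>))"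
      by blast
    then show ?thesis unfolding of_nat_eq_0_iff by (simp add: sum_eq_0_iff) blast
  qed
  finally show ?thesis .
qed

section \<open>The squared determinant is not a regular function\<close>

context monomial_sum
begin

text \<open>This is the value of the form \<open>gl_act g form\<close> at the point
  \<open>z\<close>.\<close>

definition ev :: "complex ^ 'v \<Rightarrow> complex ^ 'v ^ 'v \<Rightarrow> complex"
  where "ev z g = (\<Sum>\<beta>\<in>B. c \<beta> * (\<Prod>i\<in>UNIV. \<Sum>a\<in>UNIV. g $ a $ \<beta> i * z $ a))"

text \<open>The symmetric tensor is the polarisation of the form at unit vectors; this turns
  coefficients into combinations of values.\<close>

lemma tens_polarization: "tens g \<theta> = polarization (\<lambda>z. ev z g) (\<lambda>i. axis (\<theta> i) 1)"
proof -
  define l where "l \<beta> i z = (\<Sum>a\<in>UNIV. g $ a $ \<beta> i * z $ a)" for \<beta> :: "'i \<Rightarrow> 'v" and i and z :: "complex ^ 'v"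
  have l: "l \<beta> i (x + y) = l \<beta> i x + l \<beta> i y" "l \<beta> i 0 = 0" for \<beta> i x y
    by (simp_all add: l_def distrib_left sum.distrib)
  have pp: "polarization (\<lambda>z. \<Prod>i\<in>UNIV. l \<beta> i z) A = (\<Sum>\<sigma> | \<sigma> permutes UNIV. \<Prod>i\<in>UNIV. l \<beta> i (A (\<sigma> i)))" for \<beta> A
    by (rule polarization_prod) (rule l)+
  have la: "l \<beta> i (axis a 1) = g $ a $ \<beta> i" for \<beta> i a
    by (simp add: l_def axis_def if_distrib[of "\<lambda>x. _ * x"] cong: if_cong)
  have "polarization (\<lambda>z. ev z g) (\<lambda>i. axis (\<theta> i) 1) =
    (\<Sum>\<beta>\<in>B. \<Sum>\<tau> | \<tau> permutes UNIV. c \<beta> * (\<Prod>i\<in>UNIV. l \<beta> i (axis (\<theta> (\<tau> i)) 1)))"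
    unfolding ev_def l_def[symmetric] polarization_sum polarization_scale
    by (intro sum.cong refl) (simp add: pp sum_distrib_left)
  then show ?thesis unfolding tens_alt by (subst sum.swap) (simp add: la)
qed

text \<open>Lists keep the number of factors of each product visible, which homogeneity will select
  by.\<close>

definition ev_span :: "(complex ^ 'v ^ 'v \<Rightarrow> complex) set"
  where "ev_span = {\<phi>. \<exists>xs. \<forall>g. \<phi> g = (\<Sum>(a, zs)\<leftarrow>xs. a * (\<Prod>z\<leftarrow>zs. ev z g))}"

lemma ev_span_const: "(\<lambda>_. a) \<in> ev_span"
  unfolding ev_span_def by (auto intro!: exI[of _ "[(a, [])]"])

lemma ev_span_ev: "ev z \<in> ev_span"
  unfolding ev_span_def by (auto intro!: exI[of _ "[(1, [z])]"])

lemma ev_span_add: "\<phi> \<in> ev_span \<Longrightarrow> \<psi> \<in> ev_span \<Longrightarrow> (\<lambda>g. \<phi> g + \<psi> g) \<in> ev_span"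
  unfolding ev_span_def
proof clarsimp
  fix xs ys :: "(complex \<times> (complex ^ 'v) list) list"
  show "\<exists>zs. \<forall>g. (\<Sum>(a, zs)\<leftarrow>xs. a * (\<Prod>z\<leftarrow>zs. ev z g)) + (\<Sum>(a, zs)\<leftarrow>ys. a * (\<Prod>z\<leftarrow>zs. ev z g))
    = (\<Sum>(a, zs)\<leftarrow>zs. a * (\<Prod>z\<leftarrow>zs. ev z g))"
    by (rule exI[of _ "xs @ ys"]) simp
qed

lemma ev_span_mult: "\<phi> \<in> ev_span \<Longrightarrow> \<psi> \<in> ev_span \<Longrightarrow> (\<lambda>g. \<phi> g * \<psi> g) \<in> ev_span"
  unfolding ev_span_def
proof clarsimp
  fix xs ys :: "(complex \<times> (complex ^ 'v) list) list"
  have 1: "a * (\<Prod>z\<leftarrow>us. ev z g) * (\<Sum>(a, zs)\<leftarrow>ys. a * (\<Prod>z\<leftarrow>zs. ev z g)) =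
    (\<Sum>(a, zs)\<leftarrow>map (\<lambda>(b, vs). (a * b, us @ vs)) ys. a * (\<Prod>z\<leftarrow>zs. ev z g))" for a us g
    by (induction ys) (auto simp: algebra_simps)
  show "\<exists>zs. \<forall>g. (\<Sum>(a, zs)\<leftarrow>xs. a * (\<Prod>z\<leftarrow>zs. ev z g)) * (\<Sum>(a, zs)\<leftarrow>ys. a * (\<Prod>z\<leftarrow>zs. ev z g))
    = (\<Sum>(a, zs)\<leftarrow>zs. a * (\<Prod>z\<leftarrow>zs. ev z g))"
    by (rule exI[of _ "concat (map (\<lambda>(a, us). map (\<lambda>(b, vs). (a * b, us @ vs)) ys) xs)"], rule allI, induction xs)
      (auto simp: distrib_right 1)
qed

lemma ev_span_sum: "(\<And>x. x \<in> S \<Longrightarrow> \<phi> x \<in> ev_span) \<Longrightarrow> (\<lambda>g. \<Sum>x\<in>S. \<phi> x g) \<in> ev_span"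
  by (induction S rule: infinite_finite_induct) (auto simp: ev_span_const ev_span_add)

lemma tens_ev_span: "(\<lambda>g. tens g \<theta>) \<in> ev_span"
  unfolding tens_polarization polarization_def
  by (intro ev_span_sum ev_span_mult ev_span_const ev_span_ev)

lemma regular_ev_span: "f \<in> polynomial_maps \<Longrightarrow> (\<lambda>g. f (gl_act g form)) \<in> ev_span"
proof (induction rule: polynomial_maps.induct)
  case (coord m)
  have "(\<lambda>g. (\<Sum>\<theta> | exponents \<theta> = m. tens g \<theta>) * (1 / fact CARD('i))) \<in> ev_span"
    by (intro ev_span_sum ev_span_mult ev_span_const tens_ev_span)
  then show ?case by (simp add: lookup_eq_tens)
qed (auto intro: ev_span_const ev_span_add ev_span_mult)

lemma ev_scale: "ev z (\<chi> i j. t * g $ i $ j) = t ^ CARD('i) * ev z g"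
proof -
  have "(\<Sum>a\<in>UNIV. (\<chi> i j. t * g $ i $ j) $ a $ \<beta> i * z $ a) = t * (\<Sum>a\<in>UNIV. g $ a $ \<beta> i * z $ a)" for \<beta> i
    by (simp add: sum_distrib_left mult.assoc)
  note e = this
  have "ev z (\<chi> i j. t * g $ i $ j) = (\<Sum>\<beta>\<in>B. t ^ CARD('i) * (c \<beta> * (\<Prod>i\<in>UNIV. \<Sum>a\<in>UNIV. g $ a $ \<beta> i * z $ a)))"
    unfolding ev_def by (intro sum.cong refl) (simp only: e prod.distrib prod_constant mult.left_commute)
  then show ?thesis by (simp add: ev_def sum_distrib_left)
qed

text \<open>The \<open>2 N\<close> linear factors are numbered by pairs of a list index and a
  position. Each involves only the vector at its list index, so fewer than N vectors occur.\<close>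

lemma det_pairing_prod_ev:
  assumes len: "length zs * CARD('i) = 2 * CARD('v)" "length zs < CARD('v)"
  shows "det_pairing (\<lambda>g. \<Prod>z\<leftarrow>zs. ev z g) = 0"
proof -
  let ?k = "length zs"
  let ?I = "{..<?k} \<times> (UNIV :: 'i set)"
  have "card (UNIV :: ('v \<times> bool) set) = card ?I" using len by (simp add: card_cartesian_product)
  then obtain \<rho> where \<rho>: "bij_betw \<rho> (UNIV :: ('v \<times> bool) set) ?I"
    using finite_same_card_bij by (metis finite finite_SigmaI finite_lessThan)
  have "(\<Prod>z\<leftarrow>zs. ev z g) = (\<Sum>b\<in>PiE {..<?k} (\<lambda>_. B). (\<Prod>l<?k. c (b l)) *
    (\<Prod>s\<in>UNIV. \<Sum>a\<in>UNIV. g $ a $ b (fst (\<rho> s)) (snd (\<rho> s)) * (zs ! fst (\<rho> s)) $ a))" for g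
  proof -
    have "(\<Prod>z\<leftarrow>zs. ev z g) = (\<Prod>l<?k. ev (zs ! l) g)"
      by (simp add: prod.list_conv_set_nth atLeast0LessThan)
    also have "\<dots> = (\<Sum>b\<in>PiE {..<?k} (\<lambda>_. B). \<Prod>l<?k. c (b l) * (\<Prod>i\<in>UNIV. \<Sum>a\<in>UNIV. g $ a $ b l i * (zs ! l) $ a))"
      unfolding ev_def by (rule prod_sum_PiE) auto
    also have "\<dots> = (\<Sum>b\<in>PiE {..<?k} (\<lambda>_. B). (\<Prod>l<?k. c (b l)) *
        (\<Prod>s\<in>UNIV. \<Sum>a\<in>UNIV. g $ a $ b (fst (\<rho> s)) (snd (\<rho> s)) * (zs ! fst (\<rho> s)) $ a))"
    proof (rule sum.cong)
      fix b
      have "(\<Prod>l<?k. \<Prod>i\<in>UNIV. \<Sum>a\<in>UNIV. g $ a $ b l i * (zs ! l) $ a) =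
        (\<Prod>s\<in>UNIV. \<Sum>a\<in>UNIV. g $ a $ b (fst (\<rho> s)) (snd (\<rho> s)) * (zs ! fst (\<rho> s)) $ a)"
        using prod.reindex_bij_betw[OF \<rho>, of "\<lambda>(l, i). \<Sum>a\<in>UNIV. g $ a $ b l i * (zs ! l) $ a"]
        by (simp add: prod.cartesian_product case_prod_beta)
      then show "(\<Prod>l<?k. c (b l) * (\<Prod>i\<in>UNIV. \<Sum>a\<in>UNIV. g $ a $ b l i * (zs ! l) $ a)) = (\<Prod>l<?k. c (b l)) *
        (\<Prod>s\<in>UNIV. \<Sum>a\<in>UNIV. g $ a $ b (fst (\<rho> s)) (snd (\<rho> s)) * (zs ! fst (\<rho> s)) $ a)"
        by (simp add: prod.distrib)
    qed simp
    finally show ?thesis .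
  qed
  moreover have "det_pairing (\<lambda>g. \<Prod>s\<in>UNIV. \<Sum>a\<in>UNIV. g $ a $ b (fst (\<rho> s)) (snd (\<rho> s)) * (zs ! fst (\<rho> s)) $ a) = 0" for b
  proof (rule det_pairing_few_vectors[of "\<lambda>s. fst (\<rho> s)" "\<lambda>s. b (fst (\<rho> s)) (snd (\<rho> s))" "\<lambda>l. zs ! l"])
    have "range (\<lambda>s. fst (\<rho> s)) \<subseteq> {..<?k}" using bij_betw_apply[OF \<rho> UNIV_I] unfolding mem_Times_iff by blast
    then show "card (range (\<lambda>s. fst (\<rho> s))) < CARD('v)" "finite (range (\<lambda>s. fst (\<rho> s)))"
      using card_mono[of "{..<?k}" "range (\<lambda>s. fst (\<rho> s))"] len(2) by simp_all
  qed
  ultimately show ?thesis by (simp add: det_pairing_sum det_pairing_scale)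
qed

theorem det_square_not_regular:
  assumes D: "CARD('i) > 2" and f: "f \<in> polynomial_maps" "\<And>g. f (gl_act g form) = det g ^ 2"
  shows False
proof -
  obtain xs where xs: "\<And>g. det g ^ 2 = (\<Sum>(a, zs)\<leftarrow>xs. a * (\<Prod>z\<leftarrow>zs. ev z g))"
    using regular_ev_span[OF f(1)] unfolding f(2) ev_span_def by blast
  \<comment> \<open>Replacing \<open>g\<close> by \<open>t g\<close> and comparing coefficients of
    \<open>t ^ (2 N)\<close> discards the products of any other degree.\<close>
  let ?h = "\<lambda>(a, zs :: (complex ^ 'v) list). length zs * CARD('i) = 2 * CARD('v)"
  define ys where "ys = filter ?h xs"
  have hom: "det g ^ 2 = (\<Sum>(a, zs)\<leftarrow>ys. a * (\<Prod>z\<leftarrow>zs. ev z g))" for g :: "complex ^ 'v ^ 'v"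
  proof -
    have e: "(\<Prod>z\<leftarrow>zs. ev z (\<chi> i j. t * g $ i $ j)) = t ^ (length zs * CARD('i)) * (\<Prod>z\<leftarrow>zs. ev z g)" for t zs
      by (induction zs) (simp_all add: ev_scale power_add algebra_simps)
    have d: "det (\<chi> i j. t * g $ i $ j) = t ^ CARD('v) * det g" for t
      using det_rows_mul[of "\<lambda>_. t" "\<lambda>i. g $ i"] by (simp add: vector_scalar_mult_def)
    define p where "p = (\<Sum>(a, zs)\<leftarrow>xs. Polynomial.monom (a * (\<Prod>z\<leftarrow>zs. ev z g)) (length zs * CARD('i)))"
    have "poly p t = poly (Polynomial.monom (det g ^ 2) (2 * CARD('v))) t" for t
    proof -
      have "poly p t = (\<Sum>(a, zs)\<leftarrow>xs. a * (\<Prod>z\<leftarrow>zs. ev z (\<chi> i j. t * g $ i $ j)))"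
        unfolding p_def by (induction xs) (auto simp: poly_monom e algebra_simps)
      also have "\<dots> = det (\<chi> i j. t * g $ i $ j) ^ 2" by (rule xs[symmetric])
      finally show ?thesis by (simp add: d poly_monom power_mult_distrib power_mult[symmetric] mult.commute)
    qed
    then have "p = Polynomial.monom (det g ^ 2) (2 * CARD('v))" using poly_eq_poly_eq_iff by blast
    then have "Polynomial.coeff p (2 * CARD('v)) = det g ^ 2" by simp
    moreover have "Polynomial.coeff p (2 * CARD('v)) = (\<Sum>(a, zs)\<leftarrow>ys. a * (\<Prod>z\<leftarrow>zs. ev z g))"
      unfolding p_def ys_def by (induction xs) auto
    ultimately show ?thesis by simp
  qed
  have "det_pairing (\<lambda>g :: complex ^ 'v ^ 'v. det g ^ 2) = (\<Sum>j<length ys. det_pairing (\<lambda>g. (case ys ! j of (a, zs) \<Rightarrow> a * (\<Prod>z\<leftarrow>zs. ev z g))))"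
    unfolding hom sum_list_sum_nth by (simp add: det_pairing_sum atLeast0LessThan)
  also have "\<dots> = 0"
  proof (rule sum.neutral, rule ballI)
    fix j assume "j \<in> {..<length ys}"
    then have "ys ! j \<in> set ys" by simp
    then obtain a zs where a: "ys ! j = (a, zs)" "length zs * CARD('i) = 2 * CARD('v)"
      by (auto simp: ys_def)
    \<comment> \<open>Here degree above 2 enters: \<open>3 k \<le> D k = 2 N\<close> forces
      \<open>k < N\<close>.\<close>
    have "3 * length zs \<le> length zs * CARD('i)" using D by simp
    then have "length zs < CARD('v)" using a(2) zero_less_card_finite[where 'a='v] by linarith
    then show "det_pairing (\<lambda>g. (case ys ! j of (a, zs) \<Rightarrow> a * (\<Prod>z\<leftarrow>zs. ev z g))) = 0"
      using det_pairing_prod_ev a by (simp add: det_pairing_scale)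
  qed
  finally show False using det_pairing_det_square by blast
qed

end

section \<open>The determinant trick\<close>

text \<open>Stands in for polynomials over \<open>polynomial_maps\<close>: of a characteristic
  polynomial only the degree bound and the regularity of the coefficients are needed.\<close>

definition poly_below :: "nat \<Rightarrow> ('v cpoly \<Rightarrow> complex \<Rightarrow> complex) set"
  where "poly_below d = {F. \<exists>r. (\<forall>i. r i \<in> polynomial_maps) \<and> (\<forall>p y. F p y = (\<Sum>i<d. r i p * y ^ i))}"

lemma poly_below_zero: "(\<lambda>p y. 0) \<in> poly_below d"
  unfolding poly_below_def by (auto intro!: exI[of _ "\<lambda>i p. 0"] polynomial_maps.const)

lemma poly_below_const: "(\<lambda>p y. a) \<in> poly_below 1"
  unfolding poly_below_def by (auto intro!: exI[of _ "\<lambda>i p. a"] polynomial_maps.const)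

lemma poly_below_add:
  assumes "F \<in> poly_below d" "G \<in> poly_below d"
  shows "(\<lambda>p y. F p y + G p y) \<in> poly_below d"
proof -
  obtain r q where "\<forall>i. r i \<in> polynomial_maps" "\<forall>p y. F p y = (\<Sum>i<d. r i p * y ^ i)"
    "\<forall>i. q i \<in> polynomial_maps" "\<forall>p y. G p y = (\<Sum>i<d. q i p * y ^ i)"
    using assms unfolding poly_below_def by blast
  then show ?thesis unfolding poly_below_def
    by (auto intro!: exI[of _ "\<lambda>i p. r i p + q i p"] polynomial_maps.add simp: distrib_right sum.distrib)
qed

lemma poly_below_mult:
  assumes "F \<in> poly_below d" "a \<in> polynomial_maps"
  shows "(\<lambda>p y. a p * F p y) \<in> poly_below d"
proof -
  obtain r where "\<forall>i. r i \<in> polynomial_maps" "\<forall>p y. F p y = (\<Sum>i<d. r i p * y ^ i)"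
    using assms unfolding poly_below_def by blast
  then show ?thesis unfolding poly_below_def
    by (auto intro!: exI[of _ "\<lambda>i p. a p * r i p"] polynomial_maps.mult assms simp: sum_distrib_left mult.assoc)
qed

lemma poly_below_shift:
  assumes "F \<in> poly_below d"
  shows "(\<lambda>p y. y * F p y) \<in> poly_below (Suc d)"
proof -
  obtain r where r: "\<forall>i. r i \<in> polynomial_maps" "\<forall>p y. F p y = (\<Sum>i<d. r i p * y ^ i)"
    using assms unfolding poly_below_def by blast
  define q where "q i = (case i of 0 \<Rightarrow> \<lambda>_. 0 | Suc i \<Rightarrow> r i)" for i
  have "\<forall>i. q i \<in> polynomial_maps" using r(1) by (auto simp: q_def polynomial_maps.const split: nat.split)
  moreover have "y * F p y = (\<Sum>i<Suc d. q i p * y ^ i)" for p y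
    unfolding sum.lessThan_Suc_shift r(2)[rule_format] by (simp add: q_def sum_distrib_left mult_ac)
  ultimately show ?thesis unfolding poly_below_def by blast
qed

lemma poly_below_Suc:
  assumes "F \<in> poly_below d"
  shows "F \<in> poly_below (Suc d)"
proof -
  obtain r where r: "\<forall>i. r i \<in> polynomial_maps" "\<forall>p y. F p y = (\<Sum>i<d. r i p * y ^ i)"
    using assms unfolding poly_below_def by blast
  then show ?thesis unfolding poly_below_def
    by (auto intro!: exI[of _ "\<lambda>i. if i < d then r i else (\<lambda>_. 0)"] polynomial_maps.const)
qed

lemma poly_below_sum:
  "(\<And>x. x \<in> S \<Longrightarrow> F x \<in> poly_below d) \<Longrightarrow> (\<lambda>p y. \<Sum>x\<in>S. F x p y) \<in> poly_below d"
  by (induction S rule: infinite_finite_induct) (auto simp: poly_below_zero poly_below_add)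

lemma poly_below_prod:
  assumes "finite S" "\<And>i. i \<in> S \<Longrightarrow> a i \<in> polynomial_maps"
  shows "(\<lambda>p y. \<Prod>i\<in>S. (if e i then y else 0) - a i p) \<in> poly_below (Suc (card S))"
  using assms
proof (induction S rule: finite_induct)
  case empty
  then show ?case using poly_below_const[of 1] by simp
next
  case (insert x S)
  let ?F = "\<lambda>p y. \<Prod>i\<in>S. (if e i then y else 0) - a i p"
  have F: "?F \<in> poly_below (Suc (card S))" using insert by simp
  have a: "(\<lambda>p. (-1) * a x p) \<in> polynomial_maps" using insert by (intro polynomial_maps.mult polynomial_maps.const) auto
  have "(\<lambda>p y. if e x then y * ?F p y else 0) \<in> poly_below (Suc (Suc (card S)))"
    using poly_below_shift[OF F] poly_below_zero by (cases "e x") auto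
  from poly_below_add[OF this poly_below_Suc[OF poly_below_mult[OF F a]]]
  have "(\<lambda>p y. (if e x then y * ?F p y else 0) + ((-1) * a x p) * ?F p y) \<in> poly_below (Suc (Suc (card S)))" .
  moreover have "(\<lambda>p y. (if e x then y * ?F p y else 0) + ((-1) * a x p) * ?F p y) =
    (\<lambda>p y. \<Prod>i\<in>insert x S. (if e i then y else 0) - a i p)"
    using insert by (auto simp: fun_eq_iff algebra_simps)
  ultimately show ?case using insert by simp
qed

lemma poly_below_monic_prod:
  assumes "finite S" "\<And>i. i \<in> S \<Longrightarrow> a i \<in> polynomial_maps"
  shows "(\<lambda>p y. (\<Prod>i\<in>S. y - a i p) - y ^ card S) \<in> poly_below (card S)"
  using assms
proof (induction S rule: finite_induct)
  case empty
  then show ?case by (simp add: poly_below_zero)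
next
  case (insert x S)
  let ?F = "\<lambda>p y. \<Prod>i\<in>S. y - a i p"
  have F: "?F \<in> poly_below (Suc (card S))" using poly_below_prod[of S a "\<lambda>_. True"] insert by simp
  have a: "(\<lambda>p. (-1) * a x p) \<in> polynomial_maps" using insert by (intro polynomial_maps.mult polynomial_maps.const) auto
  have "(\<lambda>p y. y * (?F p y - y ^ card S) + ((-1) * a x p) * ?F p y) \<in> poly_below (Suc (card S))"
    using insert by (intro poly_below_add poly_below_shift poly_below_mult[OF F a]) auto
  moreover have "(\<lambda>p y. y * (?F p y - y ^ card S) + ((-1) * a x p) * ?F p y) =
    (\<lambda>p y. (\<Prod>i\<in>insert x S. y - a i p) - y ^ Suc (card S))"
    using insert by (auto simp: fun_eq_iff algebra_simps)
  ultimately show ?case using insert by simp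
qed

text \<open>The characteristic polynomial of the matrix \<open>A\<close>: its coefficients are
  regular in \<open>p\<close> and serve all eigenvectors at once, and its leading term comes from
  the identity permutation alone.\<close>

lemma eigenvalue_integral:
  fixes A :: "'z::finite \<Rightarrow> 'z \<Rightarrow> 'v cpoly \<Rightarrow> complex"
  assumes A: "\<And>i j. A i j \<in> polynomial_maps"
  obtains r where "\<And>i. r i \<in> polynomial_maps"
    "\<And>p y v k. v k \<noteq> 0 \<Longrightarrow> (\<And>i. y * v i = (\<Sum>j\<in>UNIV. A i j p * v j)) \<Longrightarrow>
      y ^ CARD('z) + (\<Sum>i<CARD('z). r i p * y ^ i) = 0"
proof -
  define F where "F p y = det (\<chi> i j. (if i = j then y else 0) - A i j p)" for p y
  let ?P = "{\<pi>. \<pi> permutes (UNIV :: 'z set)}"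
  let ?G = "\<lambda>\<pi> p y. of_int (sign \<pi>) * (\<Prod>i\<in>UNIV. (if i = \<pi> i then y else 0) - A i (\<pi> i) p)"
  have "?G \<pi> \<in> poly_below CARD('z)" if "\<pi> \<in> ?P - {id}" for \<pi>
  proof -
    have "\<pi> \<noteq> id" using that by simp
    \<comment> \<open>The factor at a moved index \<open>k\<close> contains no \<open>y\<close>,
      which brings the degree below \<open>CARD('z)\<close>.\<close>
    then obtain k where k: "\<pi> k \<noteq> k" by (metis ext id_apply)
    have a: "(\<lambda>p. of_int (sign \<pi>) * ((-1) * A k (\<pi> k) p)) \<in> polynomial_maps"
      by (rule polynomial_maps.mult[OF polynomial_maps.const polynomial_maps.mult[OF polynomial_maps.const A]])
    have "(\<lambda>p y. \<Prod>i\<in>UNIV - {k}. (if i = \<pi> i then y else 0) - A i (\<pi> i) p) \<in> poly_below (Suc (card (UNIV - {k})))"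
      by (rule poly_below_prod) (auto intro: A)
    from poly_below_mult[OF this a]
    have "(\<lambda>p y. (of_int (sign \<pi>) * ((-1) * A k (\<pi> k) p)) *
      (\<Prod>i\<in>UNIV - {k}. (if i = \<pi> i then y else 0) - A i (\<pi> i) p)) \<in> poly_below (Suc (card (UNIV - {k})))" .
    moreover have "(\<Prod>i\<in>UNIV. (if i = \<pi> i then y else 0) - A i (\<pi> i) p) =
      - A k (\<pi> k) p * (\<Prod>i\<in>UNIV - {k}. (if i = \<pi> i then y else 0) - A i (\<pi> i) p)" for p y
      using k by (subst prod.remove[of _ k]) auto
    ultimately show ?thesis by (simp add: card_Diff_singleton mult.assoc)
  qed
  then have "(\<lambda>p y. \<Sum>\<pi>\<in>?P - {id}. ?G \<pi> p y) \<in> poly_below CARD('z)"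
    by (rule poly_below_sum)
  from poly_below_add[OF poly_below_monic_prod[of UNIV "\<lambda>i. A i i", OF finite A] this]
  obtain r where r: "\<And>i. r i \<in> polynomial_maps"
    and eq: "\<And>p y. ((\<Prod>i\<in>UNIV. y - A i i p) - y ^ CARD('z)) + (\<Sum>\<pi>\<in>?P - {id}. ?G \<pi> p y) = (\<Sum>i<CARD('z). r i p * y ^ i)"
    unfolding poly_below_def by blast
  have F: "F p y = y ^ CARD('z) + (\<Sum>i<CARD('z). r i p * y ^ i)" for p y
  proof -
    have "F p y = (\<Sum>\<pi>\<in>?P. ?G \<pi> p y)" by (simp add: F_def det_def)
    also have "\<dots> = (\<Prod>i\<in>UNIV. y - A i i p) + (\<Sum>\<pi>\<in>?P - {id}. ?G \<pi> p y)"
      by (subst sum.remove[of _ id]) (auto simp: permutes_id)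
    finally show ?thesis unfolding eq[symmetric] by simp
  qed
  show thesis
  proof (rule that[OF r])
    fix p y and v :: "'z \<Rightarrow> complex" and k
    assume v: "v k \<noteq> 0" "\<And>i. y * v i = (\<Sum>j\<in>UNIV. A i j p * v j)"
    let ?M = "\<chi> i j. (if i = j then y else 0) - A i j p"
    have "?M *v (\<chi> i. v i) = 0"
      by (simp add: matrix_vector_mult_def vec_eq_iff left_diff_distrib sum_subtractf v(2)[symmetric]
          if_distrib[of "\<lambda>x. x * _"] cong: if_cong)
    moreover have "(\<chi> i. v i) \<noteq> 0" using v(1) by (auto simp: vec_eq_iff)
    ultimately have "\<not> invertible ?M" unfolding invertible_left_inverse matrix_left_invertible_ker by blast
    then have "F p y = 0" by (simp add: F_def invertible_det_nz)
    then show "y ^ CARD('z) + (\<Sum>i<CARD('z). r i p * y ^ i) = 0" by (simp add: F)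
  qed
qed

section \<open>Integrality of the determinant\<close>

text \<open>\<open>free\<close> makes the monomials squarefree and lets each be written by one word
  only. With the constant weight this leaves a single term in the contraction below; the partition
  \<open>P\<close> lets the contraction reach every variable exactly once.\<close>

locale balanced_form = monomial_sum B c
  for B :: "('i::finite \<Rightarrow> 'v::finite) set" and c :: "('i \<Rightarrow> 'v) \<Rightarrow> complex" +
  fixes \<omega> :: "'v \<Rightarrow> nat" and s :: nat and P :: "('i \<Rightarrow> 'v) set"
  assumes c_nonzero: "\<beta> \<in> B \<Longrightarrow> c \<beta> \<noteq> 0"
    and free: "\<beta> \<in> B \<Longrightarrow> \<tau> permutes UNIV \<Longrightarrow> \<beta> \<circ> \<tau> \<in> B \<Longrightarrow> \<tau> = id"
    and \<omega>: "bij_betw \<omega> UNIV {..<CARD('v)}"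
    and weight: "\<beta> \<in> B \<Longrightarrow> (\<Sum>i\<in>UNIV. \<omega> (\<beta> i)) = s"
    and P: "P \<subseteq> B"
    and partition: "bij_betw (\<lambda>(\<beta>, i). \<beta> i) (P \<times> UNIV) UNIV"
begin

lemma \<omega>_inj: "\<omega> a = \<omega> b \<longleftrightarrow> a = b"
  using \<omega> by (auto simp: bij_betw_def inj_def)

lemma \<omega>_less: "\<omega> a < CARD('v)"
  using \<omega> by (auto simp: bij_betw_def)

text \<open>Up to sign, the minor of \<open>g\<close> in the first \<open>t\<close> columns for the ordering \<open>\<omega>\<close> and in the rows that
  are not values of \<open>z\<close> at the other columns (zero if \<open>z\<close> is not injective there).\<close>

definition minor :: "nat \<Rightarrow> ('v \<Rightarrow> 'v) \<Rightarrow> complex ^ 'v ^ 'v \<Rightarrow> complex"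
  where "minor t z g = det (\<chi> r. if \<omega> r < t then column r g else axis (z r) 1)"

text \<open>Linearity in row \<open>a\<close>, the only row that sees \<open>z a\<close>; since
  \<open>\<omega> a = t\<close> it is not yet filled by a column of \<open>g\<close>.\<close>

lemma minor_expand:
  assumes "\<omega> a = t"
  shows "(\<Sum>j\<in>UNIV. x $ j * minor t (z(a := j)) g) =
    det (\<chi> r. if r = a then x else if \<omega> r < t then column r g else axis (z r) 1)"
proof -
  let ?c = "\<lambda>r. if \<omega> r < t then column r g else axis (z r) 1"
  have "minor t (z(a := j)) g = det (\<chi> r. if r = a then axis j 1 else ?c r)" for j
    unfolding minor_def using assms by (intro arg_cong[of _ _ det]) (auto simp: vec_eq_iff)
  then have "(\<Sum>j\<in>UNIV. x $ j * minor t (z(a := j)) g) = (\<Sum>j\<in>UNIV. det (\<chi> r. if r = a then x $ j *s axis j 1 else ?c r))"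
    using det_row_mul[of a _ "\<lambda>_. axis _ 1" ?c] by simp
  also have "\<dots> = det (\<chi> r. if r = a then (\<Sum>j\<in>UNIV. x $ j *s axis j 1) else ?c r)"
    using det_linear_row_sum[of UNIV a "\<lambda>_ j. x $ j *s axis j 1" ?c] by simp
  finally show ?thesis unfolding basis_expansion .
qed

text \<open>Contracting with column \<open>a\<close> fills the next free row and so enlarges the
  minor by one.\<close>

lemma minor_step:
  assumes "\<omega> a = t"
  shows "(\<Sum>j\<in>UNIV. g $ j $ a * minor t (z(a := j)) g) = minor (Suc t) z g"
proof -
  have "(\<Sum>j\<in>UNIV. g $ j $ a * minor t (z(a := j)) g) = (\<Sum>j\<in>UNIV. column a g $ j * minor t (z(a := j)) g)"
    by (simp add: column_def)
  also have "\<dots> = det (\<chi> r. if r = a then column a g else if \<omega> r < t then column r g else axis (z r) 1)"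
    by (rule minor_expand[OF assms])
  also have "\<dots> = minor (Suc t) z g"
  proof -
    have "\<omega> r < Suc t \<longleftrightarrow> r = a \<or> \<omega> r < t" for r
      using \<omega>_inj[of r a] assms by auto
    then show ?thesis unfolding minor_def by (intro arg_cong[of _ _ det]) (auto simp: vec_eq_iff)
  qed
  finally show ?thesis .
qed

text \<open>Column \<open>b\<close> already occurs in the minor, so contracting with it repeats a
  row.\<close>

lemma minor_kill:
  assumes "\<omega> b < \<omega> a"
  shows "(\<Sum>j\<in>UNIV. g $ j $ b * minor (\<omega> a) (z(a := j)) g) = 0"
proof -
  have "(\<Sum>j\<in>UNIV. g $ j $ b * minor (\<omega> a) (z(a := j)) g) = (\<Sum>j\<in>UNIV. column b g $ j * minor (\<omega> a) (z(a := j)) g)"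
    by (simp add: column_def)
  also have "\<dots> = det (\<chi> r. if r = a then column b g else if \<omega> r < \<omega> a then column r g else axis (z r) 1)"
    by (rule minor_expand) simp
  also have "\<dots> = 0"
    using assms by (intro det_identical_rows[of a b]) (auto simp: row_def vec_eq_iff)
  finally show ?thesis .
qed

lemma minor_top: "minor CARD('v) z g = det g"
proof -
  have "(\<chi> r. if \<omega> r < CARD('v) then column r g else axis (z r) 1) = transpose g"
    using \<omega>_less by (auto simp: vec_eq_iff column_def transpose_def)
  then show ?thesis by (simp add: minor_def)
qed

text \<open>Downward from \<open>det g\<close>: a minor of size \<open>t + 1\<close> is a
  combination of minors of size \<open>t\<close>.\<close>

lemma minor_nonzero:
  assumes "det g \<noteq> 0" "t \<le> CARD('v)"
  shows "\<exists>z. minor t z g \<noteq> 0"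
  using assms(2)
proof (induction rule: inc_induct)
  case base
  then show ?case using assms(1) minor_top by simp
next
  case (step t)
  then obtain z where z: "minor (Suc t) z g \<noteq> 0" by blast
  obtain a where a: "\<omega> a = t" using \<omega> step.hyps by (metis bij_betw_iff_bijections lessThan_iff)
  show ?case
  proof (rule ccontr)
    assume "\<not> ?case"
    then show False using minor_step[OF a, of g z] z by simp
  qed
qed

text \<open>Only \<open>\<beta>\<^sub>0\<close> itself contributes: the minors vanish unless every weight weakly increases,
  and the total weights agree.\<close>

lemma contraction:
  assumes \<beta>0: "\<beta>\<^sub>0 \<in> B"
  shows "(\<Sum>\<theta>\<in>UNIV. (\<Prod>i\<in>UNIV. minor (\<omega> (\<beta>\<^sub>0 i)) ((z i)(\<beta>\<^sub>0 i := \<theta> i)) g) * tens g \<theta>) =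
    c \<beta>\<^sub>0 * (\<Prod>i\<in>UNIV. minor (Suc (\<omega> (\<beta>\<^sub>0 i))) (z i) g)"
proof -
  let ?m = "\<lambda>i j. minor (\<omega> (\<beta>\<^sub>0 i)) ((z i)(\<beta>\<^sub>0 i := j)) g"
  let ?M = "\<Prod>i\<in>UNIV. minor (Suc (\<omega> (\<beta>\<^sub>0 i))) (z i) g"
  let ?P = "{\<tau>. \<tau> permutes (UNIV :: 'i set)}"
  have "(\<Sum>\<theta>\<in>UNIV. (\<Prod>i\<in>UNIV. ?m i (\<theta> i)) * tens g \<theta>) =
    (\<Sum>\<theta>\<in>UNIV. \<Sum>\<tau>\<in>?P. \<Sum>\<beta>\<in>B. c \<beta> * (\<Prod>i\<in>UNIV. g $ \<theta> i $ \<beta> (\<tau> i) * ?m i (\<theta> i)))"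
    by (simp add: tens_def sum_distrib_left prod.distrib mult_ac)
  also have "\<dots> = (\<Sum>\<tau>\<in>?P. \<Sum>\<beta>\<in>B. \<Sum>\<theta>\<in>UNIV. c \<beta> * (\<Prod>i\<in>UNIV. g $ \<theta> i $ \<beta> (\<tau> i) * ?m i (\<theta> i)))"
    by (subst sum.swap, rule sum.cong[OF refl], rule sum.swap)
  also have "\<dots> = (\<Sum>\<tau>\<in>?P. \<Sum>\<beta>\<in>B. c \<beta> * (\<Prod>i\<in>UNIV. \<Sum>j\<in>UNIV. g $ j $ \<beta> (\<tau> i) * ?m i j))"
    by (simp add: prod_sum_UNIV sum_distrib_left)
  also have "\<dots> = (\<Sum>\<tau>\<in>?P. \<Sum>\<beta>\<in>B. if \<tau> = id then if \<beta> = \<beta>\<^sub>0 then c \<beta>\<^sub>0 * ?M else 0 else 0)"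
  proof (intro sum.cong refl)
    fix \<tau> \<beta> assume \<tau>: "\<tau> \<in> ?P" and \<beta>: "\<beta> \<in> B"
    show "c \<beta> * (\<Prod>i\<in>UNIV. \<Sum>j\<in>UNIV. g $ j $ \<beta> (\<tau> i) * ?m i j) =
      (if \<tau> = id then if \<beta> = \<beta>\<^sub>0 then c \<beta>\<^sub>0 * ?M else 0 else 0)"
    proof (cases "\<beta> \<circ> \<tau> = \<beta>\<^sub>0")
      case True
      then have "\<tau> = id" using free \<beta>0 \<beta> \<tau> by simp
      then show ?thesis using True by (simp add: minor_step)
    next
      case False
      have "\<exists>i. \<omega> (\<beta> (\<tau> i)) < \<omega> (\<beta>\<^sub>0 i)"
      proof (rule ccontr)
        assume "\<not> ?thesis"
        then have le: "\<omega> (\<beta>\<^sub>0 i) \<le> \<omega> (\<beta> (\<tau> i))" for i by (simp add: not_less)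
        have "(\<Sum>i\<in>UNIV. \<omega> (\<beta> (\<tau> i))) = s"
          using sum.permute[of \<tau> UNIV "\<lambda>i. \<omega> (\<beta> i)"] \<tau> weight[OF \<beta>] by (simp add: o_def)
        then have "\<omega> (\<beta>\<^sub>0 i) = \<omega> (\<beta> (\<tau> i))" for i
          using sum_mono_inv[of "\<lambda>i. \<omega> (\<beta>\<^sub>0 i)" UNIV "\<lambda>i. \<omega> (\<beta> (\<tau> i))" i] le weight[OF \<beta>0] by simp
        then show False using False by (auto simp: \<omega>_inj)
      qed
      then obtain i where "\<omega> (\<beta> (\<tau> i)) < \<omega> (\<beta>\<^sub>0 i)" by blast
      then have "(\<Sum>j\<in>UNIV. g $ j $ \<beta> (\<tau> i) * ?m i j) = 0" by (rule minor_kill)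
      then have "(\<Prod>i\<in>UNIV. \<Sum>j\<in>UNIV. g $ j $ \<beta> (\<tau> i) * ?m i j) = 0"
        by (intro prod_zero bexI[of _ i]) simp_all
      then show ?thesis using False by auto
    qed
  qed
  also have "\<dots> = c \<beta>\<^sub>0 * ?M"
  proof -
    have "(\<Sum>\<beta>\<in>B. if \<tau> = id then if \<beta> = \<beta>\<^sub>0 then c \<beta>\<^sub>0 * ?M else 0 else 0) = (if \<tau> = id then c \<beta>\<^sub>0 * ?M else 0)" for \<tau> :: "'i \<Rightarrow> 'i"
      using \<beta>0 by simp
    then show ?thesis by (simp add: permutes_id)
  qed
  finally show ?thesis .
qed

text \<open>For \<open>A = UNIV\<close> there is one minor of each size from 0 to
  \<open>CARD('v) - 1\<close>; the finitely many \<open>Z\<close> index the module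
  generators.\<close>

definition flag_prod :: "'v set \<Rightarrow> ('v \<Rightarrow> 'v \<Rightarrow> 'v) \<Rightarrow> complex ^ 'v ^ 'v \<Rightarrow> complex"
  where "flag_prod A Z g = (\<Prod>a\<in>A. minor (\<omega> a) (Z a) g)"

text \<open>The module over the functions regular on the orbit that is generated by the products of minors.\<close>

definition flag_span :: "'v set \<Rightarrow> (complex ^ 'v ^ 'v \<Rightarrow> complex) set"
  where "flag_span A = {\<phi>. \<exists>r. (\<forall>Z. r Z \<in> polynomial_maps) \<and>
    (\<forall>g. \<phi> g = (\<Sum>Z\<in>UNIV. r Z (gl_act g form) * flag_prod A Z g))}"

lemma flag_span_gen:
  assumes "f \<in> polynomial_maps"
  shows "(\<lambda>g. f (gl_act g form) * flag_prod A Z g) \<in> flag_span A"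
proof -
  let ?r = "\<lambda>Z'. if Z' = Z then f else (\<lambda>_. 0)"
  have "f (gl_act g form) * flag_prod A Z g = (\<Sum>Z'\<in>UNIV. ?r Z' (gl_act g form) * flag_prod A Z' g)" for g
  proof -
    have "(\<Sum>Z'\<in>UNIV. ?r Z' (gl_act g form) * flag_prod A Z' g) =
      (\<Sum>Z'\<in>UNIV. if Z' = Z then f (gl_act g form) * flag_prod A Z g else 0)"
      by (intro sum.cong) auto
    then show ?thesis by simp
  qed
  then show ?thesis unfolding flag_span_def using assms
    by (auto intro!: exI[of _ ?r] polynomial_maps.const)
qed

lemma flag_span_add:
  assumes "\<phi> \<in> flag_span A" "\<psi> \<in> flag_span A"
  shows "(\<lambda>g. \<phi> g + \<psi> g) \<in> flag_span A"
proof -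
  obtain r q where "\<forall>Z. r Z \<in> polynomial_maps" "\<forall>g. \<phi> g = (\<Sum>Z\<in>UNIV. r Z (gl_act g form) * flag_prod A Z g)"
    "\<forall>Z. q Z \<in> polynomial_maps" "\<forall>g. \<psi> g = (\<Sum>Z\<in>UNIV. q Z (gl_act g form) * flag_prod A Z g)"
    using assms unfolding flag_span_def by blast
  then show ?thesis unfolding flag_span_def
    by (auto intro!: exI[of _ "\<lambda>Z p. r Z p + q Z p"] polynomial_maps.add simp: distrib_right sum.distrib)
qed

lemma flag_span_zero: "(\<lambda>g. 0) \<in> flag_span A"
  using flag_span_gen[OF polynomial_maps.const[of 0]] by simp

lemma flag_span_sum: "(\<And>x. x \<in> S \<Longrightarrow> \<phi> x \<in> flag_span A) \<Longrightarrow> (\<lambda>g. \<Sum>x\<in>S. \<phi> x g) \<in> flag_span A"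
  by (induction S rule: infinite_finite_induct) (auto simp: flag_span_zero flag_span_add)

lemma flag_span_mult:
  assumes "\<phi> \<in> flag_span A" "\<psi> \<in> flag_span A'" "A \<inter> A' = {}"
  shows "(\<lambda>g. \<phi> g * \<psi> g) \<in> flag_span (A \<union> A')"
proof -
  obtain r q where r: "\<forall>Z. r Z \<in> polynomial_maps" "\<forall>g. \<phi> g = (\<Sum>Z\<in>UNIV. r Z (gl_act g form) * flag_prod A Z g)"
    and q: "\<forall>Z. q Z \<in> polynomial_maps" "\<forall>g. \<psi> g = (\<Sum>Z\<in>UNIV. q Z (gl_act g form) * flag_prod A' Z g)"
    using assms(1,2) unfolding flag_span_def by blast
  have fpm: "flag_prod A Z g * flag_prod A' Z' g = flag_prod (A \<union> A') (override_on Z Z' A') g" for Z Z' g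
  proof -
    have "flag_prod A Z g = flag_prod A (override_on Z Z' A') g"
      unfolding flag_prod_def using assms(3) by (intro prod.cong) (auto simp: override_on_def)
    moreover have "flag_prod A' Z' g = flag_prod A' (override_on Z Z' A') g"
      unfolding flag_prod_def by (intro prod.cong) (auto simp: override_on_def)
    ultimately show ?thesis
      unfolding flag_prod_def using assms(3) by (simp add: prod.union_disjoint)
  qed
  have "\<phi> g * \<psi> g = (\<Sum>Z\<in>UNIV. \<Sum>Z'\<in>UNIV. (r Z (gl_act g form) * q Z' (gl_act g form)) * flag_prod (A \<union> A') (override_on Z Z' A') g)" for g
    unfolding r(2)[rule_format] q(2)[rule_format] sum_product
    by (intro sum.cong refl) (simp only: fpm[symmetric] mult_ac)
  then have "(\<lambda>g. \<phi> g * \<psi> g) = (\<lambda>g. \<Sum>Z\<in>UNIV. \<Sum>Z'\<in>UNIV. (\<lambda>p. r Z p * q Z' p) (gl_act g form) * flag_prod (A \<union> A') (override_on Z Z' A') g)"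
    by (simp add: fun_eq_iff)
  also have "\<dots> \<in> flag_span (A \<union> A')"
    using r(1) q(1) by (intro flag_span_sum flag_span_gen polynomial_maps.mult) auto
  finally show ?thesis .
qed

lemma P_inj: "\<beta> \<in> P \<Longrightarrow> inj \<beta>"
  using partition by (auto simp: bij_betw_def inj_on_def)

lemma P_disjoint: "\<beta> \<in> P \<Longrightarrow> \<beta>' \<in> P \<Longrightarrow> \<beta> \<noteq> \<beta>' \<Longrightarrow> range \<beta> \<inter> range \<beta>' = {}"
  using partition by (auto simp: bij_betw_def inj_on_def)

text \<open>On a block the contraction expresses the minors enlarged by one through the original
  ones, with tensor entries of \<open>g w\<close> as coefficients; \<open>c_nonzero\<close> allows
  the division.\<close>

lemma flag_span_block:
  assumes "\<beta> \<in> P"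
  shows "(\<lambda>g. \<Prod>i\<in>UNIV. minor (Suc (\<omega> (\<beta> i))) (z (\<beta> i)) g) \<in> flag_span (range \<beta>)"
proof -
  have \<beta>: "\<beta> \<in> B" "inj \<beta>" using P P_inj assms by auto
  define Z where "Z \<theta> a = (z a)(a := \<theta> (inv \<beta> a))" for \<theta> :: "'i \<Rightarrow> 'v" and a
  obtain T where T: "\<And>\<theta>. T \<theta> \<in> polynomial_maps" "\<And>\<theta> g. T \<theta> (gl_act g form) = tens g \<theta>"
    using tens_regular by metis
  have fp: "(\<Prod>i\<in>UNIV. minor (\<omega> (\<beta> i)) ((z (\<beta> i))(\<beta> i := \<theta> i)) g) = flag_prod (range \<beta>) (Z \<theta>) g" for \<theta> g
    unfolding flag_prod_def using \<beta>(2) by (subst prod.reindex) (simp_all add: Z_def)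
  have "(\<Prod>i\<in>UNIV. minor (Suc (\<omega> (\<beta> i))) (z (\<beta> i)) g) =
    (\<Sum>\<theta>\<in>UNIV. (\<lambda>p. (1 / c \<beta>) * T \<theta> p) (gl_act g form) * flag_prod (range \<beta>) (Z \<theta>) g)" for g
    using contraction[OF \<beta>(1), of "\<lambda>i. z (\<beta> i)" g] c_nonzero[OF \<beta>(1)]
    by (simp add: fp T(2) field_simps sum_divide_distrib[symmetric])
  then show ?thesis
    using T(1) by (simp only:) (intro flag_span_sum flag_span_gen polynomial_maps.mult polynomial_maps.const)
qed

lemma flag_span_shift: "(\<lambda>g. \<Prod>a\<in>UNIV. minor (Suc (\<omega> a)) (z a) g) \<in> flag_span UNIV"
proof -
  have "finite Q \<Longrightarrow> Q \<subseteq> P \<Longrightarrow> (\<lambda>g. \<Prod>\<beta>\<in>Q. \<Prod>i\<in>UNIV. minor (Suc (\<omega> (\<beta> i))) (z (\<beta> i)) g) \<in> flag_span (\<Union>\<beta>\<in>Q. range \<beta>)" for Q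
  proof (induction Q rule: finite_induct)
    case empty
    have "(\<lambda>g. 1 * flag_prod {} undefined g) \<in> flag_span {}" by (rule flag_span_gen) (rule polynomial_maps.const)
    then show ?case by (simp add: flag_prod_def)
  next
    case (insert \<beta> Q)
    have "range \<beta> \<inter> (\<Union>\<beta>\<in>Q. range \<beta>) = {}" using P_disjoint[of \<beta>] insert by blast
    from flag_span_mult[OF flag_span_block insert.IH this] insert show ?case by simp
  qed
  from this[of P] have "(\<lambda>g. \<Prod>\<beta>\<in>P. \<Prod>i\<in>UNIV. minor (Suc (\<omega> (\<beta> i))) (z (\<beta> i)) g) \<in> flag_span (\<Union>\<beta>\<in>P. range \<beta>)"
    by simp
  moreover have "(\<Union>\<beta>\<in>P. range \<beta>) = UNIV"
  proof -
    have "(\<Union>\<beta>\<in>P. range \<beta>) = (\<lambda>(\<beta>, i). \<beta> i) ` (P \<times> UNIV)" by force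
    then show ?thesis using bij_betw_imp_surj_on[OF partition] by simp
  qed
  moreover have "(\<Prod>\<beta>\<in>P. \<Prod>i\<in>UNIV. minor (Suc (\<omega> (\<beta> i))) (z (\<beta> i)) g) = (\<Prod>a\<in>UNIV. minor (Suc (\<omega> a)) (z a) g)" for g
    using prod.reindex_bij_betw[OF partition, of "\<lambda>a. minor (Suc (\<omega> a)) (z a) g"] by (simp add: prod.cartesian_product case_prod_beta)
  ultimately show ?thesis by simp
qed

text \<open>As \<open>det g\<close> is the minor of size N, the product has minors of sizes 0 to N.
  Without the constant one of size 0 there remain sizes 1 to N, that is, every minor enlarged by
  one.\<close>

lemma det_flag_prod: "(\<lambda>g. det g * flag_prod UNIV Z g) \<in> flag_span UNIV"
proof -
  let ?N = "CARD('v)"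
  define y where "y t = Z (inv \<omega> t)" for t
  have y: "y (\<omega> a) = Z a" for a using \<omega> by (simp add: y_def bij_betw_def)
  have r: "(\<Prod>a\<in>UNIV. F (\<omega> a)) = (\<Prod>t<?N. F t)" for F :: "nat \<Rightarrow> complex"
    using prod.reindex_bij_betw[OF \<omega>, of F] .
  have "det g * flag_prod UNIV Z g = minor 0 (y 0) g * (\<Prod>a\<in>UNIV. minor (Suc (\<omega> a)) (y (Suc (\<omega> a))) g)" for g
  proof -
    have "flag_prod UNIV Z g = (\<Prod>t<?N. minor t (y t) g)"
      unfolding flag_prod_def using r[of "\<lambda>t. minor t (y t) g"] by (simp add: y)
    then have "det g * flag_prod UNIV Z g = (\<Prod>t<Suc ?N. minor t (y t) g)" by (simp add: minor_top)
    also have "\<dots> = minor 0 (y 0) g * (\<Prod>t<?N. minor (Suc t) (y (Suc t)) g)"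
      by (rule prod.lessThan_Suc_shift)
    finally show ?thesis using r[of "\<lambda>t. minor (Suc t) (y (Suc t)) g"] by simp
  qed
  moreover have "minor 0 (y 0) g = minor 0 (y 0) 0" for g by (simp add: minor_def)
  ultimately have eq: "det g * flag_prod UNIV Z g = minor 0 (y 0) 0 * (\<Prod>a\<in>UNIV. minor (Suc (\<omega> a)) (y (Suc (\<omega> a))) g)" for g
    by metis
  have "(\<lambda>g. minor 0 (y 0) 0 * flag_prod {} undefined g) \<in> flag_span {}"
    by (rule flag_span_gen) (rule polynomial_maps.const)
  from flag_span_mult[OF this flag_span_shift[of "\<lambda>a. y (Suc (\<omega> a))"]]
  show ?thesis unfolding eq by (simp add: flag_prod_def)
qed

text \<open>The products \<open>flag_prod UNIV Z g\<close> form an eigenvector with eigenvalue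
  \<open>det g\<close> of a matrix with regular entries, and it is nonzero if \<open>g\<close> is
  invertible.\<close>

theorem det_square_integral:
  "\<exists>n r. (\<forall>i. r i \<in> polynomial_maps) \<and>
    (\<forall>g. det g \<noteq> 0 \<longrightarrow> (det g ^ 2) ^ n + (\<Sum>i<n. r i (gl_act g form) * (det g ^ 2) ^ i) = 0)"
proof -
  have "\<forall>Z. \<exists>r. (\<forall>Z'. r Z' \<in> polynomial_maps) \<and>
    (\<forall>g. det g * flag_prod UNIV Z g = (\<Sum>Z'\<in>UNIV. r Z' (gl_act g form) * flag_prod UNIV Z' g))"
    using det_flag_prod unfolding flag_span_def by blast
  from choice[OF this]
  obtain A where A: "\<And>Z Z'. A Z Z' \<in> polynomial_maps"
    and eq: "\<And>Z g. det g * flag_prod UNIV Z g = (\<Sum>Z'\<in>UNIV. A Z Z' (gl_act g form) * flag_prod UNIV Z' g)"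
    by blast
  \<comment> \<open>Squaring the matrix gives the eigenvalue \<open>(det g)^2\<close>, the quantity
    that is shown to be rational.\<close>
  define A2 where "A2 Z Z' p = (\<Sum>Y\<in>UNIV. A Z Y p * A Y Z' p)" for Z Z' p
  have A2: "A2 Z Z' \<in> polynomial_maps" for Z Z'
    unfolding A2_def by (intro polynomial_maps_sum polynomial_maps.mult A)
  have eq2: "det g ^ 2 * flag_prod UNIV Z g = (\<Sum>Z'\<in>UNIV. A2 Z Z' (gl_act g form) * flag_prod UNIV Z' g)" for Z g
  proof -
    have "det g ^ 2 * flag_prod UNIV Z g = det g * (\<Sum>Y\<in>UNIV. A Z Y (gl_act g form) * flag_prod UNIV Y g)"
      unfolding eq[symmetric] by (simp add: power2_eq_square)
    also have "\<dots> = (\<Sum>Y\<in>UNIV. A Z Y (gl_act g form) * (det g * flag_prod UNIV Y g))"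
      unfolding sum_distrib_left by (simp add: mult.left_commute)
    also have "\<dots> = (\<Sum>Y\<in>UNIV. \<Sum>Z'\<in>UNIV. A Z Y (gl_act g form) * A Y Z' (gl_act g form) * flag_prod UNIV Z' g)"
      unfolding eq sum_distrib_left by (simp add: mult.assoc)
    also have "\<dots> = (\<Sum>Z'\<in>UNIV. A2 Z Z' (gl_act g form) * flag_prod UNIV Z' g)"
      unfolding A2_def sum_distrib_right by (rule sum.swap)
    finally show ?thesis .
  qed
  obtain r where r: "\<And>i. r i \<in> polynomial_maps"
    "\<And>p y v k. v k \<noteq> 0 \<Longrightarrow> (\<And>i. y * v i = (\<Sum>j\<in>UNIV. A2 i j p * v j)) \<Longrightarrow>
      y ^ CARD('v \<Rightarrow> 'v \<Rightarrow> 'v) + (\<Sum>i<CARD('v \<Rightarrow> 'v \<Rightarrow> 'v). r i p * y ^ i) = 0"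
    using eigenvalue_integral[of A2, OF A2] by blast
  show ?thesis
  proof (intro exI[of _ "CARD('v \<Rightarrow> 'v \<Rightarrow> 'v)"] exI[of _ r] conjI allI impI r(1))
    fix g :: "complex ^ 'v ^ 'v" assume g: "det g \<noteq> 0"
    have "\<forall>a. \<exists>z. minor (\<omega> a) z g \<noteq> 0" using minor_nonzero[OF g] \<omega>_less by (meson less_imp_le)
    then obtain Z where "\<And>a. minor (\<omega> a) (Z a) g \<noteq> 0" by metis
    then have "flag_prod UNIV Z g \<noteq> 0" by (simp add: flag_prod_def)
    then show "(det g ^ 2) ^ CARD('v \<Rightarrow> 'v \<Rightarrow> 'v) + (\<Sum>i<CARD('v \<Rightarrow> 'v \<Rightarrow> 'v). r i (gl_act g form) * (det g ^ 2) ^ i) = 0"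
      by (rule r(2)[of "\<lambda>Z. flag_prod UNIV Z g"]) (rule eq2)
  qed
qed

end

section \<open>Stabilisers containing a torus\<close>

text \<open>Calculation modulo an ideal without a quotient type. \<open>int_cancel\<close> makes the
  quotient torsion free, so that differences of distinct integer eigenvalues can be
  cancelled.\<close>

locale cong_ideal =
  fixes I :: "'r::comm_ring_1 set"
  assumes zero_mem: "0 \<in> I" and add_mem: "x \<in> I \<Longrightarrow> y \<in> I \<Longrightarrow> x + y \<in> I"
    and mult_mem: "x \<in> I \<Longrightarrow> a * x \<in> I"
    and int_cancel: "n \<noteq> 0 \<Longrightarrow> of_int n * x \<in> I \<Longrightarrow> x \<in> I"
begin

definition eqv (infix \<open>\<doteq>\<close> 50) where "x \<doteq> y \<longleftrightarrow> x - y \<in> I"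

lemma uminus_mem: "x \<in> I \<Longrightarrow> - x \<in> I"
  using mult_mem[of x "-1"] by simp

lemma eqv_0: "x \<doteq> 0 \<longleftrightarrow> x \<in> I"
  by (simp add: eqv_def)

lemma eqv_refl [simp]: "x \<doteq> x"
  by (simp add: eqv_def zero_mem)

lemma eqv_sym: "x \<doteq> y \<Longrightarrow> y \<doteq> x"
  using uminus_mem[of "x - y"] by (simp add: eqv_def)

lemma eqv_trans [trans]: "x \<doteq> y \<Longrightarrow> y \<doteq> z \<Longrightarrow> x \<doteq> z"
  using add_mem[of "x - y" "y - z"] by (simp add: eqv_def)

lemma eqv_add: "x \<doteq> x' \<Longrightarrow> y \<doteq> y' \<Longrightarrow> x + y \<doteq> x' + y'"
  using add_mem[of "x - x'" "y - y'"] by (simp add: eqv_def algebra_simps)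

lemma eqv_mult: "x \<doteq> x' \<Longrightarrow> y \<doteq> y' \<Longrightarrow> x * y \<doteq> x' * y'"
proof -
  assume "x \<doteq> x'" "y \<doteq> y'"
  then have "y * (x - x') + x' * (y - y') \<in> I" by (intro add_mem mult_mem) (auto simp: eqv_def)
  then show ?thesis by (simp add: eqv_def algebra_simps)
qed

lemma eqv_sum: "(\<And>i. i \<in> S \<Longrightarrow> f i \<doteq> g i) \<Longrightarrow> sum f S \<doteq> sum g S"
  by (induction S rule: infinite_finite_induct) (auto simp: eqv_add)

lemma eqv_prod: "(\<And>i. i \<in> S \<Longrightarrow> f i \<doteq> g i) \<Longrightarrow> prod f S \<doteq> prod g S"
  by (induction S rule: infinite_finite_induct) (auto simp: eqv_mult)

lemma dvd_mem: "x \<in> I \<Longrightarrow> x dvd y \<Longrightarrow> y \<in> I"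
  using mult_mem by (metis dvd_def mult.commute)

end

text \<open>Choosing a word for each block amounts to choosing one map on all variables, because the
  blocks partition them.\<close>

lemma sum_families:
  fixes P :: "('i::finite \<Rightarrow> 'v::finite) set" and F :: "('i \<Rightarrow> 'v) \<Rightarrow> ('i \<Rightarrow> 'v) \<Rightarrow> 'r::comm_semiring_1"
  assumes P: "bij_betw (\<lambda>(\<beta>, i). \<beta> i) (P \<times> UNIV) UNIV"
  shows "(\<Prod>\<beta>\<in>P. \<Sum>b\<in>UNIV. F \<beta> b) = (\<Sum>\<Theta>\<in>UNIV. \<Prod>\<beta>\<in>P. F \<beta> (\<Theta> \<circ> \<beta>))"
proof -
  let ?R = "\<lambda>\<Theta> :: 'v \<Rightarrow> 'v. \<lambda>\<beta>\<in>P. \<Theta> \<circ> \<beta>"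
  define e where "e = inv_into (P \<times> UNIV) (\<lambda>(\<beta>, i). \<beta> i)"
  have e: "e (\<beta> i) = (\<beta>, i)" if "\<beta> \<in> P" for \<beta> i
    using inv_into_f_f[OF bij_betw_imp_inj_on[OF P], of "(\<beta>, i)"] that by (simp add: e_def)
  have cov: "\<exists>\<beta>\<in>P. \<exists>i. a = \<beta> i" for a
  proof -
    have "a \<in> (\<lambda>(\<beta>, i). \<beta> i) ` (P \<times> UNIV)" using bij_betw_imp_surj_on[OF P] by simp
    then show ?thesis by auto
  qed
  have "bij_betw ?R UNIV (PiE P (\<lambda>_. UNIV))"
  proof (rule bij_betw_byWitness[of _ "\<lambda>\<Phi> a. \<Phi> (fst (e a)) (snd (e a))"])
    show "\<forall>\<Theta>\<in>UNIV. (\<lambda>a. ?R \<Theta> (fst (e a)) (snd (e a))) = \<Theta>"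
    proof (intro ballI ext)
      fix \<Theta> :: "'v \<Rightarrow> 'v" and a
      obtain \<beta> i where "\<beta> \<in> P" "a = \<beta> i" using cov by blast
      then show "?R \<Theta> (fst (e a)) (snd (e a)) = \<Theta> a" by (simp add: e)
    qed
    show "\<forall>\<Phi>\<in>PiE P (\<lambda>_. UNIV). ?R (\<lambda>a. \<Phi> (fst (e a)) (snd (e a))) = \<Phi>"
      by (auto simp: fun_eq_iff e PiE_def extensional_def)
  qed auto
  from sum.reindex_bij_betw[OF this, of "\<lambda>\<Phi>. \<Prod>\<beta>\<in>P. F \<beta> (\<Phi> \<beta>)"]
  have "(\<Sum>\<Theta>\<in>UNIV. \<Prod>\<beta>\<in>P. F \<beta> (\<Theta> \<circ> \<beta>)) = (\<Sum>\<Phi>\<in>PiE P (\<lambda>_. UNIV). \<Prod>\<beta>\<in>P. F \<beta> (\<Phi> \<beta>))"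
    by simp
  then show ?thesis using prod_sum_PiE[of P "\<lambda>_. UNIV" F] by simp
qed

text \<open>The linear system saying that the derivation given by \<open>C\<close> annihilates the indicator tensor of \<open>W\<close>.\<close>

definition (in cong_ideal) annihilates :: "('v \<Rightarrow> 'v \<Rightarrow> 'r) \<Rightarrow> ('i::finite \<Rightarrow> 'v::finite) set \<Rightarrow> bool"
  where "annihilates C W \<longleftrightarrow> (\<forall>b. (\<Sum>i\<in>UNIV. \<Sum>a\<in>UNIV. C (b i) a * of_bool (b(i := a) \<in> W)) \<in> I)"

text \<open>In the application \<open>s\<close> is \<open>g^-1 h\<close> and \<open>s'\<close> its
  inverse. The integers \<open>lam\<close> form a diagonal derivation that kills \<open>W\<close>
  and has pairwise distinct eigenvalues.\<close>

locale torus_stabilizer = cong_ideal I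
  for I :: "'r::comm_ring_1 set" +
  fixes W P :: "('i::finite \<Rightarrow> 'v::finite) set" and lam :: "'v \<Rightarrow> int" and s s' :: "'v \<Rightarrow> 'v \<Rightarrow> 'r"
  assumes lam_inj: "inj lam" and lam_sum: "b \<in> W \<Longrightarrow> (\<Sum>i\<in>UNIV. lam (b i)) = 0"
    and diagonal: "annihilates C W \<Longrightarrow> x \<noteq> y \<Longrightarrow> C x y \<in> I"
    and PW: "P \<subseteq> W" and partition: "bij_betw (\<lambda>(\<beta>, i). \<beta> i) (P \<times> UNIV) UNIV"
    and ss': "(\<Sum>c\<in>UNIV. s x c * s' c y) \<doteq> of_bool (x = y)"
    and s's: "(\<Sum>c\<in>UNIV. s' x c * s c y) \<doteq> of_bool (x = y)"
    and fixes_W: "(\<Sum>b'\<in>UNIV. (\<Prod>i\<in>UNIV. s (b i) (b' i)) * of_bool (b' \<in> W)) \<doteq> of_bool (b \<in> W)"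
begin

definition conj :: "'v \<Rightarrow> 'v \<Rightarrow> 'r"
  where "conj a b = (\<Sum>c\<in>UNIV. s a c * of_int (lam c) * s' c b)"

lemma conj_s: "(\<Sum>a\<in>UNIV. conj x a * s a y) \<doteq> s x y * of_int (lam y)"
proof -
  have "(\<Sum>a\<in>UNIV. conj x a * s a y) = (\<Sum>c\<in>UNIV. s x c * of_int (lam c) * (\<Sum>a\<in>UNIV. s' c a * s a y))"
    unfolding conj_def sum_distrib_left sum_distrib_right by (subst sum.swap) (simp add: mult.assoc)
  also have "\<dots> \<doteq> (\<Sum>c\<in>UNIV. s x c * of_int (lam c) * of_bool (c = y))"
    by (intro eqv_sum eqv_mult s's eqv_refl)
  also have "\<dots> = s x y * of_int (lam y)"
    by (simp add: of_bool_def if_distrib[of "\<lambda>x. _ * x"] cong: if_cong)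
  finally show ?thesis .
qed

text \<open>Write \<open>W\<close> as its image under \<open>s\<close> and move \<open>conj\<close>
  through one factor: \<open>conj\<close> after \<open>s\<close> is \<open>s\<close> after the
  diagonal derivation \<open>lam\<close>, which kills \<open>W\<close>.\<close>

lemma conj_annihilates: "annihilates conj W"
  unfolding annihilates_def
proof
  fix b :: "'i \<Rightarrow> 'v"
  let ?w = "\<lambda>b. of_bool (b \<in> W) :: 'r"
  let ?m = "\<lambda>b'. \<Prod>k\<in>UNIV. s (b k) (b' k)"
  have "(\<Sum>i\<in>UNIV. \<Sum>a\<in>UNIV. conj (b i) a * ?w (b(i := a))) \<doteq>
    (\<Sum>i\<in>UNIV. \<Sum>a\<in>UNIV. conj (b i) a * (\<Sum>b'\<in>UNIV. (\<Prod>k\<in>UNIV. s ((b(i := a)) k) (b' k)) * ?w b'))"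
    by (intro eqv_sum eqv_mult eqv_sym[OF fixes_W] eqv_refl)
  also have "\<dots> = (\<Sum>i\<in>UNIV. \<Sum>b'\<in>UNIV. (\<Sum>a\<in>UNIV. conj (b i) a * s a (b' i)) * ((\<Prod>k\<in>UNIV - {i}. s (b k) (b' k)) * ?w b'))"
  proof (rule sum.cong[OF refl])
    fix i
    have pr: "(\<Prod>k\<in>UNIV. s ((b(i := a)) k) (b' k)) = s a (b' i) * (\<Prod>k\<in>UNIV - {i}. s (b k) (b' k))" for a b'
      by (subst prod.remove[of _ i]) auto
    have "(\<Sum>a\<in>UNIV. conj (b i) a * (\<Sum>b'\<in>UNIV. (\<Prod>k\<in>UNIV. s ((b(i := a)) k) (b' k)) * ?w b')) =
      (\<Sum>a\<in>UNIV. \<Sum>b'\<in>UNIV. conj (b i) a * s a (b' i) * ((\<Prod>k\<in>UNIV - {i}. s (b k) (b' k)) * ?w b'))"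
      unfolding pr sum_distrib_left by (simp add: mult.assoc)
    then show "(\<Sum>a\<in>UNIV. conj (b i) a * (\<Sum>b'\<in>UNIV. (\<Prod>k\<in>UNIV. s ((b(i := a)) k) (b' k)) * ?w b')) =
      (\<Sum>b'\<in>UNIV. (\<Sum>a\<in>UNIV. conj (b i) a * s a (b' i)) * ((\<Prod>k\<in>UNIV - {i}. s (b k) (b' k)) * ?w b'))"
      unfolding sum_distrib_right by (subst (asm) sum.swap)
  qed
  also have "\<dots> \<doteq> (\<Sum>i\<in>UNIV. \<Sum>b'\<in>UNIV. (s (b i) (b' i) * of_int (lam (b' i))) * ((\<Prod>k\<in>UNIV - {i}. s (b k) (b' k)) * ?w b'))"
    by (intro eqv_sum eqv_mult conj_s eqv_refl)
  also have "\<dots> = (\<Sum>i\<in>UNIV. \<Sum>b'\<in>UNIV. of_int (lam (b' i)) * (?m b' * ?w b'))"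
  proof (intro sum.cong refl)
    fix i and b' :: "'i \<Rightarrow> 'v"
    have "?m b' = s (b i) (b' i) * (\<Prod>k\<in>UNIV - {i}. s (b k) (b' k))"
      by (subst prod.remove[of _ i]) auto
    then show "(s (b i) (b' i) * of_int (lam (b' i))) * ((\<Prod>k\<in>UNIV - {i}. s (b k) (b' k)) * ?w b') = of_int (lam (b' i)) * (?m b' * ?w b')"
      by (simp only: mult_ac)
  qed
  also have "\<dots> = (\<Sum>b'\<in>UNIV. of_int (\<Sum>i\<in>UNIV. lam (b' i)) * (?m b' * ?w b'))"
    by (subst sum.swap) (simp add: sum_distrib_right)
  also have "\<dots> = 0" using lam_sum by (intro sum.neutral) (auto simp del: of_int_sum)
  finally show "(\<Sum>i\<in>UNIV. \<Sum>a\<in>UNIV. conj (b i) a * of_bool (b(i := a) \<in> W)) \<in> I" unfolding eqv_0 .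
qed

text \<open>Since \<open>conj\<close> is diagonal, \<open>conj x x\<close> acts on
  \<open>s x y\<close> as \<open>lam y\<close>; on a product of two entries of the row it would act
  as both \<open>lam y\<close> and \<open>lam y'\<close>.\<close>

lemma row_orthogonal:
  assumes "y \<noteq> y'"
  shows "s x y * s x y' \<in> I"
proof -
  have d: "conj x x * s x y \<doteq> s x y * of_int (lam y)" for y
  proof -
    have "(\<Sum>a\<in>UNIV. conj x a * s a y) \<doteq> (\<Sum>a\<in>UNIV. if a = x then conj x x * s x y else 0)"
    proof (rule eqv_sum)
      fix a
      have "a \<noteq> x \<Longrightarrow> conj x a * s a y \<in> I"
        using diagonal[OF conj_annihilates, of x a] mult_mem[of "conj x a" "s a y"] by (simp add: mult.commute)
      then show "conj x a * s a y \<doteq> (if a = x then conj x x * s x y else 0)" by (auto simp: eqv_0)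
    qed
    then have "(\<Sum>a\<in>UNIV. conj x a * s a y) \<doteq> conj x x * s x y" by simp
    from eqv_trans[OF eqv_sym[OF this] conj_s] show ?thesis .
  qed
  have "s x y * of_int (lam y) * s x y' \<doteq> conj x x * s x y * s x y'"
    by (intro eqv_mult eqv_sym[OF d] eqv_refl)
  also have "conj x x * s x y * s x y' = conj x x * s x y' * s x y" by (simp add: mult_ac)
  also have "\<dots> \<doteq> s x y' * of_int (lam y') * s x y" by (intro eqv_mult d eqv_refl)
  finally have "of_int (lam y - lam y') * (s x y * s x y') \<in> I" by (simp add: eqv_def algebra_simps)
  moreover have "lam y - lam y' \<noteq> 0" using assms lam_inj by (auto simp: inj_def)
  ultimately show ?thesis using int_cancel by blast
qed

text \<open>Multiplying the relation \<open>ss'\<close> by \<open>s x b\<close> keeps one term, by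
  row orthogonality. Thus \<open>s a b\<close> is \<open>s a b * s a b * s' b a\<close>, while the
  same product ending in \<open>s' b a'\<close> vanishes.\<close>

lemma col_orthogonal:
  assumes "a \<noteq> a'"
  shows "s a b * s a' b \<in> I"
proof -
  have sq: "s x b * s x b * s' b z \<doteq> s x b * of_bool (x = z)" for x z
  proof -
    have 1: "s x b * (\<Sum>c\<in>UNIV. s x c * s' c z) \<doteq> s x b * of_bool (x = z)"
      by (intro eqv_mult eqv_refl ss')
    have "s x b * (\<Sum>c\<in>UNIV. s x c * s' c z) \<doteq> (\<Sum>c\<in>UNIV. if c = b then s x b * s x b * s' b z else 0)"
      unfolding sum_distrib_left
    proof (rule eqv_sum)
      fix c
      have "c \<noteq> b \<Longrightarrow> s x b * (s x c * s' c z) \<in> I"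
        using mult_mem[OF row_orthogonal[of b c x], of "s' c z"] by (simp add: mult_ac)
      then show "s x b * (s x c * s' c z) \<doteq> (if c = b then s x b * s x b * s' b z else 0)"
        by (auto simp: eqv_0 mult.assoc)
    qed
    from eqv_trans[OF eqv_sym[OF this] 1] show ?thesis by simp
  qed
  have "s a b * s a' b \<doteq> (s a b * s a b * s' b a) * (s a' b * s a' b * s' b a')"
    using eqv_mult[OF sq[of a a] sq[of a' a']] by (simp add: eqv_sym)
  also have "\<dots> = (s a b * s a b * s' b a') * (s' b a * s a' b * s a' b)" by (simp add: mult_ac)
  also have "\<dots> \<doteq> 0 * (s' b a * s a' b * s a' b)"
    using sq[of a a'] assms by (intro eqv_mult eqv_refl) simp
  finally show ?thesis by (simp add: eqv_0)
qed

definition entry_prod :: "('v \<Rightarrow> 'v) \<Rightarrow> 'r" where "entry_prod \<Theta> = (\<Prod>a\<in>UNIV. s a (\<Theta> a))"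

lemma prod_orthogonal:
  fixes p :: "'k::finite \<Rightarrow> 'v"
  assumes "q \<noteq> q'"
  shows "(\<Prod>k\<in>UNIV. s (p k) (q k)) * (\<Prod>k\<in>UNIV. s (p k) (q' k)) \<in> I"
proof -
  obtain k where "q k \<noteq> q' k" using assms by auto
  then have "s (p k) (q k) * s (p k) (q' k) \<in> I" by (rule row_orthogonal)
  moreover have "s (p k) (q k) * s (p k) (q' k) dvd (\<Prod>k\<in>UNIV. s (p k) (q k)) * (\<Prod>k\<in>UNIV. s (p k) (q' k))"
    by (intro mult_dvd_mono dvd_prodI) auto
  ultimately show ?thesis by (rule dvd_mem)
qed

text \<open>Distinct maps differ in some row, where the product of the two entries lies in
  \<open>I\<close>; so the cross terms vanish.\<close>

lemma square_sum: "(\<Sum>\<Theta>\<in>S. k \<Theta> * entry_prod \<Theta>) ^ 2 \<doteq> (\<Sum>\<Theta>\<in>S. k \<Theta> ^ 2 * entry_prod \<Theta> ^ 2)"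
proof -
  have "(\<Sum>\<Theta>\<in>S. k \<Theta> * entry_prod \<Theta>) ^ 2 = (\<Sum>\<Theta>\<in>S. \<Sum>\<Theta>'\<in>S. (k \<Theta> * entry_prod \<Theta>) * (k \<Theta>' * entry_prod \<Theta>'))"
    by (simp add: power2_eq_square sum_product)
  also have "\<dots> \<doteq> (\<Sum>\<Theta>\<in>S. \<Sum>\<Theta>'\<in>S. if \<Theta>' = \<Theta> then k \<Theta> ^ 2 * entry_prod \<Theta> ^ 2 else 0)"
  proof (intro eqv_sum)
    fix \<Theta> \<Theta>'
    have "\<Theta>' \<noteq> \<Theta> \<Longrightarrow> (k \<Theta> * entry_prod \<Theta>) * (k \<Theta>' * entry_prod \<Theta>') \<in> I"
      using mult_mem[OF prod_orthogonal[of \<Theta> \<Theta>' "\<lambda>a. a"], of "k \<Theta> * k \<Theta>'"] by (simp add: entry_prod_def mult_ac)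
    then show "(k \<Theta> * entry_prod \<Theta>) * (k \<Theta>' * entry_prod \<Theta>') \<doteq> (if \<Theta>' = \<Theta> then k \<Theta> ^ 2 * entry_prod \<Theta> ^ 2 else 0)"
      by (auto simp: eqv_0 power2_eq_square mult_ac)
  qed
  also have "\<dots> = (\<Sum>\<Theta>\<in>S. k \<Theta> ^ 2 * entry_prod \<Theta> ^ 2)" by simp
  finally show ?thesis .
qed

text \<open>The sum in \<open>fixes_W\<close> at \<open>\<beta>\<close> is 1. Multiplied by the
  entries that \<open>\<Theta>\<close> chooses on the block it keeps only the word
  \<open>\<Theta> \<circ> \<beta>\<close>, whose coefficient is 0 outside \<open>W\<close>.\<close>

lemma block_mem:
  assumes \<beta>: "\<beta> \<in> P" and W: "\<Theta> \<circ> \<beta> \<notin> W"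
  shows "entry_prod \<Theta> \<in> I"
proof -
  let ?m = "\<Prod>i\<in>UNIV. s (\<beta> i) (\<Theta> (\<beta> i))"
  have "?m * 1 \<doteq> ?m * (\<Sum>b'\<in>UNIV. (\<Prod>i\<in>UNIV. s (\<beta> i) (b' i)) * of_bool (b' \<in> W))"
    using eqv_mult[OF eqv_refl eqv_sym[OF fixes_W[of \<beta>]], of ?m] \<beta> PW by (simp add: subset_iff)
  also have "\<dots> \<doteq> 0"
    unfolding sum_distrib_left
  proof -
    have "(\<Sum>b'\<in>UNIV. ?m * ((\<Prod>i\<in>UNIV. s (\<beta> i) (b' i)) * of_bool (b' \<in> W))) \<doteq> (\<Sum>b'\<in>(UNIV :: ('i \<Rightarrow> 'v) set). 0)"
    proof (rule eqv_sum)
      fix b' :: "'i \<Rightarrow> 'v"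
      show "?m * ((\<Prod>i\<in>UNIV. s (\<beta> i) (b' i)) * of_bool (b' \<in> W)) \<doteq> 0"
      proof (cases "b' = \<Theta> \<circ> \<beta>")
        case False
        then have "?m * (\<Prod>i\<in>UNIV. s (\<beta> i) (b' i)) \<in> I"
          using prod_orthogonal[of "\<Theta> \<circ> \<beta>" b' \<beta>] by auto
        from mult_mem[OF this, of "of_bool (b' \<in> W)"] show ?thesis by (simp add: eqv_0 mult_ac)
      qed (use W in simp)
    qed
    then show "(\<Sum>b'\<in>UNIV. ?m * ((\<Prod>i\<in>UNIV. s (\<beta> i) (b' i)) * of_bool (b' \<in> W))) \<doteq> 0" by simp
  qed
  finally have "?m \<in> I" by (simp add: eqv_0)
  moreover have "?m dvd entry_prod \<Theta>"
  proof -
    have "inj \<beta>" using partition \<beta> by (auto simp: bij_betw_def inj_on_def)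
    then have "?m = (\<Prod>a\<in>range \<beta>. s a (\<Theta> a))" by (simp add: prod.reindex)
    then show ?thesis unfolding entry_prod_def by (simp add: prod_dvd_prod_subset)
  qed
  ultimately show ?thesis by (rule dvd_mem)
qed

text \<open>Without cross terms the signs are squared away, so the determinant has the same square
  as the sum of \<open>?k \<Theta> * entry_prod \<Theta>\<close>. That sum factors over the blocks,
  and each factor is 1 by \<open>fixes_W\<close>.\<close>

theorem det_square_eqv: "det (\<chi> a b. s a b) ^ 2 \<doteq> 1"
proof -
  let ?P = "{\<tau>. \<tau> permutes (UNIV :: 'v set)}"
  let ?k = "\<lambda>\<Theta>. \<Prod>\<beta>\<in>P. of_bool (\<Theta> \<circ> \<beta> \<in> W) :: 'r"
  have k2: "?k \<Theta> ^ 2 = ?k \<Theta>" for \<Theta> :: "'v \<Rightarrow> 'v"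
    unfolding prod_power_distrib by (intro prod.cong) (auto simp: of_bool_def)
  have "det (\<chi> a b. s a b) ^ 2 = (\<Sum>\<tau>\<in>?P. of_int (sign \<tau>) * entry_prod \<tau>) ^ 2"
    by (simp add: det_def entry_prod_def)
  also have "\<dots> \<doteq> (\<Sum>\<tau>\<in>?P. of_int (sign \<tau>) ^ 2 * entry_prod \<tau> ^ 2)" by (rule square_sum)
  also have "\<dots> = (\<Sum>\<Theta>\<in>UNIV. if \<Theta> permutes UNIV then entry_prod \<Theta> ^ 2 else 0)"
  proof -
    have "(of_int (sign \<tau>) :: 'r) ^ 2 = 1" for \<tau> :: "'v \<Rightarrow> 'v" by (simp add: sign_def)
    then show ?thesis by (simp add: sum.If_cases)
  qed
  \<comment> \<open>The two sums differ only in negligible maps: those that are not injective vanish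
    by column orthogonality, permutations taking a block out of \<open>W\<close> by
    \<open>block_mem\<close>.\<close>
  also have "\<dots> \<doteq> (\<Sum>\<Theta>\<in>UNIV. ?k \<Theta> ^ 2 * entry_prod \<Theta> ^ 2)"
  proof (rule eqv_sum)
    fix \<Theta> :: "'v \<Rightarrow> 'v"
    have sq: "entry_prod \<Theta> \<in> I \<Longrightarrow> entry_prod \<Theta> ^ 2 \<in> I" "entry_prod \<Theta> \<in> I \<Longrightarrow> ?k \<Theta> ^ 2 * entry_prod \<Theta> ^ 2 \<in> I"
      by (auto simp: power2_eq_square intro: mult_mem)
    show "(if \<Theta> permutes UNIV then entry_prod \<Theta> ^ 2 else 0) \<doteq> ?k \<Theta> ^ 2 * entry_prod \<Theta> ^ 2"
    proof (cases "(\<forall>\<beta>\<in>P. \<Theta> \<circ> \<beta> \<in> W) \<and> \<Theta> permutes UNIV")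
      case True
      then show ?thesis by (simp add: of_bool_def)
    next
      case False
      have "entry_prod \<Theta> \<in> I"
      proof (cases "\<Theta> permutes UNIV")
        case True
        then show ?thesis using False block_mem by blast
      next
        case False
        then have "\<not> inj \<Theta>"
          by (metis UNIV_I bij_betw_def bij_imp_permutes finite finite_UNIV_inj_surj)
        then obtain a a' where a: "a \<noteq> a'" "\<Theta> a = \<Theta> a'" by (auto simp: inj_def)
        then have "s a (\<Theta> a) * s a' (\<Theta> a') \<in> I" using col_orthogonal by simp
        moreover have "s a (\<Theta> a) * s a' (\<Theta> a') dvd entry_prod \<Theta>"
        proof -
          have "(\<Prod>x\<in>{a, a'}. s x (\<Theta> x)) dvd entry_prod \<Theta>" unfolding entry_prod_def by (rule prod_dvd_prod_subset) auto
          then show ?thesis using a(1) by simp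
        qed
        ultimately show ?thesis by (rule dvd_mem)
      qed
      then have "entry_prod \<Theta> ^ 2 \<doteq> 0" "?k \<Theta> ^ 2 * entry_prod \<Theta> ^ 2 \<doteq> 0" using sq by (auto simp: eqv_0)
      from eqv_trans[OF this(1) eqv_sym[OF this(2)]] eqv_sym[OF this(2)] show ?thesis by simp
    qed
  qed
  also have "\<dots> \<doteq> (\<Sum>\<Theta>\<in>UNIV. ?k \<Theta> * entry_prod \<Theta>) ^ 2" by (rule eqv_sym[OF square_sum])
  also have "(\<Sum>\<Theta>\<in>UNIV. ?k \<Theta> * entry_prod \<Theta>) = (\<Prod>\<beta>\<in>P. \<Sum>b'\<in>UNIV. (\<Prod>i\<in>UNIV. s (\<beta> i) (b' i)) * of_bool (b' \<in> W))"
  proof -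
    have "entry_prod \<Theta> = (\<Prod>\<beta>\<in>P. \<Prod>i\<in>UNIV. s (\<beta> i) (\<Theta> (\<beta> i)))" for \<Theta>
      unfolding entry_prod_def using prod.reindex_bij_betw[OF partition, of "\<lambda>a. s a (\<Theta> a)"]
      by (simp add: prod.cartesian_product case_prod_beta)
    then show ?thesis unfolding sum_families[OF partition] by (simp add: prod.distrib mult.commute)
  qed
  also have "(\<Prod>\<beta>\<in>P. \<Sum>b'\<in>UNIV. (\<Prod>i\<in>UNIV. s (\<beta> i) (b' i)) * of_bool (b' \<in> W)) ^ 2 \<doteq> (\<Prod>\<beta>\<in>P. 1) ^ 2"
  proof -
    have "(\<Prod>\<beta>\<in>P. \<Sum>b'\<in>UNIV. (\<Prod>i\<in>UNIV. s (\<beta> i) (b' i)) * of_bool (b' \<in> W)) \<doteq> (\<Prod>\<beta>\<in>P. 1)"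
    proof (rule eqv_prod)
      fix \<beta> assume "\<beta> \<in> P"
      then have "\<beta> \<in> W" using PW by auto
      then show "(\<Sum>b'\<in>UNIV. (\<Prod>i\<in>UNIV. s (\<beta> i) (b' i)) * of_bool (b' \<in> W)) \<doteq> 1"
        using fixes_W[of \<beta>] by simp
    qed
    then show ?thesis unfolding power2_eq_square by (intro eqv_mult)
  qed
  finally show ?thesis by simp
qed

end

section \<open>Separable functions of two matrices\<close>

definition separable_rep :: "('a \<Rightarrow> 'b \<Rightarrow> complex) \<Rightarrow> (('a \<Rightarrow> complex) \<times> ('b \<Rightarrow> complex)) list \<Rightarrow> bool"
  where "separable_rep F xs \<longleftrightarrow> (\<forall>a b. F a b = (\<Sum>(\<alpha>, \<beta>)\<leftarrow>xs. \<alpha> a * \<beta> b))"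

lemma separable_rep_add:
  "separable_rep F xs \<Longrightarrow> separable_rep G ys \<Longrightarrow> separable_rep (\<lambda>a b. F a b + G a b) (xs @ ys)"
  by (simp add: separable_rep_def)

lemma separable_rep_mult:
  assumes "separable_rep F xs" "separable_rep G ys"
  shows "separable_rep (\<lambda>a b. F a b * G a b)
    (concat (map (\<lambda>(\<alpha>, \<beta>). map (\<lambda>(\<alpha>', \<beta>'). (\<lambda>a. \<alpha> a * \<alpha>' a, \<lambda>b. \<beta> b * \<beta>' b)) ys) xs))"
proof -
  have 1: "\<alpha> a * \<beta> b * (\<Sum>(\<alpha>, \<beta>)\<leftarrow>ys. \<alpha> a * \<beta> b) =
    (\<Sum>(\<alpha>, \<beta>)\<leftarrow>map (\<lambda>(\<alpha>', \<beta>'). (\<lambda>a. \<alpha> a * \<alpha>' a, \<lambda>b. \<beta> b * \<beta>' b)) ys. \<alpha> a * \<beta> b)" for \<alpha> \<beta> a b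
    by (induction ys) (auto simp: algebra_simps)
  have "(\<Sum>(\<alpha>, \<beta>)\<leftarrow>xs. \<alpha> a * \<beta> b) * (\<Sum>(\<alpha>, \<beta>)\<leftarrow>ys. \<alpha> a * \<beta> b) = (\<Sum>(\<alpha>, \<beta>)\<leftarrow>concat (map (\<lambda>(\<alpha>, \<beta>).
    map (\<lambda>(\<alpha>', \<beta>'). (\<lambda>a. \<alpha> a * \<alpha>' a, \<lambda>b. \<beta> b * \<beta>' b)) ys) xs). \<alpha> a * \<beta> b)" for a b
    by (induction xs) (auto simp: distrib_right 1)
  then show ?thesis using assms by (simp add: separable_rep_def)
qed

lemma separable_rep_left: "separable_rep (\<lambda>a b. \<alpha> a) [(\<alpha>, \<lambda>_. 1)]"
  and separable_rep_right: "separable_rep (\<lambda>a b. \<beta> b) [(\<lambda>_. 1, \<beta>)]"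
  by (simp_all add: separable_rep_def)

text \<open>The tensor product over the complex numbers of two algebras of functions, made a type so
  that determinants and \<open>torus_stabilizer\<close> apply to matrices over it.\<close>

typedef ('a, 'b) sep_fun = "{F :: 'a \<Rightarrow> 'b \<Rightarrow> complex. \<exists>xs. separable_rep F xs}"
  using separable_rep_left by blast

setup_lifting type_definition_sep_fun

instantiation sep_fun :: (type, type) comm_ring_1
begin

lift_definition zero_sep_fun :: "('a, 'b) sep_fun" is "\<lambda>_ _. 0"
  using separable_rep_left[of "\<lambda>_. 0"] by (rule exI)

lift_definition one_sep_fun :: "('a, 'b) sep_fun" is "\<lambda>_ _. 1"
  using separable_rep_left[of "\<lambda>_. 1"] by (rule exI)

lift_definition plus_sep_fun :: "('a, 'b) sep_fun \<Rightarrow> ('a, 'b) sep_fun \<Rightarrow> ('a, 'b) sep_fun"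
  is "\<lambda>F G a b. F a b + G a b"
  using separable_rep_add by blast

lift_definition times_sep_fun :: "('a, 'b) sep_fun \<Rightarrow> ('a, 'b) sep_fun \<Rightarrow> ('a, 'b) sep_fun"
  is "\<lambda>F G a b. F a b * G a b"
  using separable_rep_mult by blast

lift_definition uminus_sep_fun :: "('a, 'b) sep_fun \<Rightarrow> ('a, 'b) sep_fun" is "\<lambda>F a b. - F a b"
proof -
  fix F :: "'a \<Rightarrow> 'b \<Rightarrow> complex" assume "\<exists>xs. separable_rep F xs"
  then obtain xs where "separable_rep F xs" ..
  from separable_rep_mult[OF separable_rep_left[of "\<lambda>_. - 1"] this]
  show "\<exists>xs. separable_rep (\<lambda>a b. - F a b) xs" unfolding mult_minus1 by (rule exI)
qed

definition minus_sep_fun :: "('a, 'b) sep_fun \<Rightarrow> ('a, 'b) sep_fun \<Rightarrow> ('a, 'b) sep_fun"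
  where "minus_sep_fun F G = F + - G"

instance
proof
  fix a b c :: "('a, 'b) sep_fun"
  show "a * b * c = a * (b * c)" "a * b = b * a" "1 * a = a" "a + b + c = a + (b + c)" "a + b = b + a"
    "0 + a = a" "- a + a = 0" "(a + b) * c = a * c + b * c"
    by (simp_all add: Rep_sep_fun_inject[symmetric] fun_eq_iff zero_sep_fun.rep_eq one_sep_fun.rep_eq
        plus_sep_fun.rep_eq times_sep_fun.rep_eq uminus_sep_fun.rep_eq distrib_right)
  show "a - b = a + - b" by (rule minus_sep_fun_def)
  show "0 \<noteq> (1 :: ('a, 'b) sep_fun)"
    by (simp add: Rep_sep_fun_inject[symmetric] fun_eq_iff zero_sep_fun.rep_eq one_sep_fun.rep_eq)
qed

end

lift_definition sep_left :: "('a \<Rightarrow> complex) \<Rightarrow> ('a, 'b) sep_fun" is "\<lambda>\<alpha> a b. \<alpha> a"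
  using separable_rep_left by blast

lift_definition sep_right :: "('b \<Rightarrow> complex) \<Rightarrow> ('a, 'b) sep_fun" is "\<lambda>\<beta> a b. \<beta> b"
  using separable_rep_right by blast

abbreviation app :: "('a, 'b) sep_fun \<Rightarrow> 'a \<Rightarrow> 'b \<Rightarrow> complex" where "app \<equiv> Rep_sep_fun"

lemma app_minus: "app (x - y) a b = app x a b - app y a b"
  unfolding minus_sep_fun_def plus_sep_fun.rep_eq uminus_sep_fun.rep_eq by simp

lemma app_sum: "app (sum f S) a b = (\<Sum>x\<in>S. app (f x) a b)"
  by (induction S rule: infinite_finite_induct) (simp_all add: zero_sep_fun.rep_eq plus_sep_fun.rep_eq)

lemma app_prod: "app (prod f S) a b = (\<Prod>x\<in>S. app (f x) a b)"
  by (induction S rule: infinite_finite_induct) (simp_all add: one_sep_fun.rep_eq times_sep_fun.rep_eq)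

lemma app_of_nat: "app (of_nat n) a b = of_nat n"
  by (induction n) (simp_all add: zero_sep_fun.rep_eq one_sep_fun.rep_eq plus_sep_fun.rep_eq)

lemma app_of_int: "app (of_int n) a b = of_int n"
  by (cases n rule: int_diff_cases) (simp add: app_minus app_of_nat)

lemma app_of_bool: "app (of_bool p) a b = of_bool p"
  by (simp add: of_bool_def zero_sep_fun.rep_eq one_sep_fun.rep_eq)

lemma app_det: "app (det M) a b = det (\<chi> i j. app (M $ i $ j) a b)"
  by (simp add: det_def app_sum app_prod times_sep_fun.rep_eq app_of_int)

lemmas app_simps = zero_sep_fun.rep_eq one_sep_fun.rep_eq plus_sep_fun.rep_eq times_sep_fun.rep_eq
  app_minus app_sum app_prod app_of_int app_of_bool app_det sep_left.rep_eq sep_right.rep_eq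

section \<open>Rationality of the squared determinant\<close>

context monomial_sum
begin

text \<open>The kernel of \<open>L \<otimes>\<^sub>\<complex> L \<rightarrow> L \<otimes>\<^sub>A L\<close>, where \<open>L\<close> consists of the functions of an invertible matrix
  and \<open>A\<close> of those that are regular on the orbit.\<close>

definition orbit_ideal :: "(complex ^ 'v ^ 'v, complex ^ 'v ^ 'v) sep_fun set"
  where "orbit_ideal = {x. \<exists>xs. (\<forall>(\<alpha>, \<beta>, f)\<in>set xs. f \<in> polynomial_maps) \<and>
    (\<forall>g h. invertible g \<longrightarrow> invertible h \<longrightarrow>
      app x g h = (\<Sum>(\<alpha>, \<beta>, f)\<leftarrow>xs. \<alpha> g * \<beta> h * (f (gl_act g form) - f (gl_act h form))))}"

lemma orbit_ideal_null: "(\<And>g h. invertible g \<Longrightarrow> invertible h \<Longrightarrow> app x g h = 0) \<Longrightarrow> x \<in> orbit_ideal"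
  unfolding orbit_ideal_def by (auto intro!: exI[of _ "[]"])

lemma orbit_ideal_gen:
  assumes "f \<in> polynomial_maps"
    "\<And>g h. invertible g \<Longrightarrow> invertible h \<Longrightarrow> app x g h = \<alpha> g * \<beta> h * (f (gl_act g form) - f (gl_act h form))"
  shows "x \<in> orbit_ideal"
  unfolding orbit_ideal_def using assms by (auto intro!: exI[of _ "[(\<alpha>, \<beta>, f)]"])

lemma orbit_ideal_add:
  assumes "x \<in> orbit_ideal" "y \<in> orbit_ideal"
  shows "x + y \<in> orbit_ideal"
proof -
  obtain xs ys where "\<forall>(\<alpha>, \<beta>, f)\<in>set xs. f \<in> polynomial_maps" "\<forall>(\<alpha>, \<beta>, f)\<in>set ys. f \<in> polynomial_maps"
    "\<And>g h. invertible g \<Longrightarrow> invertible h \<Longrightarrow>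
      app x g h = (\<Sum>(\<alpha>, \<beta>, f)\<leftarrow>xs. \<alpha> g * \<beta> h * (f (gl_act g form) - f (gl_act h form)))"
    "\<And>g h. invertible g \<Longrightarrow> invertible h \<Longrightarrow>
      app y g h = (\<Sum>(\<alpha>, \<beta>, f)\<leftarrow>ys. \<alpha> g * \<beta> h * (f (gl_act g form) - f (gl_act h form)))"
    using assms unfolding orbit_ideal_def by blast
  then show ?thesis unfolding orbit_ideal_def
    by (intro CollectI exI[of _ "xs @ ys"]) (auto simp: app_simps)
qed

lemma orbit_ideal_mult:
  assumes "x \<in> orbit_ideal"
  shows "a * x \<in> orbit_ideal"
proof -
  obtain xs where xs: "\<forall>(\<alpha>, \<beta>, f)\<in>set xs. f \<in> polynomial_maps"
    "\<And>g h. invertible g \<Longrightarrow> invertible h \<Longrightarrow>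
      app x g h = (\<Sum>(\<alpha>, \<beta>, f)\<leftarrow>xs. \<alpha> g * \<beta> h * (f (gl_act g form) - f (gl_act h form)))"
    using assms unfolding orbit_ideal_def by blast
  obtain ys where "separable_rep (app a) ys" using Rep_sep_fun[of a] by blast
  then have ys: "app a g h = (\<Sum>(\<alpha>, \<beta>)\<leftarrow>ys. \<alpha> g * \<beta> h)" for g h by (simp add: separable_rep_def)
  let ?m = "\<lambda>(\<alpha>, \<beta>). map (\<lambda>(\<alpha>', \<beta>', f). (\<lambda>g. \<alpha> g * \<alpha>' g, \<lambda>h. \<beta> h * \<beta>' h, f)) xs"
  let ?S = "\<lambda>xs g h. \<Sum>(\<alpha>, \<beta>, f)\<leftarrow>xs. \<alpha> g * \<beta> h * (f (gl_act g form) - f (gl_act h form))"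
  have 1: "\<alpha> g * \<beta> h * ?S xs g h = ?S (?m (\<alpha>, \<beta>)) g h" for \<alpha> \<beta> g h
    by (induction xs) (auto simp: algebra_simps)
  have 2: "(\<Sum>(\<alpha>, \<beta>)\<leftarrow>ys. \<alpha> g * \<beta> h) * ?S xs g h = ?S (concat (map ?m ys)) g h" for g h
    by (induction ys) (auto simp: distrib_right 1)
  have "\<forall>(\<alpha>, \<beta>, f)\<in>set (concat (map ?m ys)). f \<in> polynomial_maps" using xs(1) by fastforce
  moreover have "app (a * x) g h = ?S (concat (map ?m ys)) g h" if "invertible g" "invertible h" for g h
    by (simp only: times_sep_fun.rep_eq ys xs(2)[OF that] 2)
  ultimately show ?thesis unfolding orbit_ideal_def by blast
qed

lemma cong_ideal_orbit_ideal: "cong_ideal orbit_ideal"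
proof
  show "0 \<in> orbit_ideal" by (rule orbit_ideal_null) (simp add: app_simps)
  fix n :: int and x assume n: "n \<noteq> 0" "of_int n * x \<in> orbit_ideal"
  from orbit_ideal_mult[OF n(2), of "sep_left (\<lambda>_. 1 / of_int n)"]
  show "x \<in> orbit_ideal"
  proof -
    have "sep_left (\<lambda>_. 1 / of_int n) * (of_int n * x) = x"
    proof -
      have "app (sep_left (\<lambda>_. 1 / of_int n) * (of_int n * x)) g h = app x g h" for g h
        using n(1) by (simp add: app_simps)
      then show ?thesis by (simp add: Rep_sep_fun_inject[symmetric] fun_eq_iff)
    qed
    then show ?thesis using \<open>sep_left (\<lambda>_. 1 / of_int n) * (of_int n * x) \<in> orbit_ideal\<close> by simp
  qed
qed (auto intro: orbit_ideal_add orbit_ideal_mult)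

text \<open>A linear functional on the span of \<open>1\<close> and the \<open>u\<^sub>j\<close> over the fraction field of the regular
  functions, with denominators cleared, that takes the value \<open>E\<close> at \<open>1\<close>.\<close>

definition functional ::
    "(nat \<Rightarrow> complex ^ 'v ^ 'v \<Rightarrow> complex) \<Rightarrow> nat \<Rightarrow> ('v cpoly \<Rightarrow> complex) \<Rightarrow> (nat \<Rightarrow> 'v cpoly \<Rightarrow> complex) \<Rightarrow> bool"
  where "functional u n E \<mu> \<longleftrightarrow> (\<forall>r0 r. r0 \<in> polynomial_maps \<longrightarrow> (\<forall>j. r j \<in> polynomial_maps) \<longrightarrow>
    (\<forall>h. invertible h \<longrightarrow> r0 (gl_act h form) + (\<Sum>j<n. r j (gl_act h form) * u j h) = 0) \<longrightarrow>
    (\<forall>h. invertible h \<longrightarrow> r0 (gl_act h form) * E (gl_act h form) + (\<Sum>j<n. r j (gl_act h form) * \<mu> j (gl_act h form)) = 0))"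

lemma functionalI:
  assumes "\<And>r0 r h. r0 \<in> polynomial_maps \<Longrightarrow> (\<And>j. r j \<in> polynomial_maps) \<Longrightarrow>
      (\<And>h. invertible h \<Longrightarrow> r0 (gl_act h form) + (\<Sum>j<n. r j (gl_act h form) * u j h) = 0) \<Longrightarrow>
      invertible h \<Longrightarrow> r0 (gl_act h form) * E (gl_act h form) + (\<Sum>j<n. r j (gl_act h form) * \<mu> j (gl_act h form)) = 0"
  shows "functional u n E \<mu>"
  unfolding functional_def by (intro allI impI, rule assms) simp_all

lemma functionalD:
  assumes "functional u n E \<mu>" "r0 \<in> polynomial_maps" "\<And>j. r j \<in> polynomial_maps"
    "\<And>h. invertible h \<Longrightarrow> r0 (gl_act h form) + (\<Sum>j<n. r j (gl_act h form) * u j h) = 0" "invertible h"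
  shows "r0 (gl_act h form) * E (gl_act h form) + (\<Sum>j<n. r j (gl_act h form) * \<mu> j (gl_act h form)) = 0"
  using assms(1)[unfolded functional_def, rule_format, of r0 r h, OF assms(2-5)] .

text \<open>Induction on the number of \<open>u j\<close>. A new one either depends on 1 and the
  earlier ones, and then its value is forced, or is independent of them and may be sent to
  0.\<close>

lemma descent_functional:
  "\<exists>E \<mu>. E \<in> polynomial_maps \<and> (\<exists>p\<in>gl_orbit form. E p \<noteq> 0) \<and> (\<forall>j. \<mu> j \<in> polynomial_maps) \<and> functional u n E \<mu>"
proof (induction n)
  case 0
  have "gl_act (mat 1) form \<in> gl_orbit form" unfolding gl_orbit_def using invertible_det_nz by force
  moreover have "functional u 0 (\<lambda>_. 1) (\<lambda>_ _. 0)" by (rule functionalI) simp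
  ultimately show ?case
    by (intro exI[of _ "\<lambda>_. 1"] exI[of _ "\<lambda>_ _. 0"]) (auto intro: polynomial_maps.const)
next
  case (Suc n)
  then obtain E \<mu> where E: "E \<in> polynomial_maps" "\<exists>p\<in>gl_orbit form. E p \<noteq> 0" and \<mu>: "\<And>j. \<mu> j \<in> polynomial_maps"
    and rel: "functional u n E \<mu>"
    by blast
  show ?case
  proof (cases "\<exists>q0 q. q0 \<in> polynomial_maps \<and> (\<forall>j. q j \<in> polynomial_maps) \<and> (\<exists>p\<in>gl_orbit form. q n p \<noteq> 0) \<and>
      (\<forall>h. invertible h \<longrightarrow> q0 (gl_act h form) + (\<Sum>j<Suc n. q j (gl_act h form) * u j h) = 0)")
    case True
    then obtain q0 q where q: "q0 \<in> polynomial_maps" "\<And>j. q j \<in> polynomial_maps" "\<exists>p\<in>gl_orbit form. q n p \<noteq> 0"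
      "\<And>h. invertible h \<Longrightarrow> q0 (gl_act h form) + (\<Sum>j<Suc n. q j (gl_act h form) * u j h) = 0" by blast
    \<comment> \<open>The relation \<open>q\<close> prescribes the value at \<open>u n\<close>;
      multiplying all other values by \<open>q n\<close> avoids the division.\<close>
    define E' where "E' p = q n p * E p" for p
    define \<mu>' where "\<mu>' j = (if j = n then (\<lambda>p. (-1) * (q0 p * E p + (\<Sum>j<n. q j p * \<mu> j p))) else (\<lambda>p. q n p * \<mu> j p))" for j
    have "E' \<in> polynomial_maps" unfolding E'_def by (intro polynomial_maps.mult q E)
    moreover have "\<exists>p\<in>gl_orbit form. E' p \<noteq> 0"
      using gl_orbit_irreducible[OF q(2)[of n] E(1), of form] q(3) E(2) unfolding E'_def by blast
    moreover have "\<mu>' j \<in> polynomial_maps" for j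
    proof (cases "j = n")
      case True
      have "(\<lambda>p. (-1) * (q0 p * E p + (\<Sum>j<n. q j p * \<mu> j p))) \<in> polynomial_maps"
        by (intro polynomial_maps.mult[OF polynomial_maps.const] polynomial_maps.mult polynomial_maps.add polynomial_maps_sum q E \<mu>)
      then show ?thesis using True by (simp add: \<mu>'_def)
    qed (auto simp: \<mu>'_def intro: polynomial_maps.mult q \<mu>)
    moreover have "functional u (Suc n) E' \<mu>'"
    proof (rule functionalI)
      fix r0 r and h :: "complex ^ 'v ^ 'v" assume r: "r0 \<in> polynomial_maps" "\<And>j. r j \<in> polynomial_maps"
        "\<And>h. invertible h \<Longrightarrow> r0 (gl_act h form) + (\<Sum>j<Suc n. r j (gl_act h form) * u j h) = 0" and h: "invertible h"
      \<comment> \<open>Eliminating \<open>u n\<close> between the relations \<open>r\<close> and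
        \<open>q\<close> leaves a relation covered by the induction hypothesis.\<close>
      let ?d = "\<lambda>p. q n p * r0 p - r n p * q0 p" and ?t = "\<lambda>j p. q n p * r j p - r n p * q j p"
      have "?d (gl_act h form) + (\<Sum>j<n. ?t j (gl_act h form) * u j h) = 0" if h: "invertible h" for h
      proof -
        have "q n (gl_act h form) * (r0 (gl_act h form) + (\<Sum>j<Suc n. r j (gl_act h form) * u j h))
          - r n (gl_act h form) * (q0 (gl_act h form) + (\<Sum>j<Suc n. q j (gl_act h form) * u j h)) = 0"
          using r(3)[OF h] q(4)[OF h] by simp
        then show ?thesis
          by (simp add: algebra_simps sum_distrib_left sum_subtractf)
      qed
      then have "?d (gl_act h form) * E (gl_act h form) + (\<Sum>j<n. ?t j (gl_act h form) * \<mu> j (gl_act h form)) = 0"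
        by (intro functionalD[OF rel]) (auto intro!: polynomial_maps_diff polynomial_maps.mult q r h)
      then show "r0 (gl_act h form) * E' (gl_act h form) + (\<Sum>j<Suc n. r j (gl_act h form) * \<mu>' j (gl_act h form)) = 0"
        by (simp add: E'_def \<mu>'_def algebra_simps sum_distrib_left sum_subtractf sum_negf)
    qed
    ultimately show ?thesis by blast
  next
    case False
    have "functional u (Suc n) E (\<mu>(n := \<lambda>_. 0))"
    proof (rule functionalI)
      fix r0 r and h :: "complex ^ 'v ^ 'v" assume r: "r0 \<in> polynomial_maps" "\<And>j. r j \<in> polynomial_maps"
        "\<And>h. invertible h \<Longrightarrow> r0 (gl_act h form) + (\<Sum>j<Suc n. r j (gl_act h form) * u j h) = 0" and h: "invertible h"
      have "r n (gl_act h form) = 0" if "invertible h" for h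
        using False r that unfolding gl_orbit_def by blast
      then have "r0 (gl_act h form) + (\<Sum>j<n. r j (gl_act h form) * u j h) = 0" if "invertible h" for h
        using r(3)[OF that] that by simp
      from functionalD[OF rel r(1,2) this h]
      show "r0 (gl_act h form) * E (gl_act h form) + (\<Sum>j<Suc n. r j (gl_act h form) * (\<mu>(n := \<lambda>_. 0)) j (gl_act h form)) = 0"
        by simp
    qed
    moreover have "\<forall>j. (\<mu>(n := \<lambda>_. 0)) j \<in> polynomial_maps" using \<mu> by (simp add: polynomial_maps.const)
    ultimately show ?thesis using E by blast
  qed
qed

text \<open>For fixed \<open>g\<close> the two expressions for \<open>app x g h\<close> give a
  relation in \<open>h\<close> among 1, the \<open>\<beta> j\<close> and \<open>y\<close>. Apply the
  functional and set \<open>h = g\<close>: the differences of the \<open>f j\<close> vanish, and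
  only the values at 1 and at \<open>y\<close> remain.\<close>

lemma rational_of_orbit_ideal:
  assumes x: "x \<in> orbit_ideal" and eq: "\<And>g h. invertible g \<Longrightarrow> invertible h \<Longrightarrow> app x g h = \<gamma> g * (y h - y g)"
    and nz: "\<And>g. invertible g \<Longrightarrow> \<gamma> g \<noteq> 0"
  shows "\<exists>E\<in>polynomial_maps. \<exists>F\<in>polynomial_maps. (\<exists>p\<in>gl_orbit form. E p \<noteq> 0) \<and>
    (\<forall>g. invertible g \<longrightarrow> y g * E (gl_act g form) = F (gl_act g form))"
proof -
  obtain xs where xs: "\<forall>(\<alpha>, \<beta>, f)\<in>set xs. f \<in> polynomial_maps"
    "\<And>g h. invertible g \<Longrightarrow> invertible h \<Longrightarrow>
      app x g h = (\<Sum>(\<alpha>, \<beta>, f)\<leftarrow>xs. \<alpha> g * \<beta> h * (f (gl_act g form) - f (gl_act h form)))"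
    using x unfolding orbit_ideal_def by blast
  let ?n = "length xs"
  define \<alpha> where "\<alpha> j = fst (xs ! j)" for j
  define \<beta> where "\<beta> j = fst (snd (xs ! j))" for j
  define f where "f j = (if j < ?n then snd (snd (xs ! j)) else (\<lambda>_. 0))" for j
  have f: "f j \<in> polynomial_maps" for j
  proof (cases "j < ?n")
    case True
    then have "case xs ! j of (\<alpha>, \<beta>, f) \<Rightarrow> f \<in> polynomial_maps" by (rule bspec[OF xs(1) nth_mem])
    then show ?thesis using True by (simp add: f_def case_prod_beta)
  qed (simp add: f_def polynomial_maps.const)
  have sm: "app x g h = (\<Sum>j<?n. \<alpha> j g * \<beta> j h * (f j (gl_act g form) - f j (gl_act h form)))"
    if "invertible g" "invertible h" for g h
    unfolding xs(2)[OF that] sum_list_sum_nth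
    by (simp add: atLeast0LessThan \<alpha>_def \<beta>_def f_def case_prod_beta)
  define u where "u j = (if j = ?n then y else \<beta> j)" for j
  obtain E \<mu> where E: "E \<in> polynomial_maps" "\<exists>p\<in>gl_orbit form. E p \<noteq> 0" and \<mu>: "\<And>j. \<mu> j \<in> polynomial_maps"
    and rel: "functional u (Suc ?n) E \<mu>"
    using descent_functional by blast
  have "y g * E (gl_act g form) = \<mu> ?n (gl_act g form)" if g: "invertible g" for g
  proof -
    define r where "r j = (if j = ?n then (\<lambda>_. \<gamma> g) else (\<lambda>p. \<alpha> j g * (f j p - f j (gl_act g form))))" for j
    have r: "r j \<in> polynomial_maps" for j
      unfolding r_def by (auto intro!: polynomial_maps.mult polynomial_maps.const polynomial_maps_diff f)
    have "(\<lambda>_. - (\<gamma> g * y g)) (gl_act h form) + (\<Sum>j<Suc ?n. r j (gl_act h form) * u j h) = 0" if h: "invertible h" for h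
    proof -
      have "(\<Sum>j<?n. r j (gl_act h form) * u j h) = - (\<Sum>j<?n. \<alpha> j g * \<beta> j h * (f j (gl_act g form) - f j (gl_act h form)))"
        unfolding sum_negf[symmetric] by (intro sum.cong) (auto simp: r_def u_def algebra_simps)
      then show ?thesis using eq[OF g h] sm[OF g h] by (simp add: r_def u_def algebra_simps)
    qed
    from functionalD[OF rel polynomial_maps.const r this g]
    have "- (\<gamma> g * y g) * E (gl_act g form) + (\<Sum>j<Suc ?n. r j (gl_act g form) * \<mu> j (gl_act g form)) = 0" .
    moreover have "(\<Sum>j<?n. r j (gl_act g form) * \<mu> j (gl_act g form)) = 0"
      by (intro sum.neutral) (auto simp: r_def)
    ultimately have "\<gamma> g * (y g * E (gl_act g form)) = \<gamma> g * \<mu> ?n (gl_act g form)"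
      by (auto simp: r_def algebra_simps)
    then show ?thesis using nz[OF g] by simp
  qed
  then show ?thesis
    by (intro bexI[of _ E] bexI[of _ "\<mu> ?n"] conjI) (use E \<mu> in simp_all)
qed

end

text \<open>\<open>W\<close> is the support of the symmetric tensor of \<open>form\<close>.
  \<open>diagonal\<close> is demanded for every congruence ideal because it is applied to
  \<open>orbit_ideal\<close>, which depends on the form.\<close>

locale torus_form = balanced_form B "\<lambda>_. 1" \<omega> s P
  for B :: "('i::finite \<Rightarrow> 'v::finite) set" and \<omega> s P +
  fixes W :: "('i \<Rightarrow> 'v) set"
  assumes W: "W = {\<beta> \<circ> \<tau> | \<beta> \<tau>. \<beta> \<in> B \<and> \<tau> permutes UNIV}"
    and diagonal: "\<And>(I :: (complex ^ 'v ^ 'v, complex ^ 'v ^ 'v) sep_fun set) C x y.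
      cong_ideal I \<Longrightarrow> cong_ideal.annihilates I C W \<Longrightarrow> x \<noteq> y \<Longrightarrow> C x y \<in> I"
begin

text \<open>By \<open>free\<close> each word of \<open>W\<close> is
  \<open>\<beta> \<circ> \<tau>\<close> for just one pair, so no multiplicities arise.\<close>

lemma tens_W: "tens g \<theta> = (\<Sum>b\<in>UNIV. (\<Prod>i\<in>UNIV. g $ \<theta> i $ b i) * of_bool (b \<in> W))"
proof -
  let ?P = "{\<tau>. \<tau> permutes (UNIV :: 'i set)}"
  have "bij_betw (\<lambda>(\<tau>, \<beta>). \<beta> \<circ> \<tau>) (?P \<times> B) W"
  proof (rule bij_betw_imageI)
    show "inj_on (\<lambda>(\<tau>, \<beta>). \<beta> \<circ> \<tau>) (?P \<times> B)"
    proof (rule inj_onI, clarsimp)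
      fix \<tau> \<tau>' and \<beta> \<beta>' assume h: "\<tau> permutes UNIV" "\<tau>' permutes UNIV" "\<beta> \<in> B" "\<beta>' \<in> B" "\<beta> \<circ> \<tau> = \<beta>' \<circ> \<tau>'"
      have "\<beta> \<circ> (\<tau> \<circ> inv \<tau>') = \<beta>' \<circ> (\<tau>' \<circ> inv \<tau>')" using h(5) by (simp add: comp_assoc[symmetric])
      then have e: "\<beta> \<circ> (\<tau> \<circ> inv \<tau>') = \<beta>'" using permutes_inv_o(1)[OF h(2)] by simp
      then have i: "\<tau> \<circ> inv \<tau>' = id"
        using free[OF h(3), of "\<tau> \<circ> inv \<tau>'"] h by (simp add: permutes_compose permutes_inv)
      have "\<tau> = \<tau> \<circ> (inv \<tau>' \<circ> \<tau>')" using permutes_inv_o(2)[OF h(2)] by simp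
      also have "\<dots> = \<tau>'" using i by (simp add: comp_assoc[symmetric])
      finally show "\<tau> = \<tau>' \<and> \<beta> = \<beta>'" using e i by simp
    qed
    show "(\<lambda>(\<tau>, \<beta>). \<beta> \<circ> \<tau>) ` (?P \<times> B) = W" unfolding W by force
  qed
  from sum.reindex_bij_betw[OF this, of "\<lambda>b. \<Prod>i\<in>UNIV. g $ \<theta> i $ b i"]
  have "(\<Sum>b\<in>W. \<Prod>i\<in>UNIV. g $ \<theta> i $ b i) = tens g \<theta>"
    by (simp add: tens_def sum.cartesian_product case_prod_beta)
  then show ?thesis by (simp add: of_bool_def sum.If_cases if_distrib[of "\<lambda>x. _ * x"] cong: if_cong)
qed

lemma tens_matrix_mult: "tens (h ** g) b = (\<Sum>\<theta>\<in>UNIV. (\<Prod>i\<in>UNIV. h $ b i $ \<theta> i) * tens g \<theta>)"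
proof -
  have "(\<Prod>i\<in>UNIV. (h ** g) $ b i $ b' i) = (\<Sum>\<theta>\<in>UNIV. (\<Prod>i\<in>UNIV. h $ b i $ \<theta> i) * (\<Prod>i\<in>UNIV. g $ \<theta> i $ b' i))" for b'
    unfolding matrix_matrix_mult_def by (simp add: prod_sum_UNIV prod.distrib)
  then show ?thesis
    unfolding tens_W sum_distrib_left sum_distrib_right by (subst sum.swap) (simp add: sum_distrib_right mult.assoc)
qed

lemma tens_one: "tens (mat 1) b = of_bool (b \<in> W)"
proof -
  have "(\<Prod>i\<in>UNIV. mat 1 $ b i $ b' i) = (if b' = b then 1 else 0 :: complex)" for b'
  proof (cases "b' = b")
    case False
    then obtain i where "b' i \<noteq> b i" by auto
    then show ?thesis using False by (auto simp: mat_def intro!: prod_zero bexI[of _ i])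
  qed (simp add: mat_def)
  then show ?thesis by (simp add: tens_W if_distrib[of "\<lambda>x. x * _"] cong: if_cong)
qed

theorem det_square_rational:
  "\<exists>E\<in>polynomial_maps. \<exists>F\<in>polynomial_maps. (\<exists>p\<in>gl_orbit form. E p \<noteq> 0) \<and>
    (\<forall>g. invertible g \<longrightarrow> det g ^ 2 * E (gl_act g form) = F (gl_act g form))"
proof -
  interpret cong_ideal orbit_ideal by (rule cong_ideal_orbit_ideal)
  define gi where "gi a b = (sep_left (\<lambda>g. matrix_inv g $ a $ b) :: (complex ^ 'v ^ 'v, complex ^ 'v ^ 'v) sep_fun)" for a b
  define gm where "gm a b = (sep_left (\<lambda>g. g $ a $ b) :: (complex ^ 'v ^ 'v, complex ^ 'v ^ 'v) sep_fun)" for a b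
  define hi where "hi a b = (sep_right (\<lambda>g. matrix_inv g $ a $ b) :: (complex ^ 'v ^ 'v, complex ^ 'v ^ 'v) sep_fun)" for a b
  define hm where "hm a b = (sep_right (\<lambda>g. g $ a $ b) :: (complex ^ 'v ^ 'v, complex ^ 'v ^ 'v) sep_fun)" for a b
  \<comment> \<open>The entries of \<open>g^-1 h\<close> are separable: the inverse involves only
    \<open>g\<close>, the other factor only \<open>h\<close>.\<close>
  define S where "S a b = (\<Sum>c\<in>UNIV. gi a c * hm c b)" for a b
  define S' where "S' a b = (\<Sum>c\<in>UNIV. hi a c * gm c b)" for a b
  have S: "app (S a b) g h = (matrix_inv g ** h) $ a $ b" for a b g h
    by (simp add: S_def gi_def hm_def app_simps matrix_matrix_mult_def)
  have S': "app (S' a b) g h = (matrix_inv h ** g) $ a $ b" for a b g h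
    by (simp add: S'_def hi_def gm_def app_simps matrix_matrix_mult_def)
  have inv: "matrix_inv g ** g = mat 1" "g ** matrix_inv g = mat 1" if "invertible g" for g :: "complex ^ 'v ^ 'v"
    using someI_ex[OF that[unfolded invertible_def]] by (simp_all add: matrix_inv_def)
  \<comment> \<open>The weights scaled by the degree and shifted by \<open>s\<close>: they stay
    distinct and now sum to 0 over each word of \<open>W\<close>.\<close>
  define lam where "lam a = int CARD('i) * int (\<omega> a) - int s" for a
  interpret torus_stabilizer orbit_ideal W P lam S S'
  proof
    show "inj lam" by (auto simp: inj_def lam_def \<omega>_inj)
    show "(\<Sum>i\<in>UNIV. lam (b i)) = 0" if bW: "b \<in> W" for b
    proof -
      obtain \<beta> \<tau> where b: "b = \<beta> \<circ> \<tau>" "\<beta> \<in> B" "\<tau> permutes UNIV" using bW unfolding W by blast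
      have "(\<Sum>i\<in>UNIV. \<omega> (b i)) = s"
        using sum.permute[OF b(3), of "\<lambda>i. \<omega> (\<beta> i)"] weight[OF b(2)] b(1) by (simp add: o_def)
      then have "(\<Sum>i\<in>UNIV. int (\<omega> (b i))) = int s" by (simp flip: of_nat_sum)
      then show ?thesis by (simp add: lam_def sum_subtractf flip: sum_distrib_left)
    qed
    show "C x y \<in> orbit_ideal" if "annihilates C W" "x \<noteq> y" for C x y
      using diagonal[OF cong_ideal_orbit_ideal that] .
    show "P \<subseteq> W"
    proof
      fix \<beta> assume "\<beta> \<in> P"
      then show "\<beta> \<in> W" using P unfolding W by (intro CollectI exI[of _ \<beta>] exI[of _ id]) (auto simp: permutes_id)
    qed
    show "bij_betw (\<lambda>(\<beta>, i). \<beta> i) (P \<times> UNIV) UNIV" by (rule partition)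
    show "eqv (\<Sum>c\<in>UNIV. S x c * S' c y) (of_bool (x = y))" for x y
      unfolding eqv_def
    proof (rule orbit_ideal_null)
      fix g h :: "complex ^ 'v ^ 'v" assume gh: "invertible g" "invertible h"
      have "(matrix_inv g ** h) ** (matrix_inv h ** g) = matrix_inv g ** (h ** matrix_inv h) ** g"
        by (simp only: matrix_mul_assoc)
      then have "(matrix_inv g ** h) ** (matrix_inv h ** g) = mat 1" using gh by (simp add: inv)
      then have "((matrix_inv g ** h) ** (matrix_inv h ** g)) $ x $ y = of_bool (x = y)" by (simp add: mat_def)
      then show "app ((\<Sum>c\<in>UNIV. S x c * S' c y) - of_bool (x = y)) g h = 0"
        by (simp add: app_simps S S' matrix_matrix_mult_def[of "matrix_inv g ** h"])
    qed
    show "eqv (\<Sum>c\<in>UNIV. S' x c * S c y) (of_bool (x = y))" for x y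
      unfolding eqv_def
    proof (rule orbit_ideal_null)
      fix g h :: "complex ^ 'v ^ 'v" assume gh: "invertible g" "invertible h"
      have "(matrix_inv h ** g) ** (matrix_inv g ** h) = matrix_inv h ** (g ** matrix_inv g) ** h"
        by (simp only: matrix_mul_assoc)
      then have "(matrix_inv h ** g) ** (matrix_inv g ** h) = mat 1" using gh by (simp add: inv)
      then have "((matrix_inv h ** g) ** (matrix_inv g ** h)) $ x $ y = of_bool (x = y)" by (simp add: mat_def)
      then show "app ((\<Sum>c\<in>UNIV. S' x c * S c y) - of_bool (x = y)) g h = 0"
        by (simp add: app_simps S S' matrix_matrix_mult_def[of "matrix_inv h ** g"])
    qed
    show "eqv (\<Sum>b'\<in>UNIV. (\<Prod>i\<in>UNIV. S (b i) (b' i)) * of_bool (b' \<in> W)) (of_bool (b \<in> W))" for b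
    proof -
      obtain T where T: "\<And>\<theta>. T \<theta> \<in> polynomial_maps" "\<And>\<theta> g. T \<theta> (gl_act g form) = tens g \<theta>"
        using tens_regular by metis
      \<comment> \<open>This is \<open>g^-1 h w - w = g^-1 (h w - g w)\<close>: the coefficients
        depend on \<open>g\<close> alone and the differences of tensor entries lie in the
        ideal.\<close>
      define c where "c \<theta> = (sep_left (\<lambda>g. \<Prod>i\<in>UNIV. matrix_inv g $ b i $ \<theta> i) :: (complex ^ 'v ^ 'v, complex ^ 'v ^ 'v) sep_fun)" for \<theta>
      have "c \<theta> * (sep_right (\<lambda>h. tens h \<theta>) - sep_left (\<lambda>g. tens g \<theta>)) \<in> orbit_ideal" for \<theta>
        by (rule orbit_ideal_gen[OF T(1)[of \<theta>], of _ "\<lambda>g. - (\<Prod>i\<in>UNIV. matrix_inv g $ b i $ \<theta> i)" "\<lambda>_. 1"])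
          (simp add: c_def app_simps T(2) algebra_simps)
      then have m: "eqv (\<Sum>\<theta>\<in>UNIV. c \<theta> * (sep_right (\<lambda>h. tens h \<theta>) - sep_left (\<lambda>g. tens g \<theta>))) (\<Sum>\<theta>\<in>(UNIV :: ('i \<Rightarrow> 'v) set). 0)"
        by (intro eqv_sum) (simp add: eqv_0)
      have "eqv ((\<Sum>b'\<in>UNIV. (\<Prod>i\<in>UNIV. S (b i) (b' i)) * of_bool (b' \<in> W)) - of_bool (b \<in> W))
        (\<Sum>\<theta>\<in>UNIV. c \<theta> * (sep_right (\<lambda>h. tens h \<theta>) - sep_left (\<lambda>g. tens g \<theta>)))"
        unfolding eqv_def
      proof (rule orbit_ideal_null)
        fix g h :: "complex ^ 'v ^ 'v" assume gh: "invertible g" "invertible h"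
        have "tens (matrix_inv g ** g) b = of_bool (b \<in> W)" using gh by (simp add: inv tens_one)
        then show "app ((\<Sum>b'\<in>UNIV. (\<Prod>i\<in>UNIV. S (b i) (b' i)) * of_bool (b' \<in> W)) - of_bool (b \<in> W) -
          (\<Sum>\<theta>\<in>UNIV. c \<theta> * (sep_right (\<lambda>h. tens h \<theta>) - sep_left (\<lambda>g. tens g \<theta>)))) g h = 0"
          using tens_W[of "matrix_inv g ** h" b] tens_matrix_mult[of "matrix_inv g" h b] tens_matrix_mult[of "matrix_inv g" g b]
          by (simp add: app_simps S c_def right_diff_distrib sum_subtractf)
      qed
      from eqv_trans[OF this m] show ?thesis by (simp add: eqv_def)
    qed
  qed
  have "det (\<chi> a b. S a b) ^ 2 - 1 \<in> orbit_ideal" using det_square_eqv by (simp add: eqv_def)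
  then show ?thesis
  proof (rule rational_of_orbit_ideal[where \<gamma> = "\<lambda>g. 1 / det g ^ 2"])
    fix g h :: "complex ^ 'v ^ 'v" assume g: "invertible g" "invertible h"
    have "det (matrix_inv g) * det g = 1" using inv(1)[OF g(1)] by (metis det_I det_mul)
    moreover have nz: "det g \<noteq> 0" using g by (simp add: invertible_det_nz)
    ultimately have di: "det (matrix_inv g) = 1 / det g" by (simp add: field_simps)
    have "app (det (\<chi> a b. S a b) ^ 2 - 1) g h = det (matrix_inv g ** h) ^ 2 - 1"
      by (simp add: power2_eq_square app_simps S)
    also have "\<dots> = 1 / det g ^ 2 * (det h ^ 2 - det g ^ 2)"
      using nz by (simp add: det_mul di power_divide field_simps)
    finally show "app (det (\<chi> a b. S a b) ^ 2 - 1) g h = 1 / det g ^ 2 * (det h ^ 2 - det g ^ 2)" .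
  qed (simp add: invertible_det_nz)
qed

end

section \<open>Combination of integrality, rationality and non-regularity\<close>

context balanced_form
begin

theorem not_normal:
  assumes D: "CARD('i) > 2"
    and rational: "\<exists>E\<in>polynomial_maps. \<exists>F\<in>polynomial_maps. (\<exists>p\<in>gl_orbit form. E p \<noteq> 0) \<and>
      (\<forall>g. invertible g \<longrightarrow> det g ^ 2 * E (gl_act g form) = F (gl_act g form))"
  shows "\<not> normal_variety (orbit_closure CARD('i) form)"
proof
  interpret orbit_closure_ring "CARD('i)" form by standard (rule form_Sym)
  assume nor: "normal_variety Z"
  obtain E F p0 where E: "E \<in> polynomial_maps" and F: "F \<in> polynomial_maps" and p0: "p0 \<in> gl_orbit form" "E p0 \<noteq> 0"
    and EF: "\<And>g. invertible g \<Longrightarrow> det g ^ 2 * E (gl_act g form) = F (gl_act g form)"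
    using rational by blast
  obtain r n where r: "\<And>i. r i \<in> polynomial_maps"
    and int: "\<And>g. det g \<noteq> 0 \<Longrightarrow> (det g ^ 2) ^ n + (\<Sum>i<n. r i (gl_act g form) * (det g ^ 2) ^ i) = 0"
    using det_square_integral by blast
  have "F p ^ n + (\<Sum>i<n. r i p * F p ^ i * E p ^ (n - i)) = 0" if p: "p \<in> gl_orbit form" for p
  proof -
    obtain g where g: "invertible g" "p = gl_act g form" using p unfolding gl_orbit_def by blast
    let ?y = "det g ^ 2"
    have Fp: "F p = ?y * E p" using EF g by simp
    have "r i p * F p ^ i * E p ^ (n - i) = E p ^ n * (r i p * ?y ^ i)" if "i < n" for i
    proof -
      have "E p ^ n = E p ^ i * E p ^ (n - i)" using that by (simp flip: power_add)
      then show ?thesis by (simp add: Fp power_mult_distrib)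
    qed
    then have "(\<Sum>i<n. r i p * F p ^ i * E p ^ (n - i)) = E p ^ n * (\<Sum>i<n. r i p * ?y ^ i)"
      unfolding sum_distrib_left by (intro sum.cong) auto
    then have "F p ^ n + (\<Sum>i<n. r i p * F p ^ i * E p ^ (n - i)) = E p ^ n * (?y ^ n + (\<Sum>i<n. r i p * ?y ^ i))"
      by (simp add: Fp power_mult_distrib distrib_left mult.commute)
    also have "\<dots> = 0" using int[of g] g by (simp add: invertible_det_nz)
    finally show ?thesis .
  qed
  then have "\<exists>f\<in>polynomial_maps. \<forall>p\<in>gl_orbit form. f p * E p = F p"
    by (intro normal_integral_quotient[OF nor F E p0 r])
  then obtain f where f: "f \<in> polynomial_maps" "\<And>p. p \<in> gl_orbit form \<Longrightarrow> f p * E p = F p" by blast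
  obtain g0 where g0: "E (gl_act g0 form) \<noteq> 0" using p0 unfolding gl_orbit_def by blast
  \<comment> \<open>The identity is extended from invertible \<open>g\<close> with \<open>E\<close>
    nonzero to all matrices, since the pairing evaluates it at singular ones too.\<close>
  have "f (gl_act g form) - det g ^ 2 = 0" for g :: "complex ^ 'v ^ 'v"
  proof (rule line_poly_mult_zero[where \<phi> = "\<lambda>g. E (gl_act g form)", OF _ _ _ g0])
    show lp: "line_poly (\<lambda>g. E (gl_act g form))" "line_poly (\<lambda>g. f (gl_act g form) - det g ^ 2)"
      by (intro line_poly_orbit line_poly_diff line_poly_power line_poly_det E f)+
    show "E (gl_act g form) * (f (gl_act g form) - det g ^ 2) = 0" for g
    proof (rule line_poly_zero_if_invertible[OF line_poly_mult[OF lp]])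
      fix g :: "complex ^ 'v ^ 'v" assume g: "invertible g"
      then have "f (gl_act g form) * E (gl_act g form) = F (gl_act g form)" using f(2) unfolding gl_orbit_def by blast
      then show "E (gl_act g form) * (f (gl_act g form) - det g ^ 2) = 0" using EF[OF g] by (simp add: algebra_simps)
    qed
  qed
  then show False using det_square_not_regular[OF D f(1)] by simp
qed

end

lemma (in torus_form) orbit_closure_not_normal:
  "CARD('i) > 2 \<Longrightarrow> \<not> normal_variety (orbit_closure CARD('i) form)"
  using not_normal det_square_rational by blast

section \<open>Products of variables\<close>

text \<open>A test word that exactly two changes of one letter bring into \<open>W\<close> isolates
  a sum of two coefficients in the linear system.\<close>

lemma (in cong_ideal) annihilates_two_terms:
  fixes t :: "'i::finite \<Rightarrow> 'v::finite"
  assumes ann: "annihilates C W" and "i \<noteq> j"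
    and mem: "\<And>k a. t(k := a) \<in> W \<longleftrightarrow> k = i \<and> a = x \<or> k = j \<and> a = y"
  shows "C (t i) x + C (t j) y \<in> I"
proof -
  have "(\<Sum>a\<in>UNIV. C (t k) a * of_bool (t(k := a) \<in> W)) =
    (if k = i then C (t i) x else 0) + (if k = j then C (t j) y else 0)" for k
  proof -
    have "(\<Sum>a\<in>UNIV. C (t k) a * of_bool (t(k := a) \<in> W)) =
      (\<Sum>a\<in>UNIV. if a = (if k = i then x else y) then if k = i then C (t i) x else if k = j then C (t j) y else 0 else 0)"
      using \<open>i \<noteq> j\<close> by (intro sum.cong) (auto simp: mem)
    then show ?thesis using \<open>i \<noteq> j\<close> by simp
  qed
  then have "(\<Sum>k\<in>UNIV. \<Sum>a\<in>UNIV. C (t k) a * of_bool (t(k := a) \<in> W)) = C (t i) x + C (t j) y"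
    by (simp add: sum.distrib)
  then show ?thesis using spec[OF ann[unfolded annihilates_def], of t] by simp
qed

lemma (in cong_ideal) double_mem: "x + x \<in> I \<Longrightarrow> x \<in> I"
  using int_cancel[of 2 x] by simp

lemma permutes_UNIV_iff_inj: "p permutes UNIV \<longleftrightarrow> inj p" for p :: "'a::finite \<Rightarrow> 'a"
  by (metis UNIV_I bij_betw_def bij_imp_permutes finite finite_UNIV_inj_surj permutes_inj)

lemma inj_update_iff:
  fixes p :: "'a::finite \<Rightarrow> 'b::finite"
  assumes "bij p"
  shows "inj (p(x := y)) \<longleftrightarrow> y = p x"
proof
  assume inj: "inj (p(x := y))"
  obtain z where z: "y = p z" using assms by (meson bij_pointE)
  show "y = p x"
  proof (rule ccontr)
    assume "y \<noteq> p x"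
    then have "z \<noteq> x" using z by blast
    then show False using inj_onD[OF inj, of x z] z by simp
  qed
next
  assume "y = p x"
  then show "inj (p(x := y))" using assms by (simp add: bij_def)
qed

text \<open>In \<open>p(k := p i)\<close> the value \<open>p i\<close> is doubled and
  \<open>p k\<close> is missing; one change repairs this only by putting \<open>p k\<close> at one
  of the two equal places.\<close>

lemma inj_collapsed_update_iff:
  fixes p :: "'a::finite \<Rightarrow> 'a"
  assumes p: "bij p" and "i \<noteq> k"
  shows "inj ((p(k := p i))(x := y)) \<longleftrightarrow> y = p k \<and> (x = k \<or> x = i)"
proof
  assume inj: "inj ((p(k := p i))(x := y))" (is "inj ?q")
  have x: "x = k \<or> x = i"
  proof (rule ccontr)
    assume "\<not> ?thesis"
    then show False using inj_onD[OF inj, of i k] \<open>i \<noteq> k\<close> by auto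
  qed
  have "surj ?q" using finite_UNIV_inj_surj[OF finite inj] .
  then obtain z where z: "?q z = p k" by (metis surjD)
  have "z = x"
  proof (rule ccontr)
    assume "z \<noteq> x"
    then have "(p(k := p i)) z = p k" using z by simp
    then show False using p \<open>i \<noteq> k\<close> by (auto simp: bij_def inj_def split: if_splits)
  qed
  then show "y = p k \<and> (x = k \<or> x = i)" using z x by simp
next
  assume a: "y = p k \<and> (x = k \<or> x = i)"
  then consider "(p(k := p i))(x := y) = p" | "(p(k := p i))(x := y) = p \<circ> Transposition.transpose i k"
    using \<open>i \<noteq> k\<close> by (auto simp: fun_eq_iff Transposition.transpose_def)
  then show "inj ((p(k := p i))(x := y))"
    by cases (use p in \<open>auto simp: bij_def intro!: inj_compose\<close>)
qed

lemma ex_enumeration: "\<exists>\<iota> :: 'a::finite \<Rightarrow> nat. bij_betw \<iota> UNIV {..<CARD('a)}"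
  using ex_bij_betw_finite_nat[of "UNIV :: 'a set"] by (simp add: atLeast0LessThan)

lemma prod_form_not_normal:
  assumes "CARD('m::finite) > 2"
  shows "\<not> normal_variety (orbit_closure CARD('m) (prod_form :: 'm cpoly))"
proof -
  obtain \<omega> :: "'m \<Rightarrow> nat" where \<omega>: "bij_betw \<omega> UNIV {..<CARD('m)}" using ex_enumeration by blast
  let ?W = "{\<beta> \<circ> \<tau> | \<beta> \<tau>. \<beta> \<in> {id :: 'm \<Rightarrow> 'm} \<and> \<tau> permutes UNIV}"
  have W: "b \<in> ?W \<longleftrightarrow> inj b" for b by (auto simp: permutes_UNIV_iff_inj)
  have bal: "balanced_form {id :: 'm \<Rightarrow> 'm} (\<lambda>_. 1) \<omega> (\<Sum>i\<in>UNIV. \<omega> i) {id}"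
    by unfold_locales (use \<omega> in \<open>auto simp: bij_betw_def inj_on_def image_iff\<close>)
  interpret torus_form "{id :: 'm \<Rightarrow> 'm}" \<omega> "\<Sum>i\<in>UNIV. \<omega> i" "{id}" ?W
  proof (intro torus_form.intro bal torus_form_axioms.intro refl)
    fix I :: "(complex ^ 'm ^ 'm, complex ^ 'm ^ 'm) sep_fun set" and C and x y :: 'm
    assume I: "cong_ideal I" and ann: "cong_ideal.annihilates I C ?W" and "x \<noteq> y"
    interpret cong_ideal I by (rule I)
    \<comment> \<open>In the word with \<open>x\<close> in place of \<open>y\<close> both
      corrections turn an \<open>x\<close> into \<open>y\<close>, so the equation reads
      \<open>2 C x y = 0\<close>.\<close>
    have "(id(y := x))(k := a) \<in> ?W \<longleftrightarrow> k = y \<and> a = y \<or> k = x \<and> a = y" for k a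
      unfolding W using inj_collapsed_update_iff[of id x y k a] \<open>x \<noteq> y\<close> by auto
    from annihilates_two_terms[OF ann _ this] \<open>x \<noteq> y\<close>
    have "C ((id(y := x)) y) y + C ((id(y := x)) x) y \<in> I" by blast
    then show "C x y \<in> I" using \<open>x \<noteq> y\<close> double_mem[of "C x y"] by simp
  qed
  have "form = prod_form" by (simp add: form_def prod_form_def Const_def)
  then show ?thesis using orbit_closure_not_normal assms by simp
qed

section \<open>Determinants and permanents\<close>

definition graph_map :: "('n \<Rightarrow> 'n) \<Rightarrow> 'n \<Rightarrow> 'n \<times> 'n"
  where "graph_map \<pi> i = (i, \<pi> i)"

definition graphs :: "('n \<Rightarrow> 'n \<times> 'n) set"
  where "graphs = graph_map ` {\<pi>. \<pi> permutes UNIV}"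

lemma inj_graph_map: "inj graph_map"
  by (auto simp: inj_def graph_map_def fun_eq_iff)

lemma sum_graphs: "(\<Sum>\<beta>\<in>graphs. F \<beta>) = (\<Sum>\<pi> | \<pi> permutes UNIV. F (graph_map \<pi>))"
  unfolding graphs_def by (subst sum.reindex) (auto intro: inj_on_subset[OF inj_graph_map])

text \<open>The blocks of the partition are the translates of a cyclic Latin square.\<close>

lemma ex_balanced_graphs:
  "\<exists>\<omega> s P. \<forall>c. (\<forall>\<beta>\<in>graphs. c \<beta> \<noteq> 0) \<longrightarrow> balanced_form (graphs :: ('n::finite \<Rightarrow> 'n \<times> 'n) set) c \<omega> s P"
proof -
  let ?n = "CARD('n)"
  have n: "?n > 0" by simp
  obtain \<iota> :: "'n \<Rightarrow> nat" where \<iota>: "bij_betw \<iota> UNIV {..<?n}" using ex_enumeration by blast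
  have \<iota>_less: "\<iota> i < ?n" for i using \<iota> by (auto simp: bij_betw_def)
  have \<iota>_eq: "\<iota> i = \<iota> j \<longleftrightarrow> i = j" for i j using \<iota> by (auto simp: bij_betw_def inj_def)
  obtain \<kappa> where \<kappa>: "\<And>m. m < ?n \<Longrightarrow> \<iota> (\<kappa> m) = m" using \<iota> by (metis bij_betw_inv_into_right lessThan_iff)
  define rot where "rot k i = \<kappa> ((\<iota> i + k) mod ?n)" for k i
  have \<iota>_rot: "\<iota> (rot k i) = (\<iota> i + k) mod ?n" for k i using n by (simp add: rot_def \<kappa>)
  have mod_cancel: "(a + k) mod ?n = (b + k) mod ?n \<Longrightarrow> a < ?n \<Longrightarrow> b < ?n \<Longrightarrow> a = b" for a b k :: nat
  proof -
    assume h: "(a + k) mod ?n = (b + k) mod ?n" "a < ?n" "b < ?n"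
    then have "(int a + int k) mod int ?n = (int b + int k) mod int ?n" by (metis of_nat_add of_nat_mod)
    then have "int ?n dvd int a - int b" by (simp add: mod_eq_dvd_iff)
    then show "a = b" using dvd_imp_le_int[of "int a - int b" "int ?n"] h by linarith
  qed
  have rot: "rot k permutes UNIV" for k
    unfolding permutes_UNIV_iff_inj
  proof (rule injI)
    fix i j assume "rot k i = rot k j"
    then have "(\<iota> i + k) mod ?n = (\<iota> j + k) mod ?n" by (metis \<iota>_rot)
    then show "i = j" using mod_cancel \<iota>_less \<iota>_eq by blast
  qed
  \<comment> \<open>Numbering in base n: the graph of a permutation meets each row and each column
    once, so its total weight is constant.\<close>
  define \<omega> where "\<omega> = (\<lambda>(i, j). \<iota> i + ?n * \<iota> j)"
  define P where "P = (\<lambda>k. graph_map (rot k)) ` {..<?n}"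
  have part: "bij_betw (\<lambda>(\<beta>, i). \<beta> i) (P \<times> UNIV) UNIV"
  proof (rule bij_betw_imageI)
    show "inj_on (\<lambda>(\<beta>, i). \<beta> i) (P \<times> UNIV)"
    proof (rule inj_onI, clarsimp simp: P_def graph_map_def)
      fix k k' i assume k: "k < ?n" "k' < ?n" "rot k i = rot k' i"
      then have "(k + \<iota> i) mod ?n = (k' + \<iota> i) mod ?n" by (metis \<iota>_rot add.commute)
      then show "graph_map (rot k) = graph_map (rot k')" using mod_cancel k by blast
    qed
    have "(i, j) \<in> (\<lambda>(\<beta>, i). \<beta> i) ` (P \<times> UNIV)" for i j
    proof -
      \<comment> \<open>The shift from \<open>i\<close> to \<open>j\<close> is
        \<open>\<iota> j - \<iota> i\<close> modulo n; adding n first keeps it a natural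
        number.\<close>
      let ?k = "(\<iota> j + (?n - \<iota> i)) mod ?n"
      have "\<iota> (rot ?k i) = (\<iota> i + (\<iota> j + (?n - \<iota> i))) mod ?n" by (simp add: \<iota>_rot mod_add_right_eq)
      also have "\<iota> i + (\<iota> j + (?n - \<iota> i)) = \<iota> j + ?n" using \<iota>_less[of i] by simp
      finally have "rot ?k i = j" using \<iota>_less[of j] \<iota>_eq by simp
      then have "(i, j) = graph_map (rot ?k) i" by (simp add: graph_map_def)
      moreover have "graph_map (rot ?k) \<in> P" using n by (simp add: P_def)
      ultimately show ?thesis by force
    qed
    then show "(\<lambda>(\<beta>, i). \<beta> i) ` (P \<times> UNIV) = UNIV" by auto
  qed
  have \<omega>: "bij_betw \<omega> UNIV {..<CARD('n \<times> 'n)}"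
  proof -
    have "inj \<omega>"
    proof (rule injI, clarsimp simp: \<omega>_def)
      fix i j i' j' assume h: "\<iota> i + ?n * \<iota> j = \<iota> i' + ?n * \<iota> j'"
      have "\<iota> i = (\<iota> i + ?n * \<iota> j) mod ?n" "\<iota> i' = (\<iota> i' + ?n * \<iota> j') mod ?n" using \<iota>_less by simp_all
      then have "\<iota> i = \<iota> i'" using h by simp
      then show "i = i' \<and> j = j'" using h n \<iota>_eq by simp
    qed
    moreover have "range \<omega> \<subseteq> {..<CARD('n \<times> 'n)}"
    proof (clarsimp simp: \<omega>_def)
      fix i j
      have "\<iota> i + ?n * \<iota> j < ?n + ?n * \<iota> j" using \<iota>_less[of i] by simp
      also have "\<dots> \<le> ?n * ?n" using \<iota>_less[of j] by (metis Suc_leI mult_Suc_right mult_le_mono2)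
      finally show "\<iota> i + ?n * \<iota> j < ?n * ?n" .
    qed
    moreover have "card (range \<omega>) = CARD('n \<times> 'n)" using \<open>inj \<omega>\<close> by (rule card_image)
    ultimately show ?thesis unfolding bij_betw_def by (simp add: card_subset_eq)
  qed
  have "balanced_form graphs c \<omega> ((\<Sum>i\<in>UNIV. \<iota> i) + ?n * (\<Sum>i\<in>UNIV. \<iota> i)) P" if "\<forall>\<beta>\<in>graphs. c \<beta> \<noteq> 0" for c
  proof
    show "\<tau> = id" if "\<beta> \<in> graphs" "\<tau> permutes UNIV" "\<beta> \<circ> \<tau> \<in> graphs" for \<beta> and \<tau> :: "'n \<Rightarrow> 'n"
      using that by (auto simp: graphs_def graph_map_def fun_eq_iff)
    show "(\<Sum>i\<in>UNIV. \<omega> (\<beta> i)) = (\<Sum>i\<in>UNIV. \<iota> i) + ?n * (\<Sum>i\<in>UNIV. \<iota> i)" if \<beta>: "\<beta> \<in> graphs" for \<beta>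
    proof -
      obtain \<pi> where \<pi>: "\<pi> permutes UNIV" "\<beta> = graph_map \<pi>" using \<beta> by (auto simp: graphs_def)
      have "(\<Sum>i\<in>UNIV. \<iota> (\<pi> i)) = (\<Sum>i\<in>UNIV. \<iota> i)" using sum.permute[OF \<pi>(1), of \<iota>] by (simp add: o_def)
      then show ?thesis by (simp add: \<pi>(2) graph_map_def \<omega>_def sum.distrib flip: sum_distrib_left)
    qed
    show "P \<subseteq> graphs" using rot by (auto simp: P_def graphs_def)
  qed (use that part \<omega> in auto)
  then show ?thesis by blast
qed

lemma ex_permutation2:
  assumes "k \<noteq> i" "l \<noteq> j"
  shows "\<exists>\<pi> :: 'n::finite \<Rightarrow> 'n. \<pi> permutes UNIV \<and> \<pi> k = l \<and> \<pi> i = j"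
proof -
  let ?x = "Transposition.transpose k l i"
  let ?\<pi> = "Transposition.transpose ?x j \<circ> Transposition.transpose k l"
  have "?x \<noteq> l" using assms(1) by (auto simp: Transposition.transpose_def)
  then have "?\<pi> k = l" "?\<pi> i = j" using assms by (auto simp: Transposition.transpose_def)
  moreover have "?\<pi> permutes UNIV" by (intro permutes_compose permutes_swap_id) auto
  ultimately show ?thesis by blast
qed

lemma ex_two_others:
  assumes "CARD('n::finite) > 2"
  shows "\<exists>i i' :: 'n. i \<noteq> k \<and> i' \<noteq> k \<and> i \<noteq> i'"
proof -
  have "card (UNIV - {k}) > 1" using assms by (simp add: card_Diff_singleton)
  then have "\<not> (\<exists>i. UNIV - {k} = {i})" by (metis card_1_singleton_iff less_irrefl One_nat_def)
  moreover have "UNIV - {k} \<noteq> {}" using \<open>card (UNIV - {k}) > 1\<close> by (metis card.empty not_less_zero)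
  ultimately show ?thesis by blast
qed

text \<open>Three distinct indices give \<open>f k = - f i = f i' = - f k\<close> modulo
  \<open>I\<close>, and 2 can be cancelled.\<close>

lemma (in cong_ideal) pairwise_negative_mem:
  assumes "CARD('n::finite) > 2" and "\<And>i k :: 'n. i \<noteq> k \<Longrightarrow> f k + f i \<in> I"
  shows "f k \<in> I"
proof -
  obtain i i' :: 'n where i: "i \<noteq> k" "i' \<noteq> k" "i \<noteq> i'" using ex_two_others[OF assms(1)] by blast
  have "(f k + f i) + (f k + f i') + - (f i' + f i) \<in> I"
    using i by (intro add_mem uminus_mem assms(2)) auto
  then show ?thesis using double_mem[of "f k"] by (simp add: algebra_simps)
qed

lemma graph_orbit_iff:
  "b \<in> {\<beta> \<circ> \<tau> | \<beta> \<tau>. \<beta> \<in> graphs \<and> \<tau> permutes UNIV} \<longleftrightarrow> inj (fst \<circ> b) \<and> inj (snd \<circ> b)"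
  for b :: "'n::finite \<Rightarrow> 'n \<times> 'n"
proof
  assume "b \<in> {\<beta> \<circ> \<tau> | \<beta> \<tau>. \<beta> \<in> graphs \<and> \<tau> permutes UNIV}"
  then obtain \<beta> \<tau> where \<beta>: "b = \<beta> \<circ> \<tau>" "\<beta> \<in> graphs" "\<tau> permutes UNIV" by blast
  then obtain \<pi> where b: "b = graph_map \<pi> \<circ> \<tau>" "\<pi> permutes UNIV" "\<tau> permutes UNIV" unfolding graphs_def by blast
  then have "fst \<circ> b = \<tau>" "snd \<circ> b = \<pi> \<circ> \<tau>" by (auto simp: graph_map_def)
  then show "inj (fst \<circ> b) \<and> inj (snd \<circ> b)" using b(2,3) by (metis inj_compose permutes_inj)
next
  assume inj: "inj (fst \<circ> b) \<and> inj (snd \<circ> b)"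
  let ?\<tau> = "fst \<circ> b" and ?\<pi> = "(snd \<circ> b) \<circ> inv (fst \<circ> b)"
  have \<tau>: "?\<tau> permutes UNIV" "(snd \<circ> b) permutes UNIV" using inj by (simp_all add: permutes_UNIV_iff_inj)
  then have "?\<pi> permutes UNIV" by (intro permutes_compose permutes_inv)
  moreover have "b = graph_map ?\<pi> \<circ> ?\<tau>"
    using permutes_inverses(2)[OF \<tau>(1)] by (auto simp: graph_map_def fun_eq_iff prod_eq_iff)
  ultimately show "b \<in> {\<beta> \<circ> \<tau> | \<beta> \<tau>. \<beta> \<in> graphs \<and> \<tau> permutes UNIV}"
    using \<tau>(1) by (auto simp: graphs_def)
qed

lemma per_form_not_normal:
  assumes n: "CARD('n::finite) > 2"
  shows "\<not> normal_variety (orbit_closure CARD('n) (per_form :: ('n \<times> 'n) cpoly))"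
proof -
  obtain \<omega> s P where "\<forall>c. (\<forall>\<beta>\<in>graphs. c \<beta> \<noteq> 0) \<longrightarrow> balanced_form (graphs :: ('n \<Rightarrow> 'n \<times> 'n) set) c \<omega> s P"
    using ex_balanced_graphs[where 'n = 'n] by blast
  then have bal: "balanced_form (graphs :: ('n \<Rightarrow> 'n \<times> 'n) set) (\<lambda>_. 1) \<omega> s P" by simp
  let ?W = "{\<beta> \<circ> \<tau> | \<beta> \<tau>. \<beta> \<in> (graphs :: ('n \<Rightarrow> 'n \<times> 'n) set) \<and> \<tau> permutes UNIV}"
  interpret torus_form graphs \<omega> s P ?W
  proof (intro torus_form.intro bal torus_form_axioms.intro refl)
    fix I :: "(complex ^ ('n \<times> 'n) ^ ('n \<times> 'n), complex ^ ('n \<times> 'n) ^ ('n \<times> 'n)) sep_fun set"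
      and C and x y :: "'n \<times> 'n"
    assume I: "cong_ideal I" and ann: "cong_ideal.annihilates I C ?W" and xy: "x \<noteq> y"
    interpret cong_ideal I by (rule I)
    have fst_upd: "fst \<circ> b(i := z) = (fst \<circ> b)(i := fst z)" and snd_upd: "snd \<circ> b(i := z) = (snd \<circ> b)(i := snd z)"
      for b :: "'n \<Rightarrow> 'n \<times> 'n" and i z by auto
    have fst_g: "fst \<circ> graph_map \<pi> = id" and snd_g: "snd \<circ> graph_map \<pi> = \<pi>" for \<pi> :: "'n \<Rightarrow> 'n"
      by (auto simp: graph_map_def)
    \<comment> \<open>Position \<open>(i, j)\<close> occurs twice in the test word and
      \<open>(k, l)\<close> is missing; it may replace either copy, so one coefficient is counted
      twice.\<close>
    have generic: "C (i, j) (k, l) \<in> I" if "k \<noteq> i" "l \<noteq> j" for i j k l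
    proof -
      obtain \<pi> where \<pi>: "\<pi> permutes UNIV" "\<pi> k = l" "\<pi> i = j" using ex_permutation2[OF \<open>k \<noteq> i\<close> \<open>l \<noteq> j\<close>] by blast
      let ?t = "(graph_map \<pi>)(k := (i, j))"
      have t: "?t(x := z) \<in> ?W \<longleftrightarrow> x = k \<and> z = (k, l) \<or> x = i \<and> z = (k, l)" for x z
        unfolding graph_orbit_iff fst_upd snd_upd fst_g snd_g
        using inj_collapsed_update_iff[of id i k x "fst z"] inj_collapsed_update_iff[of \<pi> i k x "snd z"] \<open>k \<noteq> i\<close> \<pi> permutes_bij[OF \<pi>(1)]
        by (cases z) auto
      have "C (?t k) (k, l) + C (?t i) (k, l) \<in> I"
        by (rule annihilates_two_terms[OF ann \<open>k \<noteq> i\<close> t])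
      then show ?thesis using \<open>k \<noteq> i\<close> \<pi>(3) double_mem[of "C (i, j) (k, l)"] by (simp add: graph_map_def)
    qed
    \<comment> \<open>Here only column \<open>j\<close> is doubled and the corrections lie in
      different rows. Coefficients of two rows are thus negatives of each other, and a third row
      settles them.\<close>
    have row: "C (k, j) (k, l) \<in> I" if "l \<noteq> j" for j k l
    proof (rule pairwise_negative_mem[OF n, of "\<lambda>k. C (k, j) (k, l)"])
      fix i k :: 'n assume "i \<noteq> k"
      then have "k \<noteq> i" by simp
      then obtain \<pi> where \<pi>: "\<pi> permutes UNIV" "\<pi> k = l" "\<pi> i = j" using ex_permutation2[OF _ \<open>l \<noteq> j\<close>] by blast
      let ?t = "(graph_map \<pi>)(k := (k, j))"
      have t: "?t(x := z) \<in> ?W \<longleftrightarrow> x = k \<and> z = (k, l) \<or> x = i \<and> z = (i, l)" for x z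
        unfolding graph_orbit_iff fst_upd snd_upd fst_g snd_g
        using inj_update_iff[of "id :: 'n \<Rightarrow> 'n" x "fst z"] inj_collapsed_update_iff[of \<pi> i k x "snd z"] \<open>k \<noteq> i\<close> \<pi> permutes_bij[OF \<pi>(1)]
        by (cases z) (auto simp: fun_upd_idem)
      have "C (?t k) (k, l) + C (?t i) (i, l) \<in> I"
        by (rule annihilates_two_terms[OF ann \<open>k \<noteq> i\<close> t])
      then show "C (k, j) (k, l) + C (i, j) (i, l) \<in> I" using \<open>k \<noteq> i\<close> \<pi>(3) by (simp add: graph_map_def)
    qed
    have col: "C (i, l) (k, l) \<in> I" if "k \<noteq> i" for i k l
    proof (rule pairwise_negative_mem[OF n, of "\<lambda>l. C (i, l) (k, l)"])
      fix m l :: 'n assume "m \<noteq> l"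
      then have "l \<noteq> m" by simp
      then obtain \<pi> where \<pi>: "\<pi> permutes UNIV" "\<pi> k = l" "\<pi> i = m" using ex_permutation2[OF \<open>k \<noteq> i\<close>] by blast
      let ?t = "(graph_map \<pi>)(k := (i, l))"
      have t: "?t(x := z) \<in> ?W \<longleftrightarrow> x = k \<and> z = (k, l) \<or> x = i \<and> z = (k, m)" for x z
        unfolding graph_orbit_iff fst_upd snd_upd fst_g snd_g
        using inj_collapsed_update_iff[of id i k x "fst z"] inj_update_iff[of \<pi> x "snd z"] \<open>k \<noteq> i\<close> \<pi> permutes_bij[OF \<pi>(1)]
        by (cases z) (auto simp: fun_upd_idem)
      have "C (?t k) (k, l) + C (?t i) (k, m) \<in> I"
        by (rule annihilates_two_terms[OF ann \<open>k \<noteq> i\<close> t])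
      then show "C (i, l) (k, l) + C (i, m) (k, m) \<in> I" using \<open>k \<noteq> i\<close> \<pi>(3) by (simp add: graph_map_def)
    qed
    obtain i j k l where x: "x = (i, j)" and y: "y = (k, l)" by (cases x, cases y)
    show "C x y \<in> I"
      using xy generic[of k i l j] row[of l j k] col[of k i l] unfolding x y by (cases "k = i"; cases "l = j") auto
  qed
  have "form = per_form"
    by (simp add: form_def per_form_def sum_graphs graph_map_def Const_def)
  then show ?thesis using orbit_closure_not_normal n by simp
qed

section \<open>Block diagonal determinants\<close>

text \<open>The set \<open>J\<close> of active fibres is there for the induction that computes the
  sign.\<close>

definition fibrewise :: "('m \<Rightarrow> 'n \<Rightarrow> 'n) \<Rightarrow> 'm set \<Rightarrow> 'n \<times> 'm \<Rightarrow> 'n \<times> 'm"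
  where "fibrewise \<psi> J a = (if snd a \<in> J then \<psi> (snd a) (fst a) else fst a, snd a)"

lemma fibrewise_permutes:
  assumes "\<And>j. \<psi> j permutes (UNIV :: 'n::finite set)"
  shows "fibrewise \<psi> J permutes (UNIV :: ('n \<times> 'm::finite) set)"
proof -
  have "a = b" if e: "fibrewise \<psi> J a = fibrewise \<psi> J b" for a b
  proof -
    have s: "snd a = snd b" using e by (simp add: fibrewise_def)
    then have "(if snd b \<in> J then \<psi> (snd b) (fst a) = \<psi> (snd b) (fst b) else fst a = fst b)"
      using e by (simp add: fibrewise_def split: if_splits)
    then show "a = b" using s permutes_inj[OF assms] by (auto simp: inj_eq prod_eq_iff split: if_splits)
  qed
  then show ?thesis unfolding permutes_UNIV_iff_inj by (rule injI)
qed

lemma sign_fibrewise: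
  fixes J :: "'m::finite set"
  assumes "\<And>j. \<psi> j permutes (UNIV :: 'n::finite set)"
  shows "sign (fibrewise \<psi> J) = (\<Prod>j\<in>J. sign (\<psi> j))"
proof (induction J rule: finite_induct[OF finite])
  case 1
  have "fibrewise \<psi> {} = id" by (auto simp: fibrewise_def fun_eq_iff)
  then show ?case by simp
next
  case (2 j J)
  have e: "fibrewise \<psi> {j} = map_permutation UNIV (\<lambda>i. (i, j)) (\<psi> j)"
  proof
    fix a :: "'n \<times> 'm"
    have "inv (\<lambda>i. (i, j)) (fst a, j) = fst a" by (rule inv_f_f) (simp add: inj_def)
    then show "fibrewise \<psi> {j} a = map_permutation UNIV (\<lambda>i. (i, j)) (\<psi> j) a"
      by (cases a) (auto simp: fibrewise_def map_permutation_def restrict_id_def)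
  qed
  have "sign (fibrewise \<psi> {j}) = sign (\<psi> j)"
    unfolding e by (rule sign_map_permutation) (auto simp: inj_def assms)
  moreover have "fibrewise \<psi> (insert j J) = fibrewise \<psi> {j} \<circ> fibrewise \<psi> J"
    using 2(2) by (auto simp: fibrewise_def fun_eq_iff)
  moreover have "sign (fibrewise \<psi> {j} \<circ> fibrewise \<psi> J) = sign (fibrewise \<psi> {j}) * sign (fibrewise \<psi> J)"
    by (intro sign_compose_UNIV fibrewise_permutes assms)
  ultimately show ?case by (simp only: prod.insert[OF finite 2(2)] 2(3))
qed

text \<open>Only permutations preserving the second coordinate contribute; they are families with
  one permutation per block, so the Leibniz sum factors.\<close>

lemma det_block_diagonal:
  fixes M :: "complex ^ 'n::finite ^ 'n"
  shows "det (\<chi> (a :: 'n \<times> 'm::finite) b. if snd a = snd b then M $ fst a $ fst b else 0) = det M ^ CARD('m)"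
proof -
  let ?P = "{\<pi>. \<pi> permutes (UNIV :: 'n set)}" and ?Q = "{p. p permutes (UNIV :: ('n \<times> 'm) set)}"
  let ?F = "\<lambda>p. of_int (sign p) * (\<Prod>a\<in>UNIV. if snd a = snd (p a) then M $ fst a $ fst (p a) else 0)"
  let ?f = "\<lambda>\<psi>. fibrewise \<psi> (UNIV :: 'm set)"
  let ?Q' = "{p \<in> ?Q. \<forall>a. snd (p a) = snd a}"
  have bij: "bij_betw ?f {\<psi>. \<forall>j. \<psi> j \<in> ?P} ?Q'"
  proof (rule bij_betw_byWitness[of _ "\<lambda>p j i. fst (p (i, j))"])
    show "\<forall>\<psi>\<in>{\<psi>. \<forall>j. \<psi> j \<in> ?P}. (\<lambda>j i. fst (?f \<psi> (i, j))) = \<psi>" by (simp add: fibrewise_def)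
    show "\<forall>p\<in>?Q'. ?f (\<lambda>j i. fst (p (i, j))) = p" by (auto simp: fibrewise_def fun_eq_iff prod_eq_iff)
    show "?f ` {\<psi>. \<forall>j. \<psi> j \<in> ?P} \<subseteq> ?Q'"
    proof (rule image_subsetI)
      fix \<psi> :: "'m \<Rightarrow> 'n \<Rightarrow> 'n" assume "\<psi> \<in> {\<psi>. \<forall>j. \<psi> j \<in> ?P}"
      then show "?f \<psi> \<in> ?Q'" using fibrewise_permutes[of \<psi> UNIV] by (simp add: fibrewise_def)
    qed
    show "(\<lambda>p j i. fst (p (i, j))) ` ?Q' \<subseteq> {\<psi>. \<forall>j. \<psi> j \<in> ?P}"
    proof (rule image_subsetI, clarsimp simp: permutes_UNIV_iff_inj)
      fix p :: "'n \<times> 'm \<Rightarrow> 'n \<times> 'm" and j assume p: "inj p" "\<forall>a b. snd (p (a, b)) = b"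
      show "inj (\<lambda>i. fst (p (i, j)))"
      proof (rule injI)
        fix x y assume "fst (p (x, j)) = fst (p (y, j))"
        then have "p (x, j) = p (y, j)" using p(2) by (simp add: prod_eq_iff)
        then show "x = y" using p(1) by (simp add: inj_eq)
      qed
    qed
  qed
  have "(\<Sum>p\<in>?Q. ?F p) = (\<Sum>p\<in>?Q'. ?F p)"
  proof (rule sum.mono_neutral_right)
    show "\<forall>p\<in>?Q - ?Q'. ?F p = 0"
    proof
      fix p assume "p \<in> ?Q - ?Q'"
      then obtain a where "snd (p a) \<noteq> snd a" by auto
      then have "snd a \<noteq> snd (p a)" by (rule not_sym)
      then have "(\<Prod>a\<in>UNIV. if snd a = snd (p a) then M $ fst a $ fst (p a) else 0) = 0"
        by (intro prod_zero bexI[of _ a]) simp_all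
      then show "?F p = 0" by simp
    qed
  qed auto
  also have "\<dots> = (\<Sum>\<psi>\<in>{\<psi>. \<forall>j. \<psi> j \<in> ?P}. ?F (?f \<psi>))"
    using sum.reindex_bij_betw[OF bij, of ?F] by simp
  also have "\<dots> = (\<Sum>\<psi>\<in>{\<psi>. \<forall>j. \<psi> j \<in> ?P}. \<Prod>j\<in>(UNIV :: 'm set). of_int (sign (\<psi> j)) * (\<Prod>i\<in>UNIV. M $ i $ \<psi> j i))"
  proof (rule sum.cong[OF refl])
    fix \<psi> :: "'m \<Rightarrow> 'n \<Rightarrow> 'n" assume \<psi>: "\<psi> \<in> {\<psi>. \<forall>j. \<psi> j \<in> ?P}"
    have "(\<Prod>a\<in>UNIV. if snd a = snd (?f \<psi> a) then M $ fst a $ fst (?f \<psi> a) else 0) =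
      (\<Prod>a\<in>(UNIV :: 'n set) \<times> (UNIV :: 'm set). M $ fst a $ \<psi> (snd a) (fst a))"
      by (simp add: fibrewise_def)
    also have "\<dots> = (\<Prod>i\<in>UNIV. \<Prod>j\<in>UNIV. M $ i $ \<psi> j i)"
      by (subst prod.cartesian_product) (simp add: case_prod_beta)
    also have "\<dots> = (\<Prod>j\<in>UNIV. \<Prod>i\<in>UNIV. M $ i $ \<psi> j i)" by (rule prod.swap)
    finally show "?F (?f \<psi>) = (\<Prod>j\<in>UNIV. of_int (sign (\<psi> j)) * (\<Prod>i\<in>UNIV. M $ i $ \<psi> j i))"
      using sign_fibrewise[of \<psi> UNIV] \<psi> by (simp add: prod.distrib)
  qed
  also have "\<dots> = (\<Prod>j\<in>(UNIV :: 'm set). \<Sum>\<pi>\<in>?P. of_int (sign \<pi>) * (\<Prod>i\<in>UNIV. M $ i $ \<pi> i))"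
  proof -
    have "PiE UNIV (\<lambda>_. ?P) = {\<psi>. \<forall>j :: 'm. \<psi> j \<in> ?P}" by (auto simp: PiE_def)
    then show ?thesis
      using prod_sum_PiE[of "UNIV :: 'm set" "\<lambda>_. ?P" "\<lambda>_ \<pi>. of_int (sign \<pi>) * (\<Prod>i\<in>UNIV. M $ i $ \<pi> i)"] by simp
  qed
  finally show ?thesis by (simp add: det_def)
qed

section \<open>Polarisation of the determinant\<close>

lemma polarization_det:
  "polarization det A = (\<Sum>\<pi> | \<pi> permutes UNIV. \<Sum>\<sigma> | \<sigma> permutes UNIV. of_int (sign \<pi>) * (\<Prod>i\<in>UNIV. A (\<sigma> i) $ i $ \<pi> i))"
  for A :: "'n \<Rightarrow> complex ^ 'n ^ ('n::finite)"
proof -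
  have "polarization (\<lambda>M :: complex ^ 'n ^ 'n. \<Prod>i\<in>UNIV. M $ i $ \<pi> i) A = (\<Sum>\<sigma> | \<sigma> permutes UNIV. \<Prod>i\<in>UNIV. A (\<sigma> i) $ i $ \<pi> i)" for \<pi>
    by (rule polarization_prod) simp_all
  then show ?thesis
    unfolding det_def polarization_sum polarization_scale by (simp add: sum_distrib_left)
qed

lemma matrix_mul_sum: "M ** (\<Sum>s\<in>S. A s) = (\<Sum>s\<in>S. M ** A s)" for M :: "complex ^ 'n ^ ('n::finite)"
  by (induction S rule: infinite_finite_induct) (simp_all add: matrix_add_ldistrib)

lemma polarization_det_mult:
  "polarization det (\<lambda>s. M ** A s) = det M * polarization det A" for M :: "complex ^ 'n ^ ('n::finite)"
  by (simp add: polarization_def det_mul sum_distrib_left mult.left_commute flip: matrix_mul_sum)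

text \<open>Permutations act transitively on ordered pairs of distinct points, so every pair is the
  image of \<open>(i, j)\<close> equally often.\<close>

lemma sum_permutes_two:
  fixes i j :: "'n::finite" and G :: "'n \<Rightarrow> 'n \<Rightarrow> complex"
  assumes "i \<noteq> j"
  shows "(\<Sum>\<sigma> | \<sigma> permutes UNIV. G (\<sigma> i) (\<sigma> j)) =
    of_nat (card {\<sigma>. \<sigma> permutes UNIV \<and> \<sigma> i = i \<and> \<sigma> j = j}) * (\<Sum>(k, l)\<in>{(k, l). k \<noteq> l}. G k l)"
proof -
  let ?P = "{\<sigma>. \<sigma> permutes (UNIV :: 'n set)}" and ?K = "card {\<sigma>. \<sigma> permutes UNIV \<and> \<sigma> i = i \<and> \<sigma> j = j}"
  have "(\<Sum>\<sigma>\<in>?P. G (\<sigma> i) (\<sigma> j)) = (\<Sum>z\<in>{(k, l). k \<noteq> l}. \<Sum>\<sigma>\<in>{\<sigma> \<in> ?P. (\<sigma> i, \<sigma> j) = z}. G (\<sigma> i) (\<sigma> j))"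
    using assms by (intro sum.group[symmetric]) (auto dest: permutes_inj simp: inj_eq)
  also have "\<dots> = (\<Sum>z\<in>{(k, l). k \<noteq> l}. of_nat ?K * G (fst z) (snd z))"
  proof (rule sum.cong[OF refl])
    fix z :: "'n \<times> 'n" assume "z \<in> {(k, l). k \<noteq> l}"
    then obtain \<rho> where \<rho>: "\<rho> permutes UNIV" "\<rho> i = fst z" "\<rho> j = snd z"
      using ex_permutation2[OF assms, of "fst z" "snd z"] by auto
    have "bij_betw (\<lambda>\<sigma>. \<rho> \<circ> \<sigma>) {\<sigma>. \<sigma> permutes UNIV \<and> \<sigma> i = i \<and> \<sigma> j = j} {\<sigma> \<in> ?P. (\<sigma> i, \<sigma> j) = z}"
    proof (rule bij_betw_byWitness[of _ "\<lambda>\<sigma>. inv \<rho> \<circ> \<sigma>"])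
      show "(\<lambda>\<sigma>. inv \<rho> \<circ> \<sigma>) ` {\<sigma> \<in> ?P. (\<sigma> i, \<sigma> j) = z} \<subseteq> {\<sigma>. \<sigma> permutes UNIV \<and> \<sigma> i = i \<and> \<sigma> j = j}"
        using \<rho> by (auto simp: permutes_compose permutes_inv permutes_inv_eq)
      show "(\<lambda>\<sigma>. \<rho> \<circ> \<sigma>) ` {\<sigma>. \<sigma> permutes UNIV \<and> \<sigma> i = i \<and> \<sigma> j = j} \<subseteq> {\<sigma> \<in> ?P. (\<sigma> i, \<sigma> j) = z}"
        using \<rho> by (auto simp: permutes_compose)
    qed (auto simp: fun_eq_iff permutes_inverses[OF \<rho>(1)])
    then have "card {\<sigma> \<in> ?P. (\<sigma> i, \<sigma> j) = z} = ?K" by (simp add: bij_betw_same_card)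
    moreover have "(\<Sum>\<sigma>\<in>{\<sigma> \<in> ?P. (\<sigma> i, \<sigma> j) = z}. G (\<sigma> i) (\<sigma> j)) = (\<Sum>\<sigma>\<in>{\<sigma> \<in> ?P. (\<sigma> i, \<sigma> j) = z}. G (fst z) (snd z))"
      by (intro sum.cong) auto
    ultimately show "(\<Sum>\<sigma>\<in>{\<sigma> \<in> ?P. (\<sigma> i, \<sigma> j) = z}. G (\<sigma> i) (\<sigma> j)) = of_nat ?K * G (fst z) (snd z)" by simp
  qed
  finally show ?thesis by (simp add: sum_distrib_left case_prod_beta)
qed

text \<open>Up to a constant, the coefficient of \<open>s t\<close> in \<open>det (1 + s Y + t Z)\<close>.\<close>

lemma polarization_det_two:
  fixes i j :: "'n::finite" and Y Z :: "complex ^ 'n ^ 'n"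
  assumes ij: "i \<noteq> j"
  shows "polarization det (\<lambda>s. if s = i then Y else if s = j then Z else mat 1) =
    of_nat (card {\<sigma>. \<sigma> permutes UNIV \<and> \<sigma> i = i \<and> \<sigma> j = j}) * (trace Y * trace Z - trace (Y ** Z))"
proof -
  let ?A = "\<lambda>s. if s = i then Y else if s = j then Z else mat 1"
  let ?P = "{\<sigma>. \<sigma> permutes (UNIV :: 'n set)}"
  let ?G = "\<lambda>k l. Y $ k $ k * Z $ l $ l - Y $ k $ l * Z $ l $ k"
  have inner: "(\<Sum>\<pi>\<in>?P. of_int (sign \<pi>) * (\<Prod>r\<in>UNIV. ?A (inv \<sigma> r) $ r $ \<pi> r)) = ?G (\<sigma> i) (\<sigma> j)"
    if \<sigma>: "\<sigma> \<in> ?P" for \<sigma>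
  proof -
    let ?k = "\<sigma> i" and ?l = "\<sigma> j"
    let ?t = "Transposition.transpose ?k ?l"
    have kl: "?k \<noteq> ?l" using ij permutes_inj[of \<sigma> UNIV] \<sigma> by (simp add: inj_eq)
    have iv: "inv \<sigma> r = i \<longleftrightarrow> r = ?k" "inv \<sigma> r = j \<longleftrightarrow> r = ?l" for r
      using permutes_inv_eq[of \<sigma> UNIV] \<sigma> by auto
    have pr: "(\<Prod>r\<in>UNIV. ?A (inv \<sigma> r) $ r $ \<pi> r) =
      Y $ ?k $ \<pi> ?k * (Z $ ?l $ \<pi> ?l * (\<Prod>r\<in>UNIV - {?k} - {?l}. if r = \<pi> r then 1 else 0))" for \<pi>
    proof -
      have "(\<Prod>r\<in>UNIV - {?k} - {?l}. ?A (inv \<sigma> r) $ r $ \<pi> r) = (\<Prod>r\<in>UNIV - {?k} - {?l}. if r = \<pi> r then 1 else 0)"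
        by (intro prod.cong) (auto simp: iv mat_def)
      then show ?thesis using kl
        by (subst prod.remove[of _ ?k], simp, simp, subst prod.remove[of _ ?l]) (simp_all add: iv ij[symmetric])
    qed
    \<comment> \<open>Outside \<open>?k\<close> and \<open>?l\<close> all rows are those of the
      identity matrix, so only the two permutations supported on these points survive.\<close>
    have "(\<Sum>\<pi>\<in>?P. of_int (sign \<pi>) * (\<Prod>r\<in>UNIV. ?A (inv \<sigma> r) $ r $ \<pi> r)) =
      (\<Sum>\<pi>\<in>{id, ?t}. of_int (sign \<pi>) * (\<Prod>r\<in>UNIV. ?A (inv \<sigma> r) $ r $ \<pi> r))"
    proof (rule sum.mono_neutral_right)
      show "{id, ?t} \<subseteq> ?P" by (auto simp: permutes_id permutes_swap_id)
      show "\<forall>\<pi>\<in>?P - {id, ?t}. of_int (sign \<pi>) * (\<Prod>r\<in>UNIV. ?A (inv \<sigma> r) $ r $ \<pi> r) = 0"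
      proof
        fix \<pi> assume \<pi>: "\<pi> \<in> ?P - {id, ?t}"
        have "\<exists>r\<in>UNIV - {?k} - {?l}. r \<noteq> \<pi> r"
        proof (rule ccontr)
          assume "\<not> ?thesis"
          then have fixes_r: "\<pi> r = r" if "r \<noteq> ?k" "r \<noteq> ?l" for r using that by fastforce
          then have "\<pi> permutes {?k, ?l}" using \<pi> by (auto simp: permutes_def)
          then have "\<pi> = id \<or> \<pi> = ?t" by (simp add: permutes_doubleton_iff)
          then show False using \<pi> by simp
        qed
        then have "(\<Prod>r\<in>UNIV - {?k} - {?l}. if r = \<pi> r then 1 else 0) = (0 :: complex)"
          by (intro prod_zero) auto
        then show "of_int (sign \<pi>) * (\<Prod>r\<in>UNIV. ?A (inv \<sigma> r) $ r $ \<pi> r) = 0" by (simp add: pr)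
      qed
    qed simp
    also have "\<dots> = ?G ?k ?l"
    proof -
      have "?t \<noteq> id" using kl by (metis id_apply transpose_apply_first)
      moreover have "(\<Prod>r\<in>UNIV - {?k} - {?l}. if r = ?t r then 1 else 0) = (1 :: complex)"
        by (intro prod.neutral) (auto simp: Transposition.transpose_def)
      moreover have "(\<Prod>r\<in>UNIV - {?k} - {?l}. if r = id r then 1 else 0) = (1 :: complex)" by simp
      ultimately show ?thesis unfolding pr using kl by (simp add: sign_swap_id)
    qed
    finally show ?thesis .
  qed
  have "polarization det ?A = (\<Sum>\<sigma>\<in>?P. \<Sum>\<pi>\<in>?P. of_int (sign \<pi>) * (\<Prod>r\<in>UNIV. ?A (\<sigma> r) $ r $ \<pi> r))"
    unfolding polarization_det by (rule sum.swap)
  also have "\<dots> = (\<Sum>\<sigma>\<in>?P. \<Sum>\<pi>\<in>?P. of_int (sign \<pi>) * (\<Prod>r\<in>UNIV. ?A (inv \<sigma> r) $ r $ \<pi> r))"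
    by (rule sum_permutes_inv[symmetric])
  also have "\<dots> = (\<Sum>\<sigma>\<in>?P. ?G (\<sigma> i) (\<sigma> j))" by (rule sum.cong[OF refl inner])
  also have "\<dots> = of_nat (card {\<sigma>. \<sigma> permutes UNIV \<and> \<sigma> i = i \<and> \<sigma> j = j}) * (\<Sum>(k, l)\<in>{(k, l). k \<noteq> l}. ?G k l)"
    by (rule sum_permutes_two[OF ij])
  also have "(\<Sum>(k, l)\<in>{(k, l). k \<noteq> l}. ?G k l) = trace Y * trace Z - trace (Y ** Z)"
  proof -
    \<comment> \<open>\<open>?G k k\<close> is 0, so the diagonal can be included.\<close>
    have "(\<Sum>(k, l)\<in>{(k, l). k \<noteq> l}. ?G k l) = (\<Sum>(k, l)\<in>UNIV \<times> UNIV. ?G k l)"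
      by (rule sum.mono_neutral_left) auto
    also have "\<dots> = (\<Sum>k\<in>UNIV. \<Sum>l\<in>UNIV. ?G k l)" by (simp add: sum.cartesian_product)
    finally show ?thesis
      by (simp add: trace_def matrix_matrix_mult_def sum_subtractf sum_product)
  qed
  finally show ?thesis .
qed

section \<open>The trace form on the orbit of the determinant\<close>

text \<open>With \<open>X\<^sub>a\<close> the matrix in row \<open>a\<close> of \<open>g\<close> and \<open>Y\<^sub>a = X\<^sub>0\<^sup>-\<^sup>1 X\<^sub>a\<close>, the traces
  \<open>tr (Y\<^sub>a Y\<^sub>b)\<close> are rational in the coefficients of \<open>g det\<close>, and their determinant is a power of
  \<open>det X\<^sub>0\<close> times \<open>(det g)\<^sup>2\<close>.\<close>

lemma det_trace_form:
  "\<exists>\<epsilon>. \<epsilon> \<noteq> 0 \<and> (\<forall>(g :: complex ^ ('n \<times> 'n) ^ ('n \<times> 'n::finite)) (M :: complex ^ 'n ^ 'n).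
    det (\<chi> a b. trace ((M ** (\<chi> i j. g $ a $ (i, j))) ** (M ** (\<chi> i j. g $ b $ (i, j))))) =
      \<epsilon> * (det g * det M ^ CARD('n)) ^ 2)"
proof -
  define S :: "complex ^ ('n \<times> 'n) ^ ('n \<times> 'n)" where "S = (\<chi> a b. if fst a = snd b \<and> snd a = fst b then 1 else 0)"
  have "S ** S = mat 1"
  proof -
    have "(\<Sum>c\<in>UNIV. S $ a $ c * S $ c $ b) = (\<Sum>c\<in>UNIV. if c = (snd a, fst a) then (if a = b then 1 else 0) else 0)" for a b
      by (intro sum.cong) (auto simp: S_def prod_eq_iff)
    then show ?thesis by (simp add: matrix_matrix_mult_def mat_def vec_eq_iff)
  qed
  then have "det S * det S = 1" by (metis det_I det_mul)
  then have S0: "det S \<noteq> 0" by auto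
  have "det (\<chi> a b. trace ((M ** (\<chi> i j. g $ a $ (i, j))) ** (M ** (\<chi> i j. g $ b $ (i, j))))) =
    det S * (det g * det M ^ CARD('n)) ^ 2" for g :: "complex ^ ('n \<times> 'n) ^ ('n \<times> 'n)" and M :: "complex ^ 'n ^ 'n"
  proof -
    define L :: "complex ^ ('n \<times> 'n) ^ ('n \<times> 'n)" where "L = (\<chi> a b. if snd a = snd b then transpose M $ fst a $ fst b else 0)"
    define Y where "Y a = M ** (\<chi> i j. g $ a $ (i, j))" for a
    have V: "(g ** L) $ a $ (i, j) = Y a $ i $ j" for a i j
    proof -
      have "(g ** L) $ a $ (i, j) = (\<Sum>(k, l)\<in>UNIV \<times> UNIV. if l = j then g $ a $ (k, l) * M $ i $ k else 0)"
        unfolding matrix_matrix_mult_def L_def transpose_def UNIV_Times_UNIV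
        by (simp, intro sum.cong) (auto split: prod.splits)
      also have "\<dots> = (\<Sum>k\<in>UNIV. \<Sum>l\<in>UNIV. if l = j then g $ a $ (k, l) * M $ i $ k else 0)"
        by (rule sum.cartesian_product[symmetric])
      also have "\<dots> = Y a $ i $ j" by (simp add: Y_def matrix_matrix_mult_def mult.commute)
      finally show ?thesis .
    qed
    have "(\<chi> a b. trace (Y a ** Y b)) = (g ** L) ** S ** transpose (g ** L)"
    proof -
      have "((g ** L) ** S ** transpose (g ** L)) $ a $ b = trace (Y a ** Y b)" for a b
      proof -
        have VS: "((g ** L) ** S) $ a $ c = (g ** L) $ a $ (snd c, fst c)" for c
        proof -
          have "(\<Sum>d\<in>UNIV. (g ** L) $ a $ d * S $ d $ c) = (\<Sum>d\<in>UNIV. if d = (snd c, fst c) then (g ** L) $ a $ (snd c, fst c) else 0)"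
            by (intro sum.cong) (auto simp: S_def prod_eq_iff)
          then show ?thesis by (simp add: matrix_matrix_mult_def[of "g ** L"])
        qed
        have "((g ** L) ** S ** transpose (g ** L)) $ a $ b = (\<Sum>c\<in>UNIV. ((g ** L) ** S) $ a $ c * (g ** L) $ b $ c)"
          by (simp add: matrix_matrix_mult_def[of "(g ** L) ** S"] transpose_def)
        also have "\<dots> = (\<Sum>(k, l)\<in>UNIV \<times> UNIV. Y a $ l $ k * Y b $ k $ l)"
          unfolding VS UNIV_Times_UNIV by (intro sum.cong) (auto simp: V)
        also have "\<dots> = (\<Sum>l\<in>UNIV. \<Sum>k\<in>UNIV. Y a $ l $ k * Y b $ k $ l)"
          by (subst sum.cartesian_product[symmetric], rule sum.swap)
        finally show ?thesis by (simp add: trace_def matrix_matrix_mult_def[of "Y a"])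
      qed
      then show ?thesis by (simp add: vec_eq_iff)
    qed
    moreover have "det L = det M ^ CARD('n)"
      unfolding L_def by (simp only: det_block_diagonal det_transpose)
    ultimately show ?thesis
      by (simp add: Y_def det_mul power2_eq_square mult_ac)
  qed
  then show ?thesis using S0 by (intro exI[of _ "det S"]) simp
qed

text \<open>Tensor entries are polarised determinants of the matrices \<open>W g a\<close>. With
  \<open>X = W g a0\<close> in all but two places they yield the traces of \<open>X^-1 W g a\<close>
  and of products of two such matrices, hence the trace form.\<close>

lemma det_form_not_normal:
  assumes n: "CARD('n::finite) > 2"
  shows "\<not> normal_variety (orbit_closure CARD('n) (det_form :: ('n \<times> 'n) cpoly))"
proof -
  let ?n = "CARD('n)"
  obtain \<omega> s P where "\<forall>c. (\<forall>\<beta>\<in>graphs. c \<beta> \<noteq> 0) \<longrightarrow> balanced_form (graphs :: ('n \<Rightarrow> 'n \<times> 'n) set) c \<omega> s P"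
    using ex_balanced_graphs[where 'n = 'n] by blast
  moreover define c where "c \<beta> = complex_of_int (sign (snd \<circ> \<beta>))" for \<beta> :: "'n \<Rightarrow> 'n \<times> 'n"
  ultimately have bal: "balanced_form (graphs :: ('n \<Rightarrow> 'n \<times> 'n) set) c \<omega> s P"
    by (simp add: sign_def)
  interpret balanced_form "graphs :: ('n \<Rightarrow> 'n \<times> 'n) set" c \<omega> s P by (rule bal)
  have cg: "c (graph_map \<pi>) = of_int (sign \<pi>)" for \<pi>
  proof -
    have "snd \<circ> graph_map \<pi> = \<pi>" by (auto simp: graph_map_def)
    then show ?thesis by (simp add: c_def)
  qed
  have form: "form = det_form"
  proof -
    have "Const (complex_of_int (sign \<pi>)) = (of_int (sign \<pi>) :: ('n \<times> 'n) cpoly)" for \<pi> :: "'n \<Rightarrow> 'n"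
      by (auto simp: sign_def Const_def single_uminus)
    then show ?thesis by (simp add: form_def det_form_def sum_graphs cg) (simp add: graph_map_def)
  qed
  define W where "W g a = (\<chi> i j. g $ a $ (i, j))" for g :: "complex ^ ('n \<times> 'n) ^ ('n \<times> 'n)" and a
  have tens_X: "tens g \<theta> = polarization det (\<lambda>i. W g (\<theta> i))" for g \<theta>
  proof -
    have "tens g \<theta> = (\<Sum>\<tau> | \<tau> permutes UNIV. \<Sum>\<pi> | \<pi> permutes UNIV. of_int (sign \<pi>) * (\<Prod>i\<in>UNIV. W g (\<theta> (\<tau> i)) $ i $ \<pi> i))"
      unfolding tens_alt sum_graphs cg by (simp add: graph_map_def W_def)
    then show ?thesis unfolding polarization_det by (subst sum.swap) simp
  qed
  obtain i j :: 'n where ij: "i \<noteq> j" using ex_two_others[OF n] by blast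
  define a0 :: "'n \<times> 'n" where "a0 = undefined"
  define K where "K = (of_nat (card {\<sigma>. \<sigma> permutes UNIV \<and> \<sigma> i = i \<and> \<sigma> j = j}) :: complex)"
  have K: "K \<noteq> 0"
  proof -
    have "id \<in> {\<sigma>. \<sigma> permutes UNIV \<and> \<sigma> i = i \<and> \<sigma> j = j}" by (simp add: permutes_id)
    then show ?thesis unfolding K_def by (metis (no_types, lifting) card_gt_0_iff empty_iff finite of_nat_eq_0_iff less_irrefl)
  qed
  define U where "U g a b = tens g (\<lambda>s. if s = i then a else if s = j then b else a0)" for g a b
  obtain T where T: "\<And>\<theta>. T \<theta> \<in> polynomial_maps" "\<And>\<theta> g. T \<theta> (gl_act g form) = tens g \<theta>"
    using tens_regular by metis
  define u where "u a b = T (\<lambda>s. if s = i then a else if s = j then b else a0)" for a b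
  have u: "u a b \<in> polynomial_maps" "u a b (gl_act g form) = U g a b" for a b g
    using T by (simp_all add: u_def U_def)
  have U: "U g a b = det (W g a0) * (K * (trace Y * trace Z - trace (Y ** Z)))"
    if "W g a = W g a0 ** Y" "W g b = W g a0 ** Z" for g a b Y Z
  proof -
    have "U g a b = polarization det (\<lambda>s. W g a0 ** (if s = i then Y else if s = j then Z else mat 1))"
      unfolding U_def tens_X by (intro arg_cong[of _ _ "polarization det"]) (auto simp: that fun_eq_iff)
    then show ?thesis unfolding polarization_det_mult polarization_det_two[OF ij] K_def .
  qed
  let ?N = "of_nat ?n :: complex"
  have tr1: "trace (mat 1 :: complex ^ 'n ^ 'n) = ?N" by (simp add: trace_def mat_def)
  \<comment> \<open>\<open>c0\<close> is the two-place polarisation at \<open>Y = Z = 1\<close>;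
    \<open>\<kappa>\<close> is the constant that remains in \<open>t\<close> below.\<close>
  define c0 where "c0 = K * (?N * ?N - ?N)"
  define \<kappa> where "\<kappa> = K ^ 2 * (?N * (?N - 1) ^ 2)"
  have N1: "?N - 1 \<noteq> 0" "?N \<noteq> 0" using n by (auto simp flip: of_nat_diff)
  have c0: "c0 \<noteq> 0"
  proof -
    have "c0 = K * (?N * (?N - 1))" by (simp add: c0_def algebra_simps)
    then show ?thesis using K N1 by simp
  qed
  have \<kappa>: "\<kappa> \<noteq> 0" using K N1 by (simp add: \<kappa>_def)
  have U00: "U g a0 a0 = c0 * det (W g a0)" for g
    using U[of g a0 "mat 1" a0 "mat 1"] by (simp add: tr1 c0_def)
  define q where "q p = (1 / c0) * u a0 a0 p" for p
  have q: "q \<in> polynomial_maps" "q (gl_act g form) = det (W g a0)" for g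
  proof -
    show "q \<in> polynomial_maps" unfolding q_def by (intro polynomial_maps.mult polynomial_maps.const u)
    show "q (gl_act g form) = det (W g a0)" for g using c0 by (simp add: q_def u(2) U00)
  qed
  \<comment> \<open>The weights make \<open>tr Y * tr Z\<close> cancel: on the orbit
    \<open>t a b\<close> becomes \<open>\<kappa> * (det X)^2 * tr (Y Z)\<close>, without division by
    \<open>det X\<close>.\<close>
  define t where "t a b p = ?N * (u a a0 p * u b a0 p) - (?N - 1) * (u a0 a0 p * u a b p)" for a b p
  have t: "t a b \<in> polynomial_maps" for a b
    unfolding t_def by (intro polynomial_maps_diff polynomial_maps.mult polynomial_maps.const u)
  define dt where "dt p = det (\<chi> a b. t a b p)" for p
  have dt: "dt \<in> polynomial_maps"
    unfolding dt_def det_def by (simp, intro polynomial_maps_sum polynomial_maps.mult polynomial_maps.const polynomial_maps_prod t)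
  obtain \<epsilon> where \<epsilon>: "\<epsilon> \<noteq> 0" "\<And>(g :: complex ^ ('n \<times> 'n) ^ ('n \<times> 'n)) (M :: complex ^ 'n ^ 'n).
    det (\<chi> a b. trace ((M ** W g a) ** (M ** W g b))) = \<epsilon> * (det g * det M ^ ?n) ^ 2"
    using det_trace_form[where 'n = 'n] unfolding W_def by blast
  define m where "m = CARD('n \<times> 'n)"
  have main: "dt (gl_act g form) * det (W g a0) ^ (2 * ?n) = \<kappa> ^ m * \<epsilon> * det (W g a0) ^ (2 * m) * det g ^ 2"
    if nz: "det (W g a0) \<noteq> 0" for g
  proof -
    let ?d = "det (W g a0)"
    have "invertible (W g a0)" using nz by (simp add: invertible_det_nz)
    then obtain M where M: "W g a0 ** M = mat 1" "M ** W g a0 = mat 1" unfolding invertible_def by blast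
    have Y: "W g a = W g a0 ** (M ** W g a)" for a by (simp add: matrix_mul_assoc M)
    have Y0: "W g a0 = W g a0 ** mat 1" by simp
    have Ua: "U g a a0 = ?d * (K * ((?N - 1) * trace (M ** W g a)))" for a
      using U[OF Y Y0] by (simp add: tr1 algebra_simps)
    have tt: "t a b (gl_act g form) = (\<kappa> * ?d ^ 2) * trace ((M ** W g a) ** (M ** W g b))" for a b
      unfolding t_def u(2) Ua U00 unfolding U[OF Y Y] c0_def \<kappa>_def
      by (simp add: power2_eq_square algebra_simps)
    have "dt (gl_act g form) = det (\<chi> a. (\<kappa> * ?d ^ 2) *s (\<chi> b. trace ((M ** W g a) ** (M ** W g b))))"
      unfolding dt_def tt by (intro arg_cong[of _ _ det]) (simp add: vec_eq_iff)
    also have "\<dots> = (\<kappa> * ?d ^ 2) ^ m * (\<epsilon> * (det g * det M ^ ?n) ^ 2)"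
      using det_rows_mul[of "\<lambda>_. \<kappa> * ?d ^ 2" "\<lambda>a. \<chi> b. trace ((M ** W g a) ** (M ** W g b))"]
      by (simp add: \<epsilon>(2) m_def)
    \<comment> \<open>The factor \<open>det X ^ (2 n)\<close> clears the powers of
      \<open>det M = 1 / det X\<close>.\<close>
    finally have "dt (gl_act g form) * ?d ^ (2 * ?n) = (\<kappa> * ?d ^ 2) ^ m * \<epsilon> * det g ^ 2 * (det M * ?d) ^ (2 * ?n)"
      by (simp add: power_mult_distrib power_mult[symmetric] mult_ac)
    moreover have "det M * ?d = 1" using M(2) by (metis det_I det_mul)
    ultimately show ?thesis by (simp add: power_mult_distrib power_mult[symmetric] mult_ac)
  qed
  \<comment> \<open>The extra factor \<open>q\<close> in both exponents makes the identity trivial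
    where \<open>det X = 0\<close>.\<close>
  define E where "E p = \<kappa> ^ m * \<epsilon> * q p ^ (2 * m + 1)" for p
  define F where "F p = dt p * q p ^ (2 * ?n + 1)" for p
  have "E \<in> polynomial_maps" "F \<in> polynomial_maps"
    unfolding E_def F_def by (intro polynomial_maps.mult polynomial_maps.const polynomial_maps_power q dt)+
  moreover have "det g ^ 2 * E (gl_act g form) = F (gl_act g form)" for g
  proof (cases "det (W g a0) = 0")
    case False
    then show ?thesis using main[OF False] by (simp add: E_def F_def q(2) mult_ac)
  qed (simp add: E_def F_def q(2))
  moreover have "\<exists>p\<in>gl_orbit form. E p \<noteq> 0"
  proof (rule ccontr)
    assume neg: "\<not> ?thesis"
    have "q (gl_act g form) = 0" if "invertible g" for g
      using neg that \<kappa> \<epsilon>(1) unfolding gl_orbit_def E_def by auto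
    then have z: "q (gl_act g form) = 0" for g
      by (rule line_poly_zero_if_invertible[OF line_poly_orbit[OF q(1)]])
    \<comment> \<open>Every row of \<open>h\<close> is the flattened identity matrix. Its
      singularity is harmless, as the vanishing of \<open>q\<close> was extended to all
      matrices.\<close>
    define h :: "complex ^ ('n \<times> 'n) ^ ('n \<times> 'n)" where "h = (\<chi> a b. if fst b = snd b then 1 else 0)"
    have "W h a0 = mat 1" by (simp add: W_def h_def mat_def vec_eq_iff)
    then show False using z[of h] by (simp add: q(2))
  qed
  ultimately have "\<not> normal_variety (orbit_closure CARD('n) form)" by (intro not_normal n) blast
  then show ?thesis by (simp add: form)
qed

theorem corollary3p29:
  shows "(CARD('m::finite) > 2 \<longrightarrow>
            \<not> normal_variety (orbit_closure CARD('m) (prod_form :: 'm cpoly))) \<and>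
         (CARD('n::finite) > 2 \<longrightarrow>
            \<not> normal_variety (orbit_closure CARD('n) (det_form :: ('n \<times> 'n) cpoly)) \<and>
            \<not> normal_variety (orbit_closure CARD('n) (per_form :: ('n \<times> 'n) cpoly)))"
  using prod_form_not_normal det_form_not_normal per_form_not_normal by blast

end
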